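(* Let $n=2\ell$ with $\ell\ge1$ and let $\bar a=(a_1,\ldots,a_t)$ be a composition of $r$, with $1\le r\le\ell$. Let $\mathfrak p=\mathfrak p_n^{-1}(\bar a)\subset\mathfrak{sp}_{n}(\mathbb C)$ be the stabiliser of the standard flag of isotropic subspaces determined by $\bar a$. Then $$M_*(\mathfrak p)=\mathfrak{so}_{a_1}\oplus\cdots\oplus\mathfrak{so}_{a_t}\oplus\mathfrak{sp}_{n-2r},$$ embedded in the obvious way (each $\mathfrak{so}_{a_i}\subset\mathfrak{gl}_{a_i}$) in the Levi subalgebra $\mathfrak{gl}_{a_1}\oplus\cdots\oplus\mathfrak{gl}_{a_t}\oplus\mathfrak{sp}_{n-2r}$ of $\mathfrak p$.
   Context: General notions (over $\mathbb C$). Let $Q$ be a connected linear algebraic group with Lie algebra $\mathfrak q$ and centre $Z$. For $\gamma\in\mathfrak q^*$ let $Q_\gamma$, $\mathfrak q_\gamma$ be the stabilisers for the coadjoint action. $\gamma$ is of reductive type if $Q_\gamma/Z$ is a reductive subgroup of $GL(\mathfrak q)$, and of nilpotent type if $\gamma(\mathfrak q_\gamma)=0$. $\mathfrak q$ is quasi-reductive if it has a linear form of reductive type, and strongly quasi-reductive if in addition $\mathrm{Lie}\,Z$ consists of semisimple elements (automatic for parabolic subalgebras of semisimple Lie algebras). If $\mathfrak q$ is strongly quasi-reductive, the linear forms that are both of reductive and of nilpotent type form one single coadjoint orbit $Q\gamma$; $Q_\gamma$ is called a maximal reductive stabiliser, and its Lie algebra, defined up to conjugation by $Q$, is denoted $M_*(\mathfrak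 q)$. (All parabolic subalgebras of $\mathfrak{sp}_{2\ell}$ are known to be quasi-reductive.) Flags. $\mathbb C^n$ carries a non-degenerate alternating form, with $\mathfrak{sp}_n$ the Lie algebra preserving it. A composition $\bar a=(a_1,\ldots,a_t)$ of $r\le\ell$ determines a (standard) flag of isotropic subspaces $0=V_0\subsetneq V_1\subsetneq\cdots\subsetneq V_t$ with $\dim V_i-\dim V_{i-1}=a_i$ (so $\dim V_t=r$). $\mathfrak p_n^{-1}(\bar a)$ is its stabiliser in $\mathfrak{sp}_n$. Conventions: $\mathfrak{sp}_0=0$, $\mathfrak{so}_0=\mathfrak{so}_1=0$, $\mathfrak{so}_2\cong\mathbb C$. *)

theory Defs
  imports
    Complex_Main
    "HOL-Algebra.Bij"
    "HOL-Algebra.Coset"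
    "Jordan_Normal_Form.Gauss_Jordan_Elimination"
begin

section \<open>Zariski topology\<close>

text \<open>The algebra of functions generated by the constants and a set \<open>C\<close> of coordinate functions.\<close>

inductive_set poly_functions :: "('a \<Rightarrow> complex) set \<Rightarrow> ('a \<Rightarrow> complex) set"
  for C :: "('a \<Rightarrow> complex) set"
where
  const: "(\<lambda>_. c) \<in> poly_functions C"
| coord: "f \<in> C \<Longrightarrow> f \<in> poly_functions C"
| add: "f \<in> poly_functions C \<Longrightarrow> g \<in> poly_functions C \<Longrightarrow> (\<lambda>x. f x + g x) \<in> poly_functions C"
| mult: "f \<in> poly_functions C \<Longrightarrow> g \<in> poly_functions C \<Longrightarrow> (\<lambda>x. f x * g x) \<in> poly_functions C"

definition zariski_closed_in ::
  "('a \<Rightarrow> complex) set \<Rightarrow> 'a set \<Rightarrow> 'a set \<Rightarrow> bool" where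
  "zariski_closed_in C H S \<longleftrightarrow>
     (\<exists>F \<subseteq> poly_functions C. S = {x \<in> H. \<forall>f\<in>F. f x = 0})"

definition zariski_connected :: "('a \<Rightarrow> complex) set \<Rightarrow> 'a set \<Rightarrow> bool" where
  "zariski_connected C U \<longleftrightarrow>
     \<not> (\<exists>A B. zariski_closed_in C U A \<and> zariski_closed_in C U B \<and>
            A \<noteq> {} \<and> B \<noteq> {} \<and> A \<inter> B = {} \<and> A \<union> B = U)"

definition mat_coords :: "nat \<Rightarrow> (complex mat \<Rightarrow> complex) set" where
  "mat_coords n = {\<lambda>A. A $$ (i, j) | i j. i < n \<and> j < n}"

text \<open>Coordinates on the endomorphisms of a space \<open>W\<close> of \<open>n \<times> n\<close> matrices: the functionals
  \<open>\<phi> \<mapsto> (\<phi> X)\<^sub>i\<^sub>j\<close>, for \<open>X \<in> W\<close>, span the dual of \<open>End W\<close>.\<close>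

definition End_coords :: "nat \<Rightarrow> complex mat set \<Rightarrow> ((complex mat \<Rightarrow> complex mat) \<Rightarrow> complex) set" where
  "End_coords n W = {\<lambda>\<phi>. \<phi> X $$ (i, j) | X i j. X \<in> W \<and> i < n \<and> j < n}"


section \<open>Reductive subgroups of \<open>GL(W)\<close>\<close>

definition GL_on :: "complex mat set \<Rightarrow> (complex mat \<Rightarrow> complex mat) monoid" where
  "GL_on W = BijGroup W \<lparr>carrier := {\<phi> \<in> Bij W.
     (\<forall>X\<in>W. \<forall>Y\<in>W. \<phi> (X + Y) = \<phi> X + \<phi> Y) \<and>
     (\<forall>c. \<forall>X\<in>W. \<phi> (c \<cdot>\<^sub>m X) = c \<cdot>\<^sub>m \<phi> X)}\<rparr>"

definition unipotent_on :: "nat \<Rightarrow> complex mat set \<Rightarrow> (complex mat \<Rightarrow> complex mat) \<Rightarrow> bool" where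
  "unipotent_on n W \<phi> \<longleftrightarrow> (\<exists>k. \<forall>X\<in>W. ((\<lambda>Y. \<phi> Y - Y) ^^ k) X = 0\<^sub>m n n)"

text \<open>The unipotent radical is trivial. This is meant for algebraic (i.e. Zariski closed)
  subgroups \<open>H\<close>, for which closed in \<open>H\<close> is the same as closed in \<open>GL(W)\<close>. It is applied
  below to images of algebraic groups under \<open>Ad\<close>, which are always closed.\<close>

definition reductive_subgroup ::
  "nat \<Rightarrow> complex mat set \<Rightarrow> (complex mat \<Rightarrow> complex mat) set \<Rightarrow> bool" where
  "reductive_subgroup n W H \<longleftrightarrow> subgroup H (GL_on W) \<and>
     (\<forall>U. U \<lhd> ((GL_on W)\<lparr>carrier := H\<rparr>) \<and>
          zariski_closed_in (End_coords n W) H U \<and>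
          zariski_connected (End_coords n W) U \<and>
          (\<forall>\<phi>\<in>U. unipotent_on n W \<phi>) \<longrightarrow> U = {\<one>\<^bsub>GL_on W\<^esub>})"


section \<open>Linear algebraic groups and linear forms on their Lie algebras\<close>

text \<open>Throughout, \<open>Q\<close> stands for a connected Zariski closed subgroup of \<open>GL\<^sub>n(\<complex>)\<close>. Its Lie
  algebra is the Zariski tangent space at the identity: the \<open>X\<close> along which the differential
  at \<open>1\<close> of every polynomial vanishing on the group is zero.\<close>

definition lie_algebra :: "nat \<Rightarrow> complex mat set \<Rightarrow> complex mat set" where
  "lie_algebra n Q = {X \<in> carrier_mat n n.
     \<forall>f \<in> poly_functions (mat_coords n). (\<forall>g\<in>Q. f g = 0) \<longrightarrow>
       ((\<lambda>t. f (1\<^sub>m n + t \<cdot>\<^sub>m X)) has_field_derivative 0) (at 0)}"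

definition centre :: "complex mat set \<Rightarrow> complex mat set" where
  "centre Q = {z \<in> Q. \<forall>g\<in>Q. z * g = g * z}"

definition conj_by :: "complex mat \<Rightarrow> complex mat \<Rightarrow> complex mat" where
  "conj_by g X = g * X * the (mat_inverse g)"

definition Ad :: "nat \<Rightarrow> complex mat set \<Rightarrow> complex mat \<Rightarrow> complex mat \<Rightarrow> complex mat" where
  "Ad n Q g = restrict (conj_by g) (lie_algebra n Q)"

definition lie_dual :: "nat \<Rightarrow> complex mat set \<Rightarrow> (complex mat \<Rightarrow> complex) set" where
  "lie_dual n Q = {\<gamma> \<in> extensional (lie_algebra n Q).
     (\<forall>X\<in>lie_algebra n Q. \<forall>Y\<in>lie_algebra n Q. \<gamma> (X + Y) = \<gamma> X + \<gamma> Y) \<and>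
     (\<forall>c. \<forall>X\<in>lie_algebra n Q. \<gamma> (c \<cdot>\<^sub>m X) = c * \<gamma> X)}"

text \<open>Stabilisers for the coadjoint actions of \<open>Q\<close> and of its Lie algebra; a form is fixed by
  \<open>g\<close> iff it is fixed by \<open>g\<^sup>-\<^sup>1\<close>.\<close>

definition group_stab ::
  "nat \<Rightarrow> complex mat set \<Rightarrow> (complex mat \<Rightarrow> complex) \<Rightarrow> complex mat set" where
  "group_stab n Q \<gamma> = {g \<in> Q. \<forall>X\<in>lie_algebra n Q. \<gamma> (Ad n Q g X) = \<gamma> X}"

definition lie_stab ::
  "nat \<Rightarrow> complex mat set \<Rightarrow> (complex mat \<Rightarrow> complex) \<Rightarrow> complex mat set" where
  "lie_stab n Q \<gamma> = {X \<in> lie_algebra n Q. \<forall>Y\<in>lie_algebra n Q. \<gamma> (X * Y - Y * X) = 0}"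

text \<open>As \<open>Q\<close> is connected, its centre \<open>Z\<close> is the kernel of \<open>Ad\<close>; so the quotient by \<open>Z\<close> of
  the stabiliser is, as a subgroup of the general linear group of the Lie algebra, its image
  under \<open>Ad\<close>.\<close>

definition reductive_type :: "nat \<Rightarrow> complex mat set \<Rightarrow> (complex mat \<Rightarrow> complex) \<Rightarrow> bool" where
  "reductive_type n Q \<gamma> \<longleftrightarrow> reductive_subgroup n (lie_algebra n Q) (Ad n Q ` group_stab n Q \<gamma>)"

definition nilpotent_type :: "nat \<Rightarrow> complex mat set \<Rightarrow> (complex mat \<Rightarrow> complex) \<Rightarrow> bool" where
  "nilpotent_type n Q \<gamma> \<longleftrightarrow> (\<forall>X\<in>lie_stab n Q \<gamma>. \<gamma> X = 0)"

definition semisimple_mat :: "complex mat \<Rightarrow> bool" where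
  "semisimple_mat X \<longleftrightarrow> (\<exists>D. diagonal_mat D \<and> similar_mat X D)"

definition quasi_reductive :: "nat \<Rightarrow> complex mat set \<Rightarrow> bool" where
  "quasi_reductive n Q \<longleftrightarrow> (\<exists>\<gamma>\<in>lie_dual n Q. reductive_type n Q \<gamma>)"

definition strongly_quasi_reductive :: "nat \<Rightarrow> complex mat set \<Rightarrow> bool" where
  "strongly_quasi_reductive n Q \<longleftrightarrow>
     quasi_reductive n Q \<and> (\<forall>X\<in>lie_algebra n (centre Q). semisimple_mat X)"

text \<open>\<open>M\<^sub>*\<close> is only defined up to conjugation by \<open>Q\<close>. Here it is the set of the Lie algebras of
  all maximal reductive stabilisers; that this is a single conjugacy class is not built in.\<close>

definition M_star :: "nat \<Rightarrow> complex mat set \<Rightarrow> complex mat set set" where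
  "M_star n Q = {lie_algebra n (group_stab n Q \<gamma>) | \<gamma>.
     strongly_quasi_reductive n Q \<and> \<gamma> \<in> lie_dual n Q \<and>
     reductive_type n Q \<gamma> \<and> nilpotent_type n Q \<gamma>}"

definition conj_class :: "complex mat set \<Rightarrow> complex mat set \<Rightarrow> complex mat set set" where
  "conj_class Q L = {conj_by g ` L | g. g \<in> Q}"


section \<open>Parabolic subalgebras of the symplectic Lie algebra\<close>

text \<open>The alternating form on \<open>\<complex>\<^sup>2\<^sup>l\<close> is the one with antidiagonal Gram matrix, so that the first
  \<open>l\<close> vectors of the standard basis span a Lagrangian subspace.\<close>

definition symp_form :: "nat \<Rightarrow> complex mat" where
  "symp_form l = mat (2 * l) (2 * l)
     (\<lambda>(i, j). if i + j + 1 = 2 * l then (if i < l then 1 else - 1) else 0)"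

definition Sp_group :: "nat \<Rightarrow> complex mat set" where
  "Sp_group l = {g \<in> carrier_mat (2 * l) (2 * l).
     transpose_mat g * symp_form l * g = symp_form l}"

definition sp_alg :: "nat \<Rightarrow> complex mat set" where
  "sp_alg l = {X \<in> carrier_mat (2 * l) (2 * l).
     transpose_mat X * symp_form l + symp_form l * X = 0\<^sub>m (2 * l) (2 * l)}"

definition so_alg :: "nat \<Rightarrow> complex mat set" where
  "so_alg a = {A \<in> carrier_mat a a. transpose_mat A = - A}"

text \<open>The \<open>i\<close>-th space of the standard flag is spanned by the first \<open>a\<^sub>1 + \<dots> + a\<^sub>i\<close> standard
  basis vectors; it is isotropic if this number is at most \<open>l\<close>.\<close>

definition std_flag :: "nat \<Rightarrow> nat list \<Rightarrow> nat \<Rightarrow> complex vec set" where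
  "std_flag l as i = {v \<in> carrier_vec (2 * l).
     \<forall>j < 2 * l. sum_list (take i as) \<le> j \<longrightarrow> v $ j = 0}"

definition parabolic_group :: "nat \<Rightarrow> nat list \<Rightarrow> complex mat set" where
  "parabolic_group l as = {g \<in> Sp_group l.
     \<forall>i \<le> length as. (\<lambda>v. g *\<^sub>v v) ` std_flag l as i = std_flag l as i}"

definition parabolic_alg :: "nat \<Rightarrow> nat list \<Rightarrow> complex mat set" where
  "parabolic_alg l as = {X \<in> sp_alg l.
     \<forall>i \<le> length as. (\<lambda>v. X *\<^sub>v v) ` std_flag l as i \<subseteq> std_flag l as i}"

definition antitranspose :: "complex mat \<Rightarrow> complex mat" where
  "antitranspose A = mat (dim_col A) (dim_row A)
     (\<lambda>(i, j). A $$ (dim_row A - 1 - j, dim_col A - 1 - i))"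

text \<open>The embedding of \<open>gl\<^bsub>a\<^sub>1\<^esub> \<oplus> \<dots> \<oplus> gl\<^bsub>a\<^sub>t\<^esub> \<oplus> sp\<^bsub>2l - 2r\<^esub>\<close> into \<open>sp\<^bsub>2l\<^esub>\<close> as a Levi subalgebra of the
  parabolic: \<open>gl\<^bsub>a\<^sub>i\<^esub>\<close> also acts on the block dual to the \<open>i\<close>-th one, and for the antidiagonal
  form the dual of \<open>A\<close> is \<open>- antitranspose A\<close>.\<close>

definition levi_embed :: "complex mat list \<Rightarrow> complex mat \<Rightarrow> complex mat" where
  "levi_embed As B = diag_block_mat (As @ [B] @ rev (map (\<lambda>A. - antitranspose A) As))"

definition so_sum_sp :: "nat \<Rightarrow> nat list \<Rightarrow> complex mat set" where
  "so_sum_sp l as = {levi_embed As B | As B.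
     list_all2 (\<lambda>A a. A \<in> so_alg a) As as \<and> B \<in> sp_alg (l - sum_list as)}"

end

theory Submission
  imports Defs "Jordan_Normal_Form.Schur_Decomposition"
begin

text \<open>Let \<open>\<gamma>\<close> be a linear form on the parabolic subalgebra \<open>p\<close> of the flag \<open>V\<^sub>1 \<subset> \<dots> \<subset> V\<^sub>t\<close>. Its
  restriction to the abelian ideal \<open>S\<^sup>2 V\<^sub>t\<close> of \<open>p\<close> is a quadratic form \<open>q\<close> on \<open>V\<^sub>t\<close>. The elements of this
  ideal that stabilise \<open>\<gamma>\<close> exponentiate to a normal unipotent subgroup of the stabiliser; if \<open>\<gamma>\<close> is of
  reductive type it is trivial, and hence \<open>q\<close> is nondegenerate on every \<open>V\<^sub>i\<close>. An orthonormal basis of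
  \<open>V\<^sub>t\<close> adapted to the flag and the action of the unipotent radical then bring \<open>\<gamma>\<close> to the form
  \<open>X \<mapsto> tr ((F\<^sub>0 + D) X)\<close>, where \<open>F\<^sub>0\<close> represents the standard quadratic form and \<open>D\<close> lies in
  \<open>L = so\<^bsub>a\<^sub>1\<^esub> \<oplus> \<dots> \<oplus> so\<^bsub>a\<^sub>t\<^esub> \<oplus> sp\<^bsub>2l - 2r\<^esub>\<close>. Every element of the stabiliser of this form commutes with \<open>D\<close>
  and stabilises \<open>F\<^sub>0\<close>. If \<open>\<gamma>\<close> is of nilpotent type, the odd powers of \<open>D\<close> show that all traces
  \<open>tr D\<^sup>2\<^sup>k\<close> vanish, so \<open>D\<close> is nilpotent; were it nonzero, a suitable odd power would generate a
  central unipotent subgroup of the stabiliser. So \<open>\<gamma>\<close> is conjugate to \<open>tr (F\<^sub>0 _)\<close>.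

  Conversely, the stabiliser of \<open>tr (F\<^sub>0 _)\<close> is closed under conjugate transposition. In such a group a
  unipotent normal subgroup \<open>U\<close> is trivial: for \<open>u \<in> U\<close> the commutator \<open>(u\<^sup>*)\<^sup>-\<^sup>1 u u\<^sup>* u\<^sup>-\<^sup>1\<close> is both in
  \<open>U\<close> and self-adjoint, hence \<open>1\<close>; so \<open>u\<close> is normal as well as unipotent, hence \<open>1\<close>.\<close>

section \<open>Matrix entries, traces and conjugation\<close>

text \<open>A reductive subgroup is tested only against Zariski closed unipotent subgroups, so
  exhibiting a unipotent normal subgroup of a stabiliser is not enough: it must be shown to be
  closed. This comes from a polynomial map that recovers Z from Ad(exp Z). For Z in the ideal of V_t
  it reads Z off the image of a grading element; for a central nilpotent it reads a scalar off a
  last nonvanishing bracket. Every nilpotent that is exponentiated has vanishing cube, so its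
  exponential is a quadratic polynomial. Nondegeneracy of q on V_i rests on the rule [v^2, Y] = -2
  (Yv) v: as Y preserves V_i, a vector v in the radical of q on V_i has a square that stabilises the
  form. Odd powers of D appear because an orthogonal or symplectic Lie algebra is closed under odd
  powers only; the values of the form at them are the traces of the even powers. That the forms of
  both types make up one orbit is not taken from general theory but read off the explicit normal
  form.\<close>

lemma mult_entry:
  assumes "A \<in> carrier_mat n n" "B \<in> carrier_mat n n" "i < n" "j < n"
  shows "(A * B) $$ (i, j) = (\<Sum>k<n. A $$ (i, k) * B $$ (k, j))"
  using assms by (auto simp: scalar_prod_def atLeast0LessThan intro!: sum.cong)

definition tr :: "complex mat \<Rightarrow> complex" where
  "tr A = (\<Sum>i<dim_row A. A $$ (i, i))"

lemma tr_carrier: "A \<in> carrier_mat n n \<Longrightarrow> tr A = (\<Sum>i<n. A $$ (i, i))"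
  by (auto simp: tr_def)

lemma tr_mult:
  assumes "A \<in> carrier_mat n n" "B \<in> carrier_mat n n"
  shows "tr (A * B) = (\<Sum>i<n. \<Sum>k<n. A $$ (i, k) * B $$ (k, i))"
proof -
  have "tr (A * B) = (\<Sum>i<n. (A * B) $$ (i, i))"
    using assms by (intro tr_carrier) auto
  then show ?thesis using assms by (simp add: mult_entry del: index_mult_mat)
qed

lemma tr_comm:
  assumes "A \<in> carrier_mat n n" "B \<in> carrier_mat n n"
  shows "tr (A * B) = tr (B * A)"
  unfolding tr_mult[OF assms] tr_mult[OF assms(2,1)]
  by (subst sum.swap) (simp add: mult.commute)

lemma tr_add: "A \<in> carrier_mat n n \<Longrightarrow> B \<in> carrier_mat n n \<Longrightarrow> tr (A + B) = tr A + tr B"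
  by (auto simp: tr_def sum.distrib)

lemma tr_minus: "A \<in> carrier_mat n n \<Longrightarrow> B \<in> carrier_mat n n \<Longrightarrow> tr (A - B) = tr A - tr B"
  by (auto simp: tr_def sum_subtractf)

lemma tr_smult: "A \<in> carrier_mat n n \<Longrightarrow> tr (c \<cdot>\<^sub>m A) = c * tr A"
  by (auto simp: tr_def sum_distrib_left intro!: sum.cong)

lemma tr_uminus: "A \<in> carrier_mat n n \<Longrightarrow> tr (- A) = - tr A"
  by (auto simp: tr_def sum_negf[symmetric] intro!: sum.cong)

text \<open>\<open>conj_by\<close> is defined through \<open>mat_inverse\<close>; a left inverse
  already determines its value, so that \<open>adj g\<close> can take its place for symplectic
  \<open>g\<close>.\<close>

lemma mat_inverse_unique:
  assumes g: "g \<in> carrier_mat n n" and h: "h \<in> carrier_mat n n" and hg: "h * g = 1\<^sub>m n"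
  shows "the (mat_inverse g) = h"
proof -
  have gh: "g * h = 1\<^sub>m n" using mat_mult_left_right_inverse[OF h g hg] .
  have "mat_inverse g \<noteq> None"
  proof
    assume "mat_inverse g = None"
    from mat_inverse(1)[OF g this, of undefined] g h hg gh show False
      by (auto simp: Units_def ring_mat_def)
  qed
  then obtain B where B: "mat_inverse g = Some B" by auto
  from mat_inverse(2)[OF g B] have "g * B = 1\<^sub>m n" "B \<in> carrier_mat n n" by auto
  have "B = h * g * B" using hg \<open>B \<in> _\<close> by simp
  also have "\<dots> = h * (g * B)" using g h \<open>B \<in> _\<close> by simp
  also have "\<dots> = h" using \<open>g * B = _\<close> h by simp
  finally show ?thesis using B by simp
qed

section \<open>Symplectic involution\<close>

text \<open>An index \<open>i\<close> belongs to the \<open>lv i\<close>-th block of the flag completed by the orthogonal spaces of its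
  members; the \<open>t\<close> blocks below \<open>r\<close> span the isotropic part. The index \<open>du i\<close> is dual to \<open>i\<close> under the
  antidiagonal form, \<open>adj X\<close> is the adjoint of \<open>X\<close> for this form, and \<open>tr (F0 * X)\<close> is the linear form
  that is the standard quadratic form on \<open>S\<^sup>2 V\<^sub>t\<close> and zero elsewhere.\<close>

locale levelled =
  fixes l r t :: nat and lv :: "nat \<Rightarrow> nat"
  assumes r_le: "r \<le> l"
    and lv_mono: "\<And>i j. i \<le> j \<Longrightarrow> j < 2 * l \<Longrightarrow> lv i \<le> lv j"
    and lv_dual: "\<And>i. i < 2 * l \<Longrightarrow> lv (2 * l - 1 - i) + lv i = 2 * t"
    and lv_first: "\<And>i. i < r \<Longrightarrow> lv i < t"
    and lv_mid: "\<And>i. r \<le> i \<Longrightarrow> i < 2 * l - r \<Longrightarrow> lv i = t"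
begin

abbreviation n where "n \<equiv> 2 * l"
abbreviation M :: "complex mat set" where "M \<equiv> carrier_mat n n"
abbreviation du where "du i \<equiv> n - Suc i"
definition sg :: "nat \<Rightarrow> complex" where "sg i = (if i < l then 1 else -1)"
definition adj :: "complex mat \<Rightarrow> complex mat" where
  "adj X = mat n n (\<lambda>(i, j). sg i * sg j * X $$ (du j, du i))"
definition UT where "UT X \<longleftrightarrow> (\<forall>i<n. \<forall>j<n. lv j < lv i \<longrightarrow> X $$ (i, j) = 0)"
definition BD where "BD X \<longleftrightarrow> (\<forall>i<n. \<forall>j<n. lv i \<noteq> lv j \<longrightarrow> X $$ (i, j) = 0)"
definition Sp where "Sp = {g \<in> M. adj g * g = 1\<^sub>m n}"
definition sp where "sp = {X \<in> M. adj X = - X}"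
definition Pg where "Pg = {g \<in> Sp. UT g}"
definition pa where "pa = {X \<in> sp. UT X}"
definition F0 :: "complex mat" where
  "F0 = mat n n (\<lambda>(i, j). if j < r \<and> i = du j then 1 else 0)"
text \<open>For a symplectic block diagonal matrix, agreement of the blocks below \<open>r\<close>
  with their mirror images under \<open>du\<close> makes these blocks orthogonal for the standard
  symmetric form, while the middle block stays symplectic. So this is a product of orthogonal groups
  and one symplectic group; \<open>La\<close> is its Lie algebra.\<close>

definition Sg where "Sg = {h \<in> Pg. BD h \<and> (\<forall>i<r. \<forall>j<r. h $$ (du i, du j) = h $$ (i, j))}"
definition La where "La = {X \<in> pa. BD X \<and> (\<forall>i<r. \<forall>j<r. X $$ (du i, du j) = X $$ (i, j))}"

lemma M_closed [simp]:
  "A \<in> M \<Longrightarrow> B \<in> M \<Longrightarrow> A * B \<in> M"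
  "A \<in> M \<Longrightarrow> B \<in> M \<Longrightarrow> A + B \<in> M"
  "A \<in> M \<Longrightarrow> B \<in> M \<Longrightarrow> A - B \<in> M"
  "A \<in> M \<Longrightarrow> - A \<in> M"
  "A \<in> M \<Longrightarrow> c \<cdot>\<^sub>m A \<in> M"
  by auto

lemma mult_M:
  assumes "A \<in> M" "B \<in> M"
  shows "C \<in> M \<Longrightarrow> A * B * C = A * (B * C)"
    "C \<in> M \<Longrightarrow> A * (B + C) = A * B + A * C" "C \<in> M \<Longrightarrow> (A + B) * C = A * C + B * C"
    "C \<in> M \<Longrightarrow> A * (B - C) = A * B - A * C" "C \<in> M \<Longrightarrow> (A - B) * C = A * C - B * C"
    "A * (c \<cdot>\<^sub>m B) = c \<cdot>\<^sub>m (A * B)" "(c \<cdot>\<^sub>m A) * B = c \<cdot>\<^sub>m (A * B)"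
    "A * (- B) = - (A * B)" "(- A) * B = - (A * B)"
  using assms
  by (simp_all add: assoc_mult_mat[of _ n n _ n _ n] mult_add_distrib_mat[of _ n n _ n]
    add_mult_distrib_mat[of _ n n] mult_minus_distrib_mat[of _ n n _ n] minus_mult_distrib_mat[of _ n n]
    mult_smult_distrib[of _ n n _ n] mult_smult_assoc_mat[of _ n n _ n])

lemma lv_du: "i < n \<Longrightarrow> lv (du i) + lv i = 2 * t"
  using lv_dual[of i] by simp

lemma sg_sq [simp]: "sg i * sg i = 1" "sg i * (sg i * x) = x"
  by (auto simp: sg_def)

lemma sg_du: "i < n \<Longrightarrow> sg (du i) = - sg i"
  by (auto simp: sg_def)

lemma adj_carrier [simp]: "adj X \<in> M" by (simp add: adj_def)
lemma adj_dim [simp]: "dim_row (adj X) = n" "dim_col (adj X) = n" by (simp_all add: adj_def)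

lemma adj_entry: "i < n \<Longrightarrow> j < n \<Longrightarrow> adj X $$ (i, j) = sg i * sg j * X $$ (du j, du i)"
  by (simp add: adj_def)

lemma sum_du: "(\<Sum>k<n. f k) = (\<Sum>k<n. f (du k))"
  by (rule sum.nat_diff_reindex[symmetric])

lemma adj_mult: assumes "A \<in> M" "B \<in> M" shows "adj (A * B) = adj B * adj A"
proof (rule eq_matI)
  fix i j assume "i < dim_row (adj B * adj A)" "j < dim_col (adj B * adj A)"
  then have ij: "i < n" "j < n" by auto
  have "adj (A * B) $$ (i, j) = sg i * sg j * (\<Sum>k<n. A $$ (du j, k) * B $$ (k, du i))"
    using ij assms by (subst adj_entry) (auto simp: mult_entry simp del: index_mult_mat)
  also have "\<dots> = sg i * sg j * (\<Sum>k<n. A $$ (du j, du k) * B $$ (du k, du i))"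
    by (subst sum_du) simp
  also have "\<dots> = (\<Sum>k<n. adj B $$ (i, k) * adj A $$ (k, j))"
    unfolding sum_distrib_left using ij by (intro sum.cong) (auto simp: adj_entry)
  also have "\<dots> = (adj B * adj A) $$ (i, j)"
    using ij by (subst mult_entry[where n=n]) auto
  finally show "adj (A * B) $$ (i, j) = (adj B * adj A) $$ (i, j)" .
qed auto

lemma adj_adj: assumes "A \<in> M" shows "adj (adj A) = A"
  using assms by (intro eq_matI) (auto simp: adj_entry sg_du)

lemma adj_one [simp]: "adj (1\<^sub>m n) = 1\<^sub>m n"
  by (intro eq_matI) (auto simp: adj_entry)

lemma adj_add: "A \<in> M \<Longrightarrow> B \<in> M \<Longrightarrow> adj (A + B) = adj A + adj B"
  by (intro eq_matI) (auto simp: adj_entry algebra_simps)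

lemma adj_minus: "A \<in> M \<Longrightarrow> B \<in> M \<Longrightarrow> adj (A - B) = adj A - adj B"
  by (intro eq_matI) (auto simp: adj_entry algebra_simps)

lemma adj_smult: "A \<in> M \<Longrightarrow> adj (c \<cdot>\<^sub>m A) = c \<cdot>\<^sub>m adj A"
  by (intro eq_matI) (auto simp: adj_entry)

lemma adj_zero: "adj (0\<^sub>m n n) = 0\<^sub>m n n"
  by (intro eq_matI) (auto simp: adj_entry)

lemma tr_adj: assumes "A \<in> M" shows "tr (adj A) = tr A"
proof -
  have "tr (adj A) = (\<Sum>i<n. A $$ (du i, du i))"
    using assms by (subst tr_carrier[where n=n]) (auto simp: adj_entry intro!: sum.cong)
  also have "\<dots> = tr A" using assms sum_du[of "\<lambda>i. A $$ (i, i)"] by (simp add: tr_carrier[of A n])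
  finally show ?thesis .
qed

lemma UT_adj: assumes "UT X" shows "UT (adj X)"
  unfolding UT_def
proof (intro allI impI)
  fix i j assume ij: "i < n" "j < n" "lv j < lv i"
  have "lv (du i) < lv (du j)" using lv_du[of i] lv_du[of j] ij by linarith
  moreover have "du i < n" "du j < n" using ij by auto
  ultimately have "X $$ (du j, du i) = 0" using assms unfolding UT_def by blast
  then show "adj X $$ (i, j) = 0" using ij by (simp add: adj_entry)
qed

lemma UT_mult: assumes "A \<in> M" "B \<in> M" "UT A" "UT B" shows "UT (A * B)"
  unfolding UT_def
proof (intro allI impI)
  fix i j assume ij: "i < n" "j < n" "lv j < lv i"
  have "A $$ (i, k) * B $$ (k, j) = 0" if "k < n" for k
    using assms(3,4) ij that unfolding UT_def by (cases "lv k < lv i") auto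
  then show "(A * B) $$ (i, j) = 0" using ij assms mult_entry[of A n B i j] by (auto intro: sum.neutral)
qed

lemma UT_one: "UT (1\<^sub>m n)" by (auto simp: UT_def)
lemma UT_add: "A \<in> M \<Longrightarrow> B \<in> M \<Longrightarrow> UT A \<Longrightarrow> UT B \<Longrightarrow> UT (A + B)" by (auto simp: UT_def)
lemma UT_minus: "A \<in> M \<Longrightarrow> B \<in> M \<Longrightarrow> UT A \<Longrightarrow> UT B \<Longrightarrow> UT (A - B)" by (auto simp: UT_def)
lemma UT_smult: "A \<in> M \<Longrightarrow> UT A \<Longrightarrow> UT (c \<cdot>\<^sub>m A)" by (auto simp: UT_def)

lemma BD_UT: "BD X \<Longrightarrow> UT X" unfolding BD_def UT_def by (metis less_irrefl)

lemma BD_mult: assumes "A \<in> M" "B \<in> M" "BD A" "BD B" shows "BD (A * B)"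
  unfolding BD_def
proof (intro allI impI)
  fix i j assume ij: "i < n" "j < n" "lv i \<noteq> lv j"
  have "A $$ (i, k) * B $$ (k, j) = 0" if "k < n" for k
    using assms(3,4) ij that unfolding BD_def by (cases "lv k = lv i") auto
  then show "(A * B) $$ (i, j) = 0" using ij assms mult_entry[of A n B i j] by (auto intro: sum.neutral)
qed

subsection \<open>The parabolic group and its adjoint action\<close>

lemma Sp_M: "g \<in> Sp \<Longrightarrow> g \<in> M" by (simp add: Sp_def)
lemma Sp_adj_left: "g \<in> Sp \<Longrightarrow> adj g * g = 1\<^sub>m n" by (simp add: Sp_def)
lemma Sp_adj_right: "g \<in> Sp \<Longrightarrow> g * adj g = 1\<^sub>m n"
  by (metis Sp_M Sp_adj_left adj_carrier mat_mult_left_right_inverse)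
lemma Sp_adj: "g \<in> Sp \<Longrightarrow> adj g \<in> Sp"
  using Sp_adj_right[of g] Sp_M[of g] unfolding Sp_def by (simp add: adj_adj)
lemma Pg_Sp: "g \<in> Pg \<Longrightarrow> g \<in> Sp" by (simp add: Pg_def)
lemma Pg_M: "g \<in> Pg \<Longrightarrow> g \<in> M" by (simp add: Pg_def Sp_M)
lemma Pg_UT: "g \<in> Pg \<Longrightarrow> UT g" by (simp add: Pg_def)
lemma Pg_adj: "g \<in> Pg \<Longrightarrow> adj g \<in> Pg" by (simp add: Pg_def Sp_adj UT_adj)
lemma Sp_one: "1\<^sub>m n \<in> Sp" by (simp add: Sp_def)
lemma Pg_one: "1\<^sub>m n \<in> Pg" by (simp add: Pg_def Sp_one UT_one)

lemma Sp_mult: assumes "g \<in> Sp" "h \<in> Sp" shows "g * h \<in> Sp"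
proof -
  have c: "g \<in> M" "h \<in> M" using assms by (auto simp: Sp_M)
  have "adj (g * h) * (g * h) = adj h * (adj g * g) * h"
    using c by (simp only: adj_mult mult_M M_closed adj_carrier)
  also have "\<dots> = 1\<^sub>m n" using assms c by (simp add: Sp_adj_left)
  finally show ?thesis using c by (simp add: Sp_def)
qed

lemma Pg_mult: "g \<in> Pg \<Longrightarrow> h \<in> Pg \<Longrightarrow> g * h \<in> Pg"
  by (simp add: Pg_def Sp_mult UT_mult Sp_M)

lemma sp_M: "X \<in> sp \<Longrightarrow> X \<in> M" by (simp add: sp_def)
lemma sp_adj: "X \<in> sp \<Longrightarrow> adj X = - X" by (simp add: sp_def)
lemma pa_sp: "X \<in> pa \<Longrightarrow> X \<in> sp" by (simp add: pa_def)
lemma pa_M: "X \<in> pa \<Longrightarrow> X \<in> M" by (simp add: pa_def sp_M)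
lemma pa_UT: "X \<in> pa \<Longrightarrow> UT X" by (simp add: pa_def)

lemma conj_by_Sp: "g \<in> Sp \<Longrightarrow> conj_by g X = g * X * adj g"
  unfolding conj_by_def by (subst mat_inverse_unique) (auto simp: Sp_M Sp_adj_left)

lemma conj_by_M: "g \<in> Sp \<Longrightarrow> X \<in> M \<Longrightarrow> conj_by g X \<in> M"
  by (simp add: conj_by_Sp Sp_M)

lemma conj_by_one: "X \<in> M \<Longrightarrow> conj_by (1\<^sub>m n) X = X"
  by (simp add: conj_by_Sp Sp_one)

lemma conj_by_mult: assumes "g \<in> Sp" "h \<in> Sp" "X \<in> M"
  shows "conj_by (g * h) X = conj_by g (conj_by h X)"
proof -
  have c: "g \<in> M" "h \<in> M" using assms by (auto simp: Sp_M)
  show ?thesis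
    using assms c by (simp add: conj_by_Sp Sp_mult adj_mult mult_M)
qed

lemma conj_by_adj: "g \<in> Sp \<Longrightarrow> X \<in> M \<Longrightarrow> conj_by (adj g) (conj_by g X) = X"
  using conj_by_mult[of "adj g" g X] by (simp add: Sp_adj Sp_adj_left conj_by_one)

lemma conj_by_adj': "g \<in> Sp \<Longrightarrow> X \<in> M \<Longrightarrow> conj_by g (conj_by (adj g) X) = X"
  using conj_by_mult[of g "adj g" X] by (simp add: Sp_adj Sp_adj_right conj_by_one)

lemma conj_by_add: assumes "g \<in> Sp" "X \<in> M" "Y \<in> M"
  shows "conj_by g (X + Y) = conj_by g X + conj_by g Y"
  using assms Sp_M[OF assms(1)]
  by (simp add: conj_by_Sp mult_M)

lemma conj_by_minus: assumes "g \<in> Sp" "X \<in> M" "Y \<in> M"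
  shows "conj_by g (X - Y) = conj_by g X - conj_by g Y"
  using assms Sp_M[OF assms(1)]
  by (simp add: conj_by_Sp mult_M)

lemma conj_by_smult: assumes "g \<in> Sp" "X \<in> M"
  shows "conj_by g (c \<cdot>\<^sub>m X) = c \<cdot>\<^sub>m conj_by g X"
  using assms Sp_M[OF assms(1)] by (simp add: conj_by_Sp mult_M)

lemma conj_by_times: assumes "g \<in> Sp" "X \<in> M" "Y \<in> M"
  shows "conj_by g (X * Y) = conj_by g X * conj_by g Y"
proof -
  have c: "g \<in> M" using assms by (auto simp: Sp_M)
  have "conj_by g X * conj_by g Y = g * X * (adj g * g) * Y * adj g"
    using assms c by (simp add: conj_by_Sp mult_M)
  then show ?thesis using assms c by (simp add: conj_by_Sp Sp_adj_left mult_M)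
qed

lemma conj_by_adjoint: assumes "g \<in> Sp" "X \<in> M" shows "adj (conj_by g X) = conj_by g (adj X)"
  using assms Sp_M[OF assms(1)] by (simp add: conj_by_Sp adj_mult adj_adj mult_M)

lemma conj_by_uminus: assumes "g \<in> Sp" "X \<in> M"
  shows "conj_by g (- X) = - conj_by g X"
proof -
  have *: "(-1) \<cdot>\<^sub>m X = - X" for X :: "complex mat" by (intro eq_matI) auto
  show ?thesis using conj_by_smult[OF assms, of "-1"] unfolding * .
qed

lemma conj_by_UT: "g \<in> Pg \<Longrightarrow> X \<in> M \<Longrightarrow> UT X \<Longrightarrow> UT (conj_by g X)"
  by (simp add: conj_by_Sp Pg_Sp UT_mult Pg_M Pg_UT UT_adj)

lemma conj_by_sp: "g \<in> Sp \<Longrightarrow> X \<in> sp \<Longrightarrow> conj_by g X \<in> sp"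
  by (simp add: sp_def conj_by_M conj_by_adjoint conj_by_uminus)

lemma conj_by_pa: "g \<in> Pg \<Longrightarrow> X \<in> pa \<Longrightarrow> conj_by g X \<in> pa"
  by (simp add: pa_def conj_by_sp Pg_Sp conj_by_UT sp_M)

lemma tr_conj_by: assumes "g \<in> Sp" "X \<in> M" shows "tr (conj_by g X) = tr X"
proof -
  have c: "g \<in> M" using assms by (auto simp: Sp_M)
  have "tr (conj_by g X) = tr (adj g * (g * X))" using c assms
    by (subst tr_comm[of _ n]) (auto simp: conj_by_Sp)
  also have "adj g * (g * X) = adj g * g * X" using c assms by (simp add: mult_M)
  finally show ?thesis using assms by (simp add: Sp_adj_left)
qed

end

section \<open>Normal unipotent subgroups of a self-adjoint group\<close>

locale mat_subspace =
  fixes n :: nat and W :: "complex mat set"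
  assumes W_carrier: "W \<subseteq> carrier_mat n n"
    and W_zero: "0\<^sub>m n n \<in> W"
    and W_add: "X \<in> W \<Longrightarrow> Y \<in> W \<Longrightarrow> X + Y \<in> W"
    and W_smult: "X \<in> W \<Longrightarrow> c \<cdot>\<^sub>m X \<in> W"
begin

lemma minus_eq: "X \<in> W \<Longrightarrow> Y \<in> W \<Longrightarrow> X - Y = X + (-1) \<cdot>\<^sub>m Y"
  using W_carrier by (intro eq_matI) auto

lemma W_minus: "X \<in> W \<Longrightarrow> Y \<in> W \<Longrightarrow> X - Y \<in> W"
  by (simp add: minus_eq W_add W_smult)

lemma W_minus_self: "X \<in> W \<Longrightarrow> X - X = 0\<^sub>m n n"
  using W_carrier by auto

lemma W_eqI: "X \<in> W \<Longrightarrow> Y \<in> W \<Longrightarrow> X - Y = 0\<^sub>m n n \<Longrightarrow> X = Y"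
proof (intro eq_matI)
  fix i j assume *: "X \<in> W" "Y \<in> W" "X - Y = 0\<^sub>m n n" "i < dim_row Y" "j < dim_col Y"
  have c: "X \<in> carrier_mat n n" "Y \<in> carrier_mat n n" using * W_carrier by auto
  have "X $$ (i, j) - Y $$ (i, j) = (X - Y) $$ (i, j)" using *(4,5) by simp
  also have "\<dots> = 0" using *(3-5) c by simp
  finally show "X $$ (i, j) = Y $$ (i, j)" by simp
qed (use W_carrier in auto)

lemma GL_carrier: "\<phi> \<in> carrier (GL_on W) \<longleftrightarrow> \<phi> \<in> Bij W \<and>
    (\<forall>X\<in>W. \<forall>Y\<in>W. \<phi> (X + Y) = \<phi> X + \<phi> Y) \<and> (\<forall>c. \<forall>X\<in>W. \<phi> (c \<cdot>\<^sub>m X) = c \<cdot>\<^sub>m \<phi> X)"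
  by (simp add: GL_on_def)

lemma GL_mult: "\<phi> \<in> Bij W \<Longrightarrow> \<psi> \<in> Bij W \<Longrightarrow> \<phi> \<otimes>\<^bsub>GL_on W\<^esub> \<psi> = compose W \<phi> \<psi>"
  by (simp add: GL_on_def BijGroup_def)

lemma GL_one: "\<one>\<^bsub>GL_on W\<^esub> = (\<lambda>X\<in>W. X)"
  by (simp add: GL_on_def BijGroup_def)

lemma group_GL: "group (GL_on W)"
proof -
  define H where "H = {\<phi> \<in> Bij W.
     (\<forall>X\<in>W. \<forall>Y\<in>W. \<phi> (X + Y) = \<phi> X + \<phi> Y) \<and>
     (\<forall>c. \<forall>X\<in>W. \<phi> (c \<cdot>\<^sub>m X) = c \<cdot>\<^sub>m \<phi> X)}"
  have mem: "\<phi> X \<in> W" if "\<phi> \<in> Bij W" "X \<in> W" for \<phi> X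
    using Bij_imp_funcset[OF that(1)] that(2) by auto
  have "subgroup H (BijGroup W)"
  proof (rule subgroup.intro)
    show "H \<subseteq> carrier (BijGroup W)" by (auto simp: H_def BijGroup_def)
  next
    fix x y assume "x \<in> H" "y \<in> H"
    then show "x \<otimes>\<^bsub>BijGroup W\<^esub> y \<in> H"
      by (auto simp: H_def BijGroup_def compose_Bij compose_def W_add W_smult mem intro: compose_Bij[unfolded compose_def])
  next
    show "\<one>\<^bsub>BijGroup W\<^esub> \<in> H" by (auto simp: H_def BijGroup_def id_Bij W_add W_smult)
  next
    fix x assume x: "x \<in> H"
    then have xB: "x \<in> Bij W" by (simp add: H_def)
    have "inv_into W x (X + Y) = inv_into W x X + inv_into W x Y" if "X \<in> W" "Y \<in> W" for X Y
      using x that by (intro Bij_inv_into_lemma) (auto simp: H_def W_add)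
    moreover have "inv_into W x (c \<cdot>\<^sub>m X) = c \<cdot>\<^sub>m inv_into W x X" if "X \<in> W" for X c
      using Bij_inv_into_lemma[of W x "\<lambda>X Y. c \<cdot>\<^sub>m X" X X] x that by (auto simp: H_def W_smult)
    ultimately show "inv\<^bsub>BijGroup W\<^esub> x \<in> H"
      using xB by (auto simp: H_def inv_BijGroup restrict_inv_into_Bij W_add W_smult)
  qed
  then have "group ((BijGroup W)\<lparr>carrier := H\<rparr>)"
    by (rule subgroup.subgroup_is_group) (rule group_BijGroup)
  then show ?thesis by (simp add: GL_on_def H_def)
qed

lemma GL_mem: "\<phi> \<in> carrier (GL_on W) \<Longrightarrow> X \<in> W \<Longrightarrow> \<phi> X \<in> W"
  using Bij_imp_funcset[of \<phi> W] by (auto simp: GL_carrier)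

lemma GL_mult_apply: "\<phi> \<in> carrier (GL_on W) \<Longrightarrow> \<psi> \<in> carrier (GL_on W) \<Longrightarrow> X \<in> W \<Longrightarrow>
    (\<phi> \<otimes>\<^bsub>GL_on W\<^esub> \<psi>) X = \<phi> (\<psi> X)"
  by (simp add: GL_mult GL_carrier compose_def)

lemma GL_minus: assumes "\<phi> \<in> carrier (GL_on W)" "X \<in> W" "Y \<in> W" shows "\<phi> (X - Y) = \<phi> X - \<phi> Y"
proof -
  have "\<phi> (X - Y) = \<phi> X + (-1) \<cdot>\<^sub>m \<phi> Y"
    using assms by (simp add: minus_eq GL_carrier W_smult)
  then show ?thesis using assms by (simp add: minus_eq GL_mem)
qed

lemma GL_inv_apply:
  assumes "\<phi> \<in> carrier (GL_on W)" "X \<in> W"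
  shows "\<phi> ((inv\<^bsub>GL_on W\<^esub> \<phi>) X) = X" "(inv\<^bsub>GL_on W\<^esub> \<phi>) (\<phi> X) = X"
proof -
  interpret G: group "GL_on W" by (rule group_GL)
  have "(\<phi> \<otimes>\<^bsub>GL_on W\<^esub> inv\<^bsub>GL_on W\<^esub> \<phi>) X = X" "(inv\<^bsub>GL_on W\<^esub> \<phi> \<otimes>\<^bsub>GL_on W\<^esub> \<phi>) X = X"
    using assms by (simp_all add: GL_one)
  then show "\<phi> ((inv\<^bsub>GL_on W\<^esub> \<phi>) X) = X" "(inv\<^bsub>GL_on W\<^esub> \<phi>) (\<phi> X) = X"
    unfolding GL_mult_apply[OF assms(1) G.inv_closed[OF assms(1)] assms(2)]
      GL_mult_apply[OF G.inv_closed[OF assms(1)] assms] by auto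
qed

lemma GL_eqI: "\<phi> \<in> carrier (GL_on W) \<Longrightarrow> \<psi> \<in> carrier (GL_on W) \<Longrightarrow> (\<And>X. X \<in> W \<Longrightarrow> \<phi> X = \<psi> X) \<Longrightarrow> \<phi> = \<psi>"
  by (auto simp: GL_carrier Bij_def intro: extensionalityI)

end

locale mat_inner = mat_subspace +
  fixes B :: "complex mat \<Rightarrow> complex mat \<Rightarrow> complex"
  assumes B_minus: "X \<in> W \<Longrightarrow> Y \<in> W \<Longrightarrow> Z \<in> W \<Longrightarrow> B (X - Y) Z = B X Z - B Y Z"
    and B_herm: "X \<in> W \<Longrightarrow> Y \<in> W \<Longrightarrow> B X Y = cnj (B Y X)"
    and B_definite: "X \<in> W \<Longrightarrow> B X X = 0 \<Longrightarrow> X = 0\<^sub>m n n"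
begin

lemma B_minus2: "X \<in> W \<Longrightarrow> Y \<in> W \<Longrightarrow> Z \<in> W \<Longrightarrow> B Z (X - Y) = B Z X - B Z Y"
  using B_minus[of X Y Z] by (metis B_herm W_minus complex_cnj_diff)

lemma B_zero: "X \<in> W \<Longrightarrow> B (0\<^sub>m n n) X = 0"
  using B_minus[of X X X] W_minus_self[of X] by simp

lemma B_zero2: "X \<in> W \<Longrightarrow> B X (0\<^sub>m n n) = 0"
  using B_minus2[of X X X] W_minus_self[of X] by simp

text \<open>Normality gives NZ and N'Z the same length. With Z = NX, the induction hypothesis NZ = 0
  therefore yields N'Z = 0, and then NX has length zero. The base case is not void: N 0 = 0 is
  itself extracted from the adjoint relation.\<close>

lemma normal_nilpotent:
  assumes mem: "\<And>X. X \<in> W \<Longrightarrow> N X \<in> W" "\<And>X. X \<in> W \<Longrightarrow> N' X \<in> W"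
    and adj: "\<And>X Y. X \<in> W \<Longrightarrow> Y \<in> W \<Longrightarrow> B (N X) Y = B X (N' Y)"
    and comm: "\<And>X. X \<in> W \<Longrightarrow> N (N' X) = N' (N X)"
  shows "X \<in> W \<Longrightarrow> (N ^^ k) X = 0\<^sub>m n n \<Longrightarrow> N X = 0\<^sub>m n n"
proof (induction k arbitrary: X)
  case 0
  have "N X \<in> W" using 0 mem by auto
  then have "B (N X) (N X) = 0" using 0 adj[of X "N X"] mem B_zero[of "N' (N X)"] by auto
  then show ?case using B_definite \<open>N X \<in> W\<close> by auto
next
  case (Suc k)
  define Z where "Z = N X"
  have XW: "X \<in> W" and ZW: "Z \<in> W" using Suc mem Z_def by auto
  have "(N ^^ k) Z = 0\<^sub>m n n" using Suc.prems(2) by (simp add: Z_def funpow_swap1)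
  then have NZ: "N Z = 0\<^sub>m n n" using Suc.IH ZW by auto
  have adj': "B (N' X) Y = B X (N Y)" if "X \<in> W" "Y \<in> W" for X Y
    using adj[of Y X] that mem by (metis B_herm)
  have N'Z: "N' Z \<in> W" using ZW mem by auto
  have "B (N' Z) (N' Z) = B Z (N' (N Z))" using adj'[OF ZW N'Z] comm[OF ZW] by simp
  also have "\<dots> = B (N Z) (N Z)" using adj[OF ZW, of "N Z"] mem ZW by simp
  also have "\<dots> = 0" using NZ B_zero[OF W_zero] by simp
  finally have "N' Z = 0\<^sub>m n n" using B_definite N'Z by auto
  then have "B (N X) (N X) = 0" using adj[OF XW ZW] B_zero2[OF XW] Z_def by simp
  then show ?case using B_definite mem XW by auto
qed

theorem normal_unipotent_trivial:
  assumes H: "subgroup H (GL_on W)"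
    and star: "\<And>\<phi>. \<phi> \<in> H \<Longrightarrow> \<exists>\<psi>\<in>H. \<forall>X\<in>W. \<forall>Y\<in>W. B (\<phi> X) Y = B X (\<psi> Y)"
    and U: "U \<lhd> (GL_on W)\<lparr>carrier := H\<rparr>"
    and unip: "\<And>\<phi>. \<phi> \<in> U \<Longrightarrow> unipotent_on n W \<phi>"
  shows "U = {\<one>\<^bsub>GL_on W\<^esub>}"
proof -
  interpret G: group "GL_on W" by (rule group_GL)
  interpret GH: group "(GL_on W)\<lparr>carrier := H\<rparr>" by (rule G.subgroup_imp_group[OF H])
  have subU: "subgroup U ((GL_on W)\<lparr>carrier := H\<rparr>)" using U by (rule normal_imp_subgroup)
  have HG: "H \<subseteq> carrier (GL_on W)" using H by (rule subgroup.subset)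
  have UH: "U \<subseteq> H" using subgroup.subset[OF subU] by simp
  have "\<phi> = \<one>\<^bsub>GL_on W\<^esub>" if "\<phi> \<in> U" for \<phi>
  proof -
    have \<phi>H: "\<phi> \<in> H" using that UH by auto
    obtain \<psi> where \<psi>H: "\<psi> \<in> H" and \<psi>: "\<And>X Y. X \<in> W \<Longrightarrow> Y \<in> W \<Longrightarrow> B (\<phi> X) Y = B X (\<psi> Y)"
      using star[OF \<phi>H] by blast
    have \<phi>G: "\<phi> \<in> carrier (GL_on W)" and \<psi>G: "\<psi> \<in> carrier (GL_on W)" using \<phi>H \<psi>H HG by auto
    have \<psi>': "B (\<psi> X) Y = B X (\<phi> Y)" if "X \<in> W" "Y \<in> W" for X Y
      using \<psi>[of Y X] that by (metis B_herm GL_mem \<phi>G \<psi>G)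
    define p q where "p = inv\<^bsub>GL_on W\<^esub> \<phi>" and "q = inv\<^bsub>GL_on W\<^esub> \<psi>"
    have pG: "p \<in> carrier (GL_on W)" and qG: "q \<in> carrier (GL_on W)"
      using \<phi>G \<psi>G by (auto simp: p_def q_def)
    note mem = GL_mem[OF \<phi>G] GL_mem[OF \<psi>G] GL_mem[OF pG] GL_mem[OF qG]
    note can = GL_inv_apply[OF \<phi>G, folded p_def] GL_inv_apply[OF \<psi>G, folded q_def]
    have adjp: "B (p X) Y = B X (q Y)" if "X \<in> W" "Y \<in> W" for X Y
      using \<psi>[of "p X" "q Y"] that mem can by simp
    have adjq: "B (q X) Y = B X (p Y)" if "X \<in> W" "Y \<in> W" for X Y
      using \<psi>'[of "q X" "p Y"] that mem can by simp
    \<comment> \<open>Here \<open>q\<close> is the inverse of \<open>\<psi>\<close> and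
      \<open>p\<close> that of \<open>\<phi>\<close>. The first three factors form a conjugate of
      \<open>\<phi>\<close>, so the product lies in \<open>U\<close>. Taking adjoints reverses the
      order and exchanges \<open>\<phi>\<close> with \<open>\<psi>\<close> and \<open>p\<close> with
      \<open>q\<close>, which returns the same product.\<close>
    define \<mu> where "\<mu> = q \<otimes>\<^bsub>GL_on W\<^esub> \<phi> \<otimes>\<^bsub>GL_on W\<^esub> \<psi> \<otimes>\<^bsub>GL_on W\<^esub> p"
    have invH: "inv\<^bsub>(GL_on W)\<lparr>carrier := H\<rparr>\<^esub> x = inv\<^bsub>GL_on W\<^esub> x" if "x \<in> H" for x
      using G.m_inv_consistent[OF H that] .
    have "q \<otimes>\<^bsub>GL_on W\<^esub> \<phi> \<otimes>\<^bsub>GL_on W\<^esub> \<psi> \<in> U"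
      using normal.inv_op_closed1[OF U, of \<psi> \<phi>] \<psi>H \<open>\<phi> \<in> U\<close> invH[OF \<psi>H] by (simp add: q_def)
    moreover have "p \<in> U"
      using subgroup.m_inv_closed[OF subU \<open>\<phi> \<in> U\<close>] invH[OF \<phi>H] by (simp add: p_def)
    ultimately have \<mu>U: "\<mu> \<in> U"
      using subgroup.m_closed[OF subU, of "q \<otimes>\<^bsub>GL_on W\<^esub> \<phi> \<otimes>\<^bsub>GL_on W\<^esub> \<psi>" p] by (simp add: \<mu>_def)
    have \<mu>G: "\<mu> \<in> carrier (GL_on W)" using \<mu>U UH HG by auto
    have \<mu>: "\<mu> X = q (\<phi> (\<psi> (p X)))" if "X \<in> W" for X
      using that \<phi>G \<psi>G pG qG mem by (simp add: \<mu>_def GL_mult_apply)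
    have self: "B (\<mu> X) Y = B X (\<mu> Y)" if "X \<in> W" "Y \<in> W" for X Y
      using that mem by (simp add: \<mu> adjq \<psi> \<psi>' adjp)
    have \<mu>_id: "\<mu> X = X" if X: "X \<in> W" for X
    proof -
      obtain k where "((\<lambda>Y. \<mu> Y - Y) ^^ k) X = 0\<^sub>m n n"
        using unip[OF \<mu>U] X unfolding unipotent_on_def by blast
      then have "\<mu> X - X = 0\<^sub>m n n"
        using X GL_mem[OF \<mu>G]
        by (intro normal_nilpotent[of "\<lambda>Y. \<mu> Y - Y" "\<lambda>Y. \<mu> Y - Y" X k])
          (auto simp: W_minus B_minus B_minus2 self)
      then show ?thesis using W_eqI X GL_mem[OF \<mu>G] by auto
    qed
    have comm: "\<phi> (\<psi> X) = \<psi> (\<phi> X)" if X: "X \<in> W" for X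
    proof -
      have "q (\<phi> (\<psi> X)) = \<phi> X" using \<mu>_id[of "\<phi> X"] X mem by (simp add: \<mu> can)
      then show ?thesis using can(3)[of "\<phi> (\<psi> X)"] X mem by simp
    qed
    have "\<phi> X = X" if X: "X \<in> W" for X
    proof -
      obtain k where k: "((\<lambda>Y. \<phi> Y - Y) ^^ k) X = 0\<^sub>m n n"
        using unip[OF \<open>\<phi> \<in> U\<close>] X unfolding unipotent_on_def by blast
      have swap: "(a - b) - (c - d) = (a - c) - (b - d)"
        if "a \<in> W" "b \<in> W" "c \<in> W" "d \<in> W" for a b c d
      proof -
        have "a \<in> carrier_mat n n" "b \<in> carrier_mat n n" "c \<in> carrier_mat n n" "d \<in> carrier_mat n n"
          using that W_carrier by auto
        then show ?thesis by (intro eq_matI) auto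
      qed
      have "\<phi> X - X = 0\<^sub>m n n"
        using X k mem
        by (intro normal_nilpotent[of "\<lambda>Y. \<phi> Y - Y" "\<lambda>Y. \<psi> Y - Y" X k])
          (auto simp: W_minus B_minus B_minus2 \<psi> GL_minus[OF \<phi>G] GL_minus[OF \<psi>G] comm intro: swap)
      then show ?thesis using W_eqI X mem by auto
    qed
    then show ?thesis by (intro GL_eqI[OF \<phi>G G.one_closed]) (auto simp: GL_one)
  qed
  moreover have "\<one>\<^bsub>GL_on W\<^esub> \<in> U" using subgroup.one_closed[OF subU] by simp
  ultimately show ?thesis by blast
qed

end

section \<open>Lie algebras of the parabolic group and of the stabiliser\<close>

lemma poly_functions_sum:
  "(\<And>k. k \<in> K \<Longrightarrow> f k \<in> poly_functions C) \<Longrightarrow> (\<lambda>x. \<Sum>k\<in>K. f k x) \<in> poly_functions C"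
  by (induction K rule: infinite_finite_induct) (auto intro: poly_functions.intros)

lemma poly_functions_cmult: "f \<in> poly_functions C \<Longrightarrow> (\<lambda>x. c * f x) \<in> poly_functions C"
  by (rule poly_functions.mult[OF poly_functions.const])

lemma poly_functions_minus:
  "f \<in> poly_functions C \<Longrightarrow> g \<in> poly_functions C \<Longrightarrow> (\<lambda>x. f x - g x) \<in> poly_functions C"
  using poly_functions.add[of f C "\<lambda>x. (-1) * g x"] poly_functions_cmult[of g C "-1"] by simp

lemma mat_coord: "i < n \<Longrightarrow> j < n \<Longrightarrow> (\<lambda>A. A $$ (i, j)) \<in> poly_functions (mat_coords n)"
  by (rule poly_functions.coord) (auto simp: mat_coords_def)

text \<open>The derivative is chosen before the curve: it depends on the velocity \<open>X\<close>
  alone. So a curve inside a group can be compared with the straight line \<open>1 + t X\<close>,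
  which leaves the group.\<close>

lemma poly_function_curve:
  assumes "f \<in> poly_functions (mat_coords n)"
  shows "\<exists>D. \<forall>c. c 0 = 1\<^sub>m n \<longrightarrow>
    (\<forall>i<n. \<forall>j<n. ((\<lambda>t. c t $$ (i, j)) has_field_derivative X $$ (i, j)) (at 0)) \<longrightarrow>
    ((\<lambda>t. f (c t)) has_field_derivative D) (at (0::complex))"
  using assms
proof induction
  case (const a)
  then show ?case by (intro exI[of _ 0]) auto
next
  case (coord f)
  then obtain i j where "f = (\<lambda>A. A $$ (i, j))" "i < n" "j < n" by (auto simp: mat_coords_def)
  then show ?case by (intro exI[of _ "X $$ (i, j)"]) auto
next
  case (add f g)
  then obtain D E where "\<forall>c. c 0 = 1\<^sub>m n \<longrightarrow>
    (\<forall>i<n. \<forall>j<n. ((\<lambda>t. c t $$ (i, j)) has_field_derivative X $$ (i, j)) (at 0)) \<longrightarrow>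
    ((\<lambda>t. f (c t)) has_field_derivative D) (at (0::complex))"
   "\<forall>c. c 0 = 1\<^sub>m n \<longrightarrow>
    (\<forall>i<n. \<forall>j<n. ((\<lambda>t. c t $$ (i, j)) has_field_derivative X $$ (i, j)) (at 0)) \<longrightarrow>
    ((\<lambda>t. g (c t)) has_field_derivative E) (at (0::complex))" by blast
  then show ?case by (intro exI[of _ "D + E"]) (auto intro!: DERIV_add)
next
  case (mult f g)
  then obtain D E where *: "\<forall>c. c 0 = 1\<^sub>m n \<longrightarrow>
    (\<forall>i<n. \<forall>j<n. ((\<lambda>t. c t $$ (i, j)) has_field_derivative X $$ (i, j)) (at 0)) \<longrightarrow>
    ((\<lambda>t. f (c t)) has_field_derivative D) (at (0::complex))"
   "\<forall>c. c 0 = 1\<^sub>m n \<longrightarrow>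
    (\<forall>i<n. \<forall>j<n. ((\<lambda>t. c t $$ (i, j)) has_field_derivative X $$ (i, j)) (at 0)) \<longrightarrow>
    ((\<lambda>t. g (c t)) has_field_derivative E) (at (0::complex))" by blast
  show ?case
  proof (rule exI[of _ "D * g (1\<^sub>m n) + E * f (1\<^sub>m n)"], intro allI impI)
    fix c :: "complex \<Rightarrow> complex mat"
    assume c: "c 0 = 1\<^sub>m n" "\<forall>i<n. \<forall>j<n. ((\<lambda>t. c t $$ (i, j)) has_field_derivative X $$ (i, j)) (at 0)"
    show "((\<lambda>t. f (c t) * g (c t)) has_field_derivative D * g (1\<^sub>m n) + E * f (1\<^sub>m n)) (at 0)"
      using DERIV_mult[OF *(1)[rule_format, of c] *(2)[rule_format, of c]] c by simp
  qed
qed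

text \<open>A polynomial vanishing on \<open>Q\<close> vanishes along \<open>c\<close> near 0, so
  its derivative in the direction \<open>X\<close> is zero. Membership is asked only near 0 because
  the Cayley curve below lies in the group only there.\<close>

lemma lie_algebraI:
  assumes X: "X \<in> carrier_mat n n" and c0: "c 0 = 1\<^sub>m n"
    and c: "\<And>i j. i < n \<Longrightarrow> j < n \<Longrightarrow> ((\<lambda>t. c t $$ (i, j)) has_field_derivative X $$ (i, j)) (at 0)"
    and Q: "\<forall>\<^sub>F t in nhds (0::complex). c t \<in> Q"
  shows "X \<in> lie_algebra n Q"
  unfolding lie_algebra_def
proof (intro CollectI conjI X ballI impI)
  fix f assume f: "f \<in> poly_functions (mat_coords n)" and f0: "\<forall>g\<in>Q. f g = 0"
  from poly_function_curve[OF f, of X] obtain D where D: "\<And>c. c 0 = 1\<^sub>m n \<Longrightarrow>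
    (\<And>i j. i < n \<Longrightarrow> j < n \<Longrightarrow> ((\<lambda>t. c t $$ (i, j)) has_field_derivative X $$ (i, j)) (at 0)) \<Longrightarrow>
    ((\<lambda>t. f (c t)) has_field_derivative D) (at (0::complex))" by blast
  have "((\<lambda>t. f (c t)) has_field_derivative D) (at 0)" using D[of c] c0 c by blast
  moreover have "\<forall>\<^sub>F t in nhds (0::complex). f (c t) = 0"
    using Q by eventually_elim (use f0 in auto)
  ultimately have "((\<lambda>t. 0) has_field_derivative D) (at (0::complex))"
    using DERIV_cong_ev[of 0 0 "\<lambda>t. f (c t)" "\<lambda>t. 0" D D] by simp
  then have "D = 0" using DERIV_unique[OF _ DERIV_const] by blast
  moreover have "((\<lambda>t. f (1\<^sub>m n + t \<cdot>\<^sub>m X)) has_field_derivative D) (at 0)"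
  proof (rule D)
    show "1\<^sub>m n + 0 \<cdot>\<^sub>m X = 1\<^sub>m n" using X by (intro eq_matI) auto
    fix i j assume "i < n" "j < n"
    then show "((\<lambda>t. (1\<^sub>m n + t \<cdot>\<^sub>m X) $$ (i, j)) has_field_derivative X $$ (i, j)) (at 0)"
      using X by (auto intro!: derivative_eq_intros)
  qed
  ultimately show "((\<lambda>t. f (1\<^sub>m n + t \<cdot>\<^sub>m X)) has_field_derivative 0) (at 0)" by simp
qed

lemma lie_algebraD:
  assumes "X \<in> lie_algebra n Q" "f \<in> poly_functions (mat_coords n)" "\<And>g. g \<in> Q \<Longrightarrow> f g = 0"
    "((\<lambda>t. f (1\<^sub>m n + t \<cdot>\<^sub>m X)) has_field_derivative d) (at 0)"
  shows "d = 0"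
  using assms DERIV_unique unfolding lie_algebra_def by blast

lemma isCont_det:
  assumes A: "\<And>t. A t \<in> carrier_mat m m"
    and cont: "\<And>i j. i < m \<Longrightarrow> j < m \<Longrightarrow> isCont (\<lambda>t. A t $$ (i, j)) a"
  shows "isCont (\<lambda>t. det (A t) :: complex) (a :: complex)"
proof -
  have "isCont (\<lambda>t. \<Sum>p | p permutes {0..<m}. signof p * (\<Prod>i = 0..<m. A t $$ (i, p i))) a"
    by (intro continuous_intros cont) (auto dest: permutes_in_image)
  then show ?thesis using det_def'[OF A] by simp
qed

text \<open>Near \<open>0\<close> the resolvent is the adjugate divided by the determinant, hence continuous; its
  derivative at \<open>0\<close> then follows from \<open>R = 1 + t X R\<close>.\<close>

lemma resolvent_curve:
  assumes X: "X \<in> carrier_mat m m"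
  obtains R where "\<And>t. R t \<in> carrier_mat m m" "R 0 = 1\<^sub>m m"
    "\<forall>\<^sub>F t in nhds (0::complex). (1\<^sub>m m - t \<cdot>\<^sub>m X) * R t = 1\<^sub>m m"
    "\<And>i j. i < m \<Longrightarrow> j < m \<Longrightarrow> ((\<lambda>t. R t $$ (i, j)) has_field_derivative X $$ (i, j)) (at 0)"
proof -
  define A where "A t = 1\<^sub>m m - t \<cdot>\<^sub>m X" for t :: complex
  have A: "A t \<in> carrier_mat m m" for t using X by (auto simp: A_def)
  have A0: "A 0 = 1\<^sub>m m" using X by (intro eq_matI) (auto simp: A_def)
  have Ac: "isCont (\<lambda>t. A t $$ (i, j)) a" if "i < m" "j < m" for i j a
    using that X by (auto simp: A_def intro!: continuous_intros)
  define R where "R t = inverse (det (A t)) \<cdot>\<^sub>m adj_mat (A t)" for t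
  have R: "R t \<in> carrier_mat m m" for t using adj_mat(1)[OF A] by (simp add: R_def)
  have inv: "A t * R t = 1\<^sub>m m" if "det (A t) \<noteq> 0" for t
    using adj_mat(1,2)[OF A[of t]] A[of t] that
    by (simp add: R_def mult_smult_distrib[of _ m m _ m]) (auto intro!: eq_matI)
  have detc: "isCont (\<lambda>t. det (A t)) a" for a by (rule isCont_det[OF A Ac])
  have det0: "det (A 0) = 1" by (simp add: A0)
  have "\<forall>\<^sub>F t in nhds 0. det (A t) \<noteq> 0"
    using detc[of 0] det0 t1_space_nhds[of "0::complex" ] 
    by (intro eventually_nhds_conv_at[THEN iffD2] conjI)
      (auto simp: isCont_def intro!: tendsto_imp_eventually_ne)
  then have ev: "\<forall>\<^sub>F t in nhds 0. A t * R t = 1\<^sub>m m" by eventually_elim (rule inv)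
  have R0: "R 0 = 1\<^sub>m m" using inv[of 0] det0 A0 R[of 0] by simp
  have Rc: "isCont (\<lambda>t. R t $$ (i, j)) 0" if ij: "i < m" "j < m" for i j
  proof -
    have dim: "dim_row (A t) = m" "dim_col (A t) = m" for t using A by auto
    have "isCont (\<lambda>t. det (mat_delete (A t) j i)) 0"
    proof (rule isCont_det)
      show "mat_delete (A t) j i \<in> carrier_mat (m - 1) (m - 1)" for t
        using mat_delete_carrier[OF A] .
      fix p q assume "p < m - 1" "q < m - 1"
      then show "isCont (\<lambda>t. mat_delete (A t) j i $$ (p, q)) 0"
        by (auto simp: mat_delete_def dim intro!: Ac)
    qed
    then have "isCont (\<lambda>t. inverse (det (A t)) * ((-1) ^ (j + i) * det (mat_delete (A t) j i))) 0"
      using detc det0 by (intro continuous_intros) auto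
    moreover have "R t $$ (i, j) = inverse (det (A t)) * ((-1) ^ (j + i) * det (mat_delete (A t) j i))" for t
      using ij by (simp add: R_def adj_mat_def cofactor_def dim)
    ultimately show ?thesis by simp
  qed
  have "((\<lambda>t. R t $$ (i, j)) has_field_derivative X $$ (i, j)) (at 0)" if ij: "i < m" "j < m" for i j
  proof -
    have XR: "isCont (\<lambda>t. \<Sum>k<m. X $$ (i, k) * R t $$ (k, j)) 0"
      using ij by (intro continuous_intros Rc) auto
    have X0: "(\<Sum>k<m. X $$ (i, k) * R 0 $$ (k, j)) = X $$ (i, j)"
    proof -
      have "X $$ (i, j) = (X * R 0) $$ (i, j)" using X ij by (simp add: R0)
      then show ?thesis using X R ij by (simp add: mult_entry del: index_mult_mat)
    qed
    have "\<forall>\<^sub>F t in at 0. (R t $$ (i, j) - R 0 $$ (i, j)) / t = (\<Sum>k<m. X $$ (i, k) * R t $$ (k, j))"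
      using ev[unfolded eventually_nhds_conv_at, THEN conjunct1] eventually_neq_at_within[of 0 0 UNIV]
    proof eventually_elim
      case (elim t)
      have "1\<^sub>m m = R t - t \<cdot>\<^sub>m (X * R t)"
        using elim(1) R[of t] X unfolding A_def
        by (simp add: minus_mult_distrib_mat[of _ m m] mult_smult_assoc_mat[of _ m m _ m])
      then have "1\<^sub>m m $$ (i, j) = R t $$ (i, j) - t * (X * R t) $$ (i, j)"
        using ij X R[of t] by (metis carrier_matD index_minus_mat(1) index_mult_mat(2,3) index_smult_mat)
      then show ?case using elim(2) X R ij
        by (simp add: R0 mult_entry[of X m] field_simps del: index_mult_mat)
    qed
    moreover have "(\<lambda>t. \<Sum>k<m. X $$ (i, k) * R t $$ (k, j)) \<midarrow>0\<rightarrow> X $$ (i, j)"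
      using XR X0 by (simp add: isCont_def)
    ultimately have "(\<lambda>t. (R t $$ (i, j) - R 0 $$ (i, j)) / (t - 0)) \<midarrow>0\<rightarrow> X $$ (i, j)"
      by (simp add: filterlim_cong[OF refl refl])
    then show ?thesis by (simp add: has_field_derivative_iff)
  qed
  with R R0 ev show thesis unfolding A_def by (rule that)
qed

section \<open>Inverses of block triangular matrices\<close>

context levelled begin

text \<open>Cut both matrices at \<open>s\<close>, the first index of level above
  \<open>lv j\<close>. The lower left block of \<open>A\<close> vanishes, so its lower right block
  is invertible because det A is nonzero; and this block annihilates the lower left block of
  \<open>B\<close>, which contains the entry (i, j).\<close>

lemma UT_inverse:
  assumes A: "A \<in> M" and B: "B \<in> M" and AB: "A * B = 1\<^sub>m n" and UT: "UT A"
  shows "UT B"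
  unfolding UT_def
proof (intro allI impI)
  fix i j assume ij: "i < n" "j < n" "lv j < lv i"
  define s where "s = (LEAST k. lv j < lv k)"
  have s1: "lv j < lv s" unfolding s_def by (rule LeastI) (rule ij)
  have s2: "s \<le> i" unfolding s_def by (rule Least_le) (rule ij)
  have js: "j < s" using s1 lv_mono[of s j] ij by (meson leI leD)
  have low: "lv k \<le> lv j" if "k < s" for k
    using that not_less_Least[of k "\<lambda>k. lv j < lv k"] by (auto simp: s_def)
  have high: "lv j < lv k" if "s \<le> k" "k < n" for k using s1 lv_mono[OF that] by simp
  obtain A1 A2 A3 A4 where sA: "split_block A s s = (A1, A2, A3, A4)" by (metis prod_cases4)
  obtain B1 B2 B3 B4 where sB: "split_block B s s = (B1, B2, B3, B4)" by (metis prod_cases4)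
  define m where "m = n - s"
  have n: "n = s + m" using s2 ij by (simp add: m_def)
  have dA: "dim_row A = s + m" "dim_col A = s + m" and dB: "dim_row B = s + m" "dim_col B = s + m"
    using A B n by auto
  note SA = split_block[OF sA dA] and SB = split_block[OF sB dB]
  have A3: "A3 = 0\<^sub>m m s"
  proof (rule eq_matI)
    fix p q assume "p < dim_row (0\<^sub>m m s :: complex mat)" "q < dim_col (0\<^sub>m m s :: complex mat)"
    then have pq: "p < m" "q < s" by auto
    have "A3 $$ (p, q) = A $$ (p + s, q)"
      using sA pq dA by (auto simp: split_block_def Let_def)
    also have "\<dots> = 0" using UT low[of q] high[of "p + s"] pq n
      unfolding UT_def by (metis add.commute add_less_cancel_left le_add2 le_less_trans trans_less_add1)
    finally show "A3 $$ (p, q) = (0\<^sub>m m s) $$ (p, q)" using pq by simp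
  qed (use SA in auto)
  have "det A * det B = 1" using det_mult[OF A B] AB by simp
  then have "det A \<noteq> 0" by auto
  moreover have "det A = det A1 * det A4"
    using det_four_block_mat_lower_left_zero[OF SA(1,2) A3 SA(4)] SA(5) by simp
  ultimately have d4: "det A4 \<noteq> 0" by auto
  have "four_block_mat (A1 * B1 + A2 * B3) (A1 * B2 + A2 * B4) (A3 * B1 + A4 * B3) (A3 * B2 + A4 * B4) = 1\<^sub>m n"
    using mult_four_block_mat[OF SA(1-4) SB(1-4)] SA(5) SB(5) AB by simp
  then have lo: "(four_block_mat (A1 * B1 + A2 * B3) (A1 * B2 + A2 * B4) (A3 * B1 + A4 * B3) (A3 * B2 + A4 * B4)) $$ (p + s, q) = 0"
    if "p < m" "q < s" for p q using that n by auto
  have A4B3: "A4 * B3 = 0\<^sub>m m s"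
  proof (rule eq_matI)
    fix p q assume "p < dim_row (0\<^sub>m m s :: complex mat)" "q < dim_col (0\<^sub>m m s :: complex mat)"
    then have pq: "p < m" "q < s" by auto
    have "A3 * B1 = 0\<^sub>m m s" using A3 SB(1) by simp
    then show "(A4 * B3) $$ (p, q) = (0\<^sub>m m s) $$ (p, q)"
      using lo[OF pq] pq SA SB by auto
  qed (use SA SB in auto)
  have "det A4 \<cdot>\<^sub>m B3 = adj_mat A4 * A4 * B3"
    using adj_mat(3)[OF SA(4)] SB(3) by (simp add: mult_smult_assoc_mat[of _ m m _ s])
  also have "\<dots> = 0\<^sub>m m s"
    using adj_mat(1)[OF SA(4)] SA(4) SB(3) A4B3 by (simp add: assoc_mult_mat[of _ m m _ m _ s])
  finally have z: "det A4 \<cdot>\<^sub>m B3 = 0\<^sub>m m s" .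
  have im: "i - s < m" using ij s2 by (simp add: m_def)
  have "(det A4 \<cdot>\<^sub>m B3) $$ (i - s, j) = 0" using z im js by simp
  then have "B3 $$ (i - s, j) = 0" using d4 im js SB(3) by simp
  moreover have "B3 $$ (i - s, j) = B $$ (i, j)"
    using sB im js dB s2 by (auto simp: split_block_def Let_def)
  ultimately show "B $$ (i, j) = 0" by simp
qed

lemma UT_transpose_BD: assumes "X \<in> M" "UT X" "UT (transpose_mat X)" shows "BD X"
  unfolding BD_def
proof (intro allI impI)
  fix i j assume ij: "i < n" "j < n" "lv i \<noteq> lv j"
  then consider "lv j < lv i" | "lv i < lv j" by linarith
  then show "X $$ (i, j) = 0"
  proof cases
    case 2
    then have "transpose_mat X $$ (j, i) = 0" using assms(3) ij unfolding UT_def by blast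
    then show ?thesis using ij assms(1) by simp
  qed (use assms(2) ij in \<open>auto simp: UT_def\<close>)
qed

lemma BD_transpose: "X \<in> M \<Longrightarrow> BD X \<Longrightarrow> BD (transpose_mat X)"
  by (auto simp: BD_def)

text \<open>A matrix is block diagonal when it and its transpose are block triangular, so
  \<open>UT_inverse\<close> is applied to both.\<close>

lemma BD_inverse:
  assumes A: "A \<in> M" and B: "B \<in> M" and AB: "A * B = 1\<^sub>m n" and BD: "BD A"
  shows "BD B"
proof (rule UT_transpose_BD[OF B])
  show "UT B" using UT_inverse[OF A B AB BD_UT[OF BD]] .
  have "B * A = 1\<^sub>m n" using mat_mult_left_right_inverse[OF A B AB] .
  then have "transpose_mat A * transpose_mat B = 1\<^sub>m n"
    using transpose_mult[OF B A] by simp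
  then show "UT (transpose_mat B)"
    using UT_inverse[of "transpose_mat A" "transpose_mat B"] A B BD_UT[OF BD_transpose[OF A BD]] by simp
qed

section \<open>The matrix \<open>F0\<close> and commutation with it\<close>

lemma F0_M [simp]: "F0 \<in> M" by (simp add: F0_def)
lemma F0_dim [simp]: "dim_row F0 = n" "dim_col F0 = n" by (simp_all add: F0_def)

lemma F0_left: assumes "X \<in> M" "i < n" "j < n"
  shows "(F0 * X) $$ (i, j) = (if du i < r then X $$ (du i, j) else 0)"
proof -
  have "(F0 * X) $$ (i, j) = (\<Sum>k<n. F0 $$ (i, k) * X $$ (k, j))" using assms by (simp add: mult_entry del: index_mult_mat)
  also have "\<dots> = (\<Sum>k<n. if k = du i then (if du i < r then X $$ (du i, j) else 0) else 0)"
    using assms r_le by (intro sum.cong) (auto simp: F0_def)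
  finally show ?thesis using assms by simp
qed

lemma F0_right: assumes "X \<in> M" "i < n" "j < n"
  shows "(X * F0) $$ (i, j) = (if j < r then X $$ (i, du j) else 0)"
proof -
  have "(X * F0) $$ (i, j) = (\<Sum>k<n. X $$ (i, k) * F0 $$ (k, j))" using assms by (simp add: mult_entry del: index_mult_mat)
  also have "\<dots> = (\<Sum>k<n. if k = du j then (if j < r then X $$ (i, du j) else 0) else 0)"
    using assms r_le by (intro sum.cong) (auto simp: F0_def)
  finally show ?thesis using assms by simp
qed

lemma lv_ne: "i < r \<Longrightarrow> j < n \<Longrightarrow> r \<le> j \<Longrightarrow> lv i < lv j"
proof (cases "j < n - r")
  case False
  assume "i < r" "j < n" "r \<le> j"
  then have "lv (du j) < t" using False by (intro lv_first) auto
  then show ?thesis using lv_first[OF \<open>i < r\<close>] lv_du[OF \<open>j < n\<close>] by linarith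
qed (use lv_first[of i] lv_mid[of j] in auto)

text \<open>Commutation with a single matrix passes to products, inverses and the Cayley transform,
  which is not visible for the mirror condition on entries. The remaining entries of both products
  vanish because levels on the two sides of \<open>r\<close> differ (\<open>lv_ne\<close>).\<close>

lemma comm_F0:
  assumes X: "X \<in> M" "BD X"
  shows "F0 * X = X * F0 \<longleftrightarrow> (\<forall>i<r. \<forall>j<r. X $$ (du i, du j) = X $$ (i, j))"
proof
  assume eq: "F0 * X = X * F0"
  show "\<forall>i<r. \<forall>j<r. X $$ (du i, du j) = X $$ (i, j)"
  proof (intro allI impI)
    fix i j assume ij: "i < r" "j < r"
    then have "i < n" "j < n" using r_le by auto
    then show "X $$ (du i, du j) = X $$ (i, j)"
      using F0_left[OF X(1), of "du i" j] F0_right[OF X(1), of "du i" j] eq ij by simp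
  qed
next
  assume eq: "\<forall>i<r. \<forall>j<r. X $$ (du i, du j) = X $$ (i, j)"
  show "F0 * X = X * F0"
  proof (rule eq_matI)
    fix i j assume "i < dim_row (X * F0)" "j < dim_col (X * F0)"
    then have ij: "i < n" "j < n" using X F0_M by auto
    have 1: "X $$ (du i, j) = 0" if "du i < r" "\<not> j < r"
      using lv_ne[of "du i" j] that ij X(2) unfolding BD_def by auto
    have 2: "X $$ (i, du j) = 0" if "\<not> du i < r" "j < r"
    proof -
      have "lv j < lv (du i)" using that ij by (intro lv_ne) auto
      then have "lv i < lv (du j)" using lv_du[OF ij(1)] lv_du[OF ij(2)] by linarith
      then show ?thesis using ij X(2) unfolding BD_def by auto
    qed
    have 3: "X $$ (du i, j) = X $$ (i, du j)" if "du i < r" "j < r"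
      using eq[rule_format, OF that] ij by simp
    show "(F0 * X) $$ (i, j) = (X * F0) $$ (i, j)"
      unfolding F0_left[OF X(1) ij] F0_right[OF X(1) ij] using 1 2 3 by auto
  qed (use X in auto)
qed

lemma Sg_iff: "h \<in> Sg \<longleftrightarrow> h \<in> Sp \<and> BD h \<and> F0 * h = h * F0"
  using comm_F0[of h] BD_UT[of h] by (auto simp: Sg_def Pg_def Sp_M)

lemma La_iff: "X \<in> La \<longleftrightarrow> X \<in> sp \<and> BD X \<and> F0 * X = X * F0"
  using comm_F0[of X] BD_UT[of X] by (auto simp: La_def pa_def sp_M)

text \<open>The Cayley transform, the inverse of \<open>1 - t X/2\<close> times
  \<open>1 + t X/2\<close>, is symplectic for \<open>X\<close> in \<open>sp\<close>. Being built
  from \<open>X\<close> by sums, products and one inverse, it inherits triangularity, block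
  diagonality and commutation with \<open>F0\<close>; one curve thus serves both \<open>Pg\<close>
  and \<open>Sg\<close>.\<close>

lemma cayley_curve:
  assumes X: "X \<in> sp"
  obtains c where "c 0 = 1\<^sub>m n"
    "\<And>i j. i < n \<Longrightarrow> j < n \<Longrightarrow> ((\<lambda>t. c t $$ (i, j)) has_field_derivative X $$ (i, j)) (at 0)"
    "\<forall>\<^sub>F t in nhds (0::complex). c t \<in> Sp \<and> (UT X \<longrightarrow> UT (c t)) \<and> (BD X \<longrightarrow> BD (c t)) \<and>
       (F0 * X = X * F0 \<longrightarrow> F0 * c t = c t * F0)"
proof -
  \<comment> \<open>The factor 1/2 is there because \<open>R\<close> and \<open>1 + t Y\<close> each
    contribute the velocity \<open>Y\<close> at 0.\<close>
  define Y where "Y = (1/2) \<cdot>\<^sub>m X"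
  have YM: "Y \<in> M" using X by (simp add: Y_def sp_M)
  have Ya: "adj Y = - Y" using X by (auto simp: Y_def adj_smult sp_M sp_adj intro!: eq_matI)
  obtain R where R: "\<And>t. R t \<in> M" "R 0 = 1\<^sub>m n"
    and ev: "\<forall>\<^sub>F t in nhds (0::complex). (1\<^sub>m n - t \<cdot>\<^sub>m Y) * R t = 1\<^sub>m n"
    and der: "\<And>i j. i < n \<Longrightarrow> j < n \<Longrightarrow> ((\<lambda>t. R t $$ (i, j)) has_field_derivative Y $$ (i, j)) (at 0)"
    using resolvent_curve[OF YM] by blast
  define c where "c t = R t * (1\<^sub>m n + t \<cdot>\<^sub>m Y)" for t
  have c_eq: "c t = R t + t \<cdot>\<^sub>m (R t * Y)" for t
    using R(1)[of t] YM by (simp add: c_def mult_M)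
  show thesis
  proof (rule that)
    show "c 0 = 1\<^sub>m n" using R YM by (intro eq_matI) (auto simp: c_eq)
  next
    fix i j assume ij: "i < n" "j < n"
    have e: "c t $$ (i, j) = R t $$ (i, j) + t * (\<Sum>k<n. R t $$ (i, k) * Y $$ (k, j))" for t
      using ij R(1)[of t] YM by (simp add: c_eq mult_entry[of "R t" n] del: index_mult_mat(1))
    define S where "S = (\<lambda>t. \<Sum>k<n. R t $$ (i, k) * Y $$ (k, j))"
    have "(S has_field_derivative (\<Sum>k<n. Y $$ (i, k) * Y $$ (k, j))) (at 0)"
      unfolding S_def using ij by (intro DERIV_sum) (auto intro!: derivative_eq_intros der)
    moreover have "S 0 = Y $$ (i, j)"
    proof -
      have "S 0 = (R 0 * Y) $$ (i, j)" unfolding S_def using R(1)[of 0] YM ij by (subst mult_entry[of _ n]) auto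
      then show ?thesis using R(2) YM by simp
    qed
    ultimately have "((\<lambda>t. R t $$ (i, j) + t * S t) has_field_derivative Y $$ (i, j) + Y $$ (i, j)) (at 0)"
      using ij by (auto intro!: derivative_eq_intros der)
    moreover have "Y $$ (i, j) + Y $$ (i, j) = X $$ (i, j)"
      using ij sp_M[OF X] by (auto simp: Y_def)
    ultimately show "((\<lambda>t. c t $$ (i, j)) has_field_derivative X $$ (i, j)) (at 0)"
      unfolding e S_def by simp
  next
    have ev': "\<forall>\<^sub>F t in nhds (0::complex). (1\<^sub>m n - (- t) \<cdot>\<^sub>m Y) * R (- t) = 1\<^sub>m n"
    proof -
      have "filterlim uminus (nhds (0::complex)) (nhds 0)"
        using tendsto_minus[OF filterlim_ident[of "nhds (0::complex)"]] by simp
      then show ?thesis using ev by (rule filterlim_iff[THEN iffD1, rule_format])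
    qed
    from ev ev' show "\<forall>\<^sub>F t in nhds (0::complex). c t \<in> Sp \<and> (UT X \<longrightarrow> UT (c t)) \<and> (BD X \<longrightarrow> BD (c t)) \<and>
       (F0 * X = X * F0 \<longrightarrow> F0 * c t = c t * F0)"
    proof eventually_elim
      case (elim t)
      define P Q where "P = 1\<^sub>m n + t \<cdot>\<^sub>m Y" and "Q = 1\<^sub>m n - t \<cdot>\<^sub>m Y"
      have PM: "P \<in> M" and QM: "Q \<in> M" using YM by (auto simp: P_def Q_def)
      have QR: "Q * R t = 1\<^sub>m n" using elim by (simp add: Q_def)
      have RQ: "R t * Q = 1\<^sub>m n" using mat_mult_left_right_inverse[OF QM R(1) QR] .
      have PQ: "P * Q = Q * P"
      proof -
        have "P * Q = 1\<^sub>m n - t \<cdot>\<^sub>m (t \<cdot>\<^sub>m (Y * Y))" using YM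
          unfolding P_def Q_def by (simp add: mult_M) (intro eq_matI, auto simp: algebra_simps)
        moreover have "Q * P = 1\<^sub>m n - t \<cdot>\<^sub>m (t \<cdot>\<^sub>m (Y * Y))" using YM
          unfolding P_def Q_def by (simp add: mult_M) (intro eq_matI, auto simp: algebra_simps)
        ultimately show ?thesis by simp
      qed
      have adjP: "adj P = Q" and adjQ: "adj Q = P"
        using YM Ya by (auto simp: P_def Q_def adj_add adj_minus adj_smult intro!: eq_matI)
      have RP: "R t * P = P * R t"
      proof -
        have "R t * P = R t * P * (Q * R t)" using R PM by (simp add: QR)
        also have "\<dots> = R t * (P * Q) * R t" using R PM QM by (simp add: mult_M)
        also have "\<dots> = (R t * Q) * P * R t" using R PM QM by (simp add: PQ mult_M)
        finally show ?thesis using RQ PM R by simp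
      qed
      have ct: "c t = R t * P" by (simp add: c_def P_def)
      have "adj (c t) * c t = Q * adj (R t) * (P * R t)"
        using R(1)[of t] PM by (simp add: ct adj_mult adjP) (simp add: RP)
      also have "\<dots> = Q * (adj (R t) * adj Q) * R t" using R QM PM by (simp add: mult_M adjQ)
      also have "adj (R t) * adj Q = 1\<^sub>m n" using QR R QM by (simp flip: adj_mult)
      finally have "adj (c t) * c t = 1\<^sub>m n" using QM QR by simp
      then have 1: "c t \<in> Sp" using R PM by (simp add: Sp_def ct)
      have 2: "UT (c t)" if "UT X"
      proof -
        have "UT Y" using that X by (simp add: Y_def UT_smult sp_M)
        then have "UT P" "UT Q" using YM by (auto simp: P_def Q_def UT_add UT_minus UT_one UT_smult)
        then show ?thesis unfolding ct using UT_inverse[OF QM R(1) QR] R PM by (intro UT_mult) auto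
      qed
      have 3: "BD (c t)" if "BD X"
      proof -
        have "BD P" "BD Q" using that X YM by (auto simp: P_def Q_def BD_def Y_def sp_def)
        then show ?thesis unfolding ct using BD_inverse[OF QM R(1) QR] R PM by (intro BD_mult) auto
      qed
      have 4: "F0 * c t = c t * F0" if "F0 * X = X * F0"
      proof -
        have FY: "F0 * Y = Y * F0" using that X by (simp add: Y_def sp_M mult_M)
        have FP: "F0 * P = P * F0" and FQ: "F0 * Q = Q * F0"
          using YM by (auto simp: P_def Q_def mult_M FY)
        have FR: "F0 * R t = R t * F0"
        proof -
          have "F0 * R t = R t * Q * F0 * R t" using RQ by simp
          also have "\<dots> = R t * (Q * F0) * R t" using R QM by (simp add: mult_M)
          also have "\<dots> = R t * F0 * (Q * R t)" using R QM by (simp add: FQ[symmetric] mult_M)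
          finally show ?thesis using QR R by simp
        qed
        have "F0 * c t = (F0 * R t) * P" using R PM by (simp add: ct mult_M)
        also have "\<dots> = R t * (F0 * P)" using R PM by (simp add: FR mult_M)
        also have "\<dots> = c t * F0" using R PM by (simp add: FP ct mult_M)
        finally show ?thesis .
      qed
      from 1 2 3 4 show ?case by blast
    qed
  qed
qed

section \<open>Linearising the defining equations\<close>

lemma mult_coord_poly:
  assumes "i < n" "j < n"
    and "\<And>k. k < n \<Longrightarrow> (\<lambda>A. f A $$ (i, k)) \<in> poly_functions C"
    and "\<And>k. k < n \<Longrightarrow> (\<lambda>A. g A $$ (k, j)) \<in> poly_functions C"
    and "\<And>A. f A \<in> M" "\<And>A. g A \<in> M"
  shows "(\<lambda>A. (f A * g A) $$ (i, j)) \<in> poly_functions C"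
  using assms by (simp add: mult_entry[of _ n] del: index_mult_mat(1))
    (intro poly_functions_sum poly_functions.mult, auto)

text \<open>Each entry of \<open>adj A * A - 1\<close> is a polynomial vanishing on
  \<open>Q\<close>; along \<open>1 + t X\<close> its linear coefficient is the corresponding entry
  of \<open>adj X + X\<close>.\<close>

lemma lie_sub_sp:
  assumes Q: "Q \<subseteq> Sp" and X: "X \<in> lie_algebra n Q"
  shows "X \<in> sp"
proof -
  have XM: "X \<in> M" using X by (simp add: lie_algebra_def)
  have "(adj X + X) $$ (i, j) = 0" if ij: "i < n" "j < n" for i j
  proof -
    define f :: "complex mat \<Rightarrow> complex" where
      "f A = (\<Sum>k<n. sg i * sg k * A $$ (du k, du i) * A $$ (k, j)) - 1\<^sub>m n $$ (i, j)" for A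
    have "f \<in> poly_functions (mat_coords n)" unfolding f_def
      using ij by (intro poly_functions_minus poly_functions_sum poly_functions.mult poly_functions_cmult mat_coord poly_functions.const) auto
    moreover have "f g = 0" if "g \<in> Q" for g
    proof -
      have g: "g \<in> M" "adj g * g = 1\<^sub>m n" using that Q by (auto simp: Sp_def)
      have "(adj g * g) $$ (i, j) = (\<Sum>k<n. sg i * sg k * g $$ (du k, du i) * g $$ (k, j))"
        using g(1) ij by (subst mult_entry[of _ n]) (auto simp: adj_entry)
      then show ?thesis using g ij by (simp add: f_def)
    qed
    moreover have "f (1\<^sub>m n + t \<cdot>\<^sub>m X) = t * (adj X + X) $$ (i, j) + t * t * (adj X * X) $$ (i, j)" for t
    proof -
      let ?A = "1\<^sub>m n + t \<cdot>\<^sub>m X"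
      have AM: "?A \<in> M" using XM by simp
      have "f ?A = (adj ?A * ?A) $$ (i, j) - 1\<^sub>m n $$ (i, j)"
        unfolding f_def using AM ij by (subst mult_entry[of _ n]) (auto simp: adj_entry simp del: index_add_mat intro!: sum.cong)
      also have "adj ?A * ?A = 1\<^sub>m n + t \<cdot>\<^sub>m (adj X + X) + (t * t) \<cdot>\<^sub>m (adj X * X)"
        using XM by (simp add: adj_add adj_smult mult_M) (intro eq_matI, auto simp: algebra_simps simp del: index_mult_mat(1))
      finally show ?thesis using XM ij by (auto simp del: index_mult_mat(1))
    qed
    then have "((\<lambda>t. f (1\<^sub>m n + t \<cdot>\<^sub>m X)) has_field_derivative (adj X + X) $$ (i, j)) (at 0)"
      by (auto intro!: derivative_eq_intros)
    ultimately show ?thesis using lie_algebraD[OF X] by blast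
  qed
  note * = this
  have "adj X = - X"
  proof (rule eq_matI)
    fix i j assume "i < dim_row (- X)" "j < dim_col (- X)"
    then show "adj X $$ (i, j) = (- X) $$ (i, j)" using *[of i j] XM by (simp add: add_eq_0_iff)
  qed (use XM in auto)
  then show ?thesis using XM by (simp add: sp_def)
qed

lemma lie_entry_zero:
  assumes Q: "\<And>g. g \<in> Q \<Longrightarrow> g $$ (i, j) = 0" and X: "X \<in> lie_algebra n Q" and ij: "i < n" "j < n" "i \<noteq> j"
  shows "X $$ (i, j) = 0"
proof (rule lie_algebraD[OF X mat_coord[OF ij(1,2)]])
  have XM: "X \<in> M" using X by (simp add: lie_algebra_def)
  show "((\<lambda>t. (1\<^sub>m n + t \<cdot>\<^sub>m X) $$ (i, j)) has_field_derivative X $$ (i, j)) (at 0)"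
    using XM ij by (auto intro!: derivative_eq_intros)
qed (rule Q)

text \<open>The linearised equations bound the Lie algebra from above, and the Cayley curve realises
  each of their solutions as a tangent vector. The same scheme gives \<open>lie_Sg\<close>.\<close>

theorem lie_Pg: "lie_algebra n Pg = pa"
proof (intro equalityI subsetI)
  fix X assume X: "X \<in> lie_algebra n Pg"
  have "X \<in> sp" using lie_sub_sp[OF _ X] by (auto simp: Pg_def)
  moreover have "UT X" unfolding UT_def
  proof (intro allI impI)
    fix i j assume "i < n" "j < n" "lv j < lv i"
    then show "X $$ (i, j) = 0"
      by (intro lie_entry_zero[OF _ X]) (auto simp: Pg_def UT_def)
  qed
  ultimately show "X \<in> pa" by (simp add: pa_def)
next
  fix X assume X: "X \<in> pa"
  obtain c where c: "c 0 = 1\<^sub>m n"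
    "\<And>i j. i < n \<Longrightarrow> j < n \<Longrightarrow> ((\<lambda>t. c t $$ (i, j)) has_field_derivative X $$ (i, j)) (at 0)"
    and ev: "\<forall>\<^sub>F t in nhds (0::complex). c t \<in> Sp \<and> (UT X \<longrightarrow> UT (c t)) \<and> (BD X \<longrightarrow> BD (c t)) \<and>
       (F0 * X = X * F0 \<longrightarrow> F0 * c t = c t * F0)"
    by (rule cayley_curve[OF pa_sp[OF X]]) blast
  show "X \<in> lie_algebra n Pg"
  proof (rule lie_algebraI[OF pa_M[OF X] c])
    show "\<forall>\<^sub>F t in nhds 0. c t \<in> Pg" using ev by eventually_elim (use X in \<open>auto simp: Pg_def pa_def\<close>)
  qed
qed

theorem lie_Sg: "lie_algebra n Sg = La"
proof (intro equalityI subsetI)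
  fix X assume X: "X \<in> lie_algebra n Sg"
  have XM: "X \<in> M" using X by (simp add: lie_algebra_def)
  have "Sg \<subseteq> Sp" by (auto simp: Sg_iff)
  then have "X \<in> sp" using lie_sub_sp[OF _ X] by blast
  moreover have "BD X" unfolding BD_def
  proof (intro allI impI)
    fix i j assume "i < n" "j < n" "lv i \<noteq> lv j"
    then show "X $$ (i, j) = 0"
      by (intro lie_entry_zero[OF _ X]) (auto simp: Sg_def BD_def)
  qed
  moreover have "X $$ (du i, du j) = X $$ (i, j)" if ij: "i < r" "j < r" for i j
  proof -
    have ij': "i < n" "j < n" using ij r_le by auto
    have "X $$ (du i, du j) - X $$ (i, j) = 0"
    proof (rule lie_algebraD[OF X, where f = "\<lambda>A. A $$ (du i, du j) - A $$ (i, j)"])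
      show "(\<lambda>A. A $$ (du i, du j) - A $$ (i, j)) \<in> poly_functions (mat_coords n)"
        using ij' by (intro poly_functions_minus mat_coord) auto
      show "g $$ (du i, du j) - g $$ (i, j) = 0" if "g \<in> Sg" for g using that ij by (simp add: Sg_def)
      show "((\<lambda>t. (1\<^sub>m n + t \<cdot>\<^sub>m X) $$ (du i, du j) - (1\<^sub>m n + t \<cdot>\<^sub>m X) $$ (i, j))
          has_field_derivative X $$ (du i, du j) - X $$ (i, j)) (at 0)"
        using XM ij' by (auto intro!: derivative_eq_intros)
    qed
    then show ?thesis by simp
  qed
  ultimately show "X \<in> La" by (auto simp: La_def pa_def BD_UT)
next
  fix X assume X: "X \<in> La"
  have Xsp: "X \<in> sp" using X by (simp add: La_iff)
  obtain c where c: "c 0 = 1\<^sub>m n"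
    "\<And>i j. i < n \<Longrightarrow> j < n \<Longrightarrow> ((\<lambda>t. c t $$ (i, j)) has_field_derivative X $$ (i, j)) (at 0)"
    and ev: "\<forall>\<^sub>F t in nhds (0::complex). c t \<in> Sp \<and> (UT X \<longrightarrow> UT (c t)) \<and> (BD X \<longrightarrow> BD (c t)) \<and>
       (F0 * X = X * F0 \<longrightarrow> F0 * c t = c t * F0)"
    by (rule cayley_curve[OF Xsp]) blast
  show "X \<in> lie_algebra n Sg"
  proof (rule lie_algebraI[OF sp_M[OF Xsp] c])
    show "\<forall>\<^sub>F t in nhds 0. c t \<in> Sg" using ev by eventually_elim (use X in \<open>auto simp: Sg_iff La_iff\<close>)
  qed
qed

section \<open>Conjugation commutes with taking Lie algebras\<close>

lemma poly_functions_conj: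
  assumes g: "g \<in> Sp" and f: "f \<in> poly_functions (mat_coords n)"
  shows "\<exists>f'\<in>poly_functions (mat_coords n). \<forall>X\<in>M. f' X = f (conj_by g X)"
  using f
proof induction
  case (const a)
  then show ?case by (auto intro!: bexI[OF _ poly_functions.const])
next
  case (coord f)
  then obtain i j where ij: "f = (\<lambda>A. A $$ (i, j))" "i < n" "j < n" by (auto simp: mat_coords_def)
  define f' :: "complex mat \<Rightarrow> complex" where
    "f' X = (\<Sum>b<n. (\<Sum>a<n. g $$ (i, a) * X $$ (a, b)) * adj g $$ (b, j))" for X
  have "f' \<in> poly_functions (mat_coords n)" unfolding f'_def
    by (intro poly_functions_sum poly_functions.mult poly_functions_cmult mat_coord poly_functions.const) auto
  moreover have "f' X = f (conj_by g X)" if "X \<in> M" for X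
    using that g ij Sp_M[OF g] by (simp add: f'_def conj_by_Sp mult_entry[of _ n] del: index_mult_mat(1))
  ultimately show ?case by blast
next
  case (add f h)
  then obtain f' h' where "f' \<in> poly_functions (mat_coords n)" "h' \<in> poly_functions (mat_coords n)"
    "\<forall>X\<in>M. f' X = f (conj_by g X)" "\<forall>X\<in>M. h' X = h (conj_by g X)" by blast
  then show ?case by (intro bexI[OF _ poly_functions.add[of f' _ h']]) auto
next
  case (mult f h)
  then obtain f' h' where "f' \<in> poly_functions (mat_coords n)" "h' \<in> poly_functions (mat_coords n)"
    "\<forall>X\<in>M. f' X = f (conj_by g X)" "\<forall>X\<in>M. h' X = h (conj_by g X)" by blast
  then show ?case by (intro bexI[OF _ poly_functions.mult[of f' _ h']]) auto
qed

lemma lie_conj_sub: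
  assumes g: "g \<in> Sp" and Q: "Q \<subseteq> M"
  shows "conj_by g ` lie_algebra n Q \<subseteq> lie_algebra n (conj_by g ` Q)"
proof (clarify)
  fix X assume X: "X \<in> lie_algebra n Q"
  have XM: "X \<in> M" using X by (simp add: lie_algebra_def)
  show "conj_by g X \<in> lie_algebra n (conj_by g ` Q)"
    unfolding lie_algebra_def
  proof (intro CollectI conjI ballI impI conj_by_M g XM)
    fix f assume f: "f \<in> poly_functions (mat_coords n)" "\<forall>h\<in>conj_by g ` Q. f h = 0"
    obtain f' where f': "f' \<in> poly_functions (mat_coords n)" "\<forall>X\<in>M. f' X = f (conj_by g X)"
      using poly_functions_conj[OF g f(1)] by blast
    have "\<forall>h\<in>Q. f' h = 0" using f(2) f'(2) Q by auto
    then have "((\<lambda>t. f' (1\<^sub>m n + t \<cdot>\<^sub>m X)) has_field_derivative 0) (at 0)"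
      using X f'(1) unfolding lie_algebra_def by blast
    moreover have "f' (1\<^sub>m n + t \<cdot>\<^sub>m X) = f (1\<^sub>m n + t \<cdot>\<^sub>m conj_by g X)" for t
    proof -
      have "conj_by g (1\<^sub>m n) = 1\<^sub>m n" using Sp_adj_right[OF g] Sp_M[OF g] g by (simp add: conj_by_Sp)
      then show ?thesis using f'(2) XM g by (simp add: conj_by_add conj_by_smult)
    qed
    ultimately show "((\<lambda>t. f (1\<^sub>m n + t \<cdot>\<^sub>m conj_by g X)) has_field_derivative 0) (at 0)" by simp
  qed
qed

lemma lie_conj:
  assumes g: "g \<in> Sp" and Q: "Q \<subseteq> M"
  shows "lie_algebra n (conj_by g ` Q) = conj_by g ` lie_algebra n Q"
proof
  show "conj_by g ` lie_algebra n Q \<subseteq> lie_algebra n (conj_by g ` Q)" by (rule lie_conj_sub[OF g Q])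
  have sub: "conj_by g ` Q \<subseteq> M" using conj_by_M[OF g] Q by auto
  have eq: "conj_by (adj g) ` (conj_by g ` Q) = Q"
    unfolding image_image using Q g conj_by_adj by (intro image_cong[THEN trans, OF refl _ image_ident]) auto
  have "conj_by (adj g) ` lie_algebra n (conj_by g ` Q) \<subseteq> lie_algebra n Q"
    using lie_conj_sub[OF Sp_adj[OF g] sub] unfolding eq .
  then have "conj_by g ` conj_by (adj g) ` lie_algebra n (conj_by g ` Q) \<subseteq> conj_by g ` lie_algebra n Q"
    by (rule image_mono)
  moreover have "conj_by g ` conj_by (adj g) ` lie_algebra n (conj_by g ` Q) = lie_algebra n (conj_by g ` Q)"
    unfolding image_image using g conj_by_adj'
    by (intro image_cong[THEN trans, OF refl _ image_ident]) (auto simp: lie_algebra_def)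
  ultimately show "lie_algebra n (conj_by g ` Q) \<subseteq> conj_by g ` lie_algebra n Q" by simp
qed

section \<open>Stabilisers of linear forms\<close>

lemma pa_zero: "0\<^sub>m n n \<in> pa" by (auto simp: pa_def sp_def UT_def adj_zero intro!: eq_matI)
lemma pa_add: "X \<in> pa \<Longrightarrow> Y \<in> pa \<Longrightarrow> X + Y \<in> pa"
  by (auto simp: pa_def sp_def UT_add adj_add intro!: eq_matI)
lemma sp_smult: "X \<in> sp \<Longrightarrow> c \<cdot>\<^sub>m X \<in> sp"
  by (auto simp: sp_def adj_smult intro!: eq_matI)
lemma sp_add: "X \<in> sp \<Longrightarrow> Y \<in> sp \<Longrightarrow> X + Y \<in> sp"
  by (auto simp: sp_def adj_add intro!: eq_matI)
lemma sp_minus: "X \<in> sp \<Longrightarrow> Y \<in> sp \<Longrightarrow> X - Y \<in> sp"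
  by (auto simp: sp_def adj_minus intro!: eq_matI)
lemma pa_smult: "X \<in> pa \<Longrightarrow> c \<cdot>\<^sub>m X \<in> pa"
  by (simp add: pa_def sp_smult UT_smult sp_M)

sublocale W: mat_subspace n pa
  by unfold_locales (auto simp: pa_zero pa_add pa_smult pa_M)

lemma bracket_sp: assumes "X \<in> sp" "Y \<in> sp" shows "X * Y - Y * X \<in> sp"
proof -
  have c: "X \<in> M" "Y \<in> M" "adj X = - X" "adj Y = - Y" using assms by (auto simp: sp_def)
  have "adj (X * Y - Y * X) = Y * X - X * Y"
    using c by (simp add: adj_minus adj_mult mult_M)
  also have "\<dots> = - (X * Y - Y * X)" using c(1,2) by (intro eq_matI) (auto simp del: index_mult_mat(1))
  finally show ?thesis using c by (simp add: sp_def)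
qed

lemma bracket_pa: "X \<in> pa \<Longrightarrow> Y \<in> pa \<Longrightarrow> X * Y - Y * X \<in> pa"
  by (simp add: pa_def bracket_sp UT_minus UT_mult sp_M)

section \<open>Coadjoint stabilisers and the trace pairing\<close>

lemma Ad_pa: "X \<in> pa \<Longrightarrow> Ad n Pg g X = conj_by g X"
  by (simp add: Ad_def lie_Pg)

lemma group_stab_Pg: "group_stab n Pg \<gamma> = {g \<in> Pg. \<forall>X\<in>pa. \<gamma> (conj_by g X) = \<gamma> X}"
  by (auto simp: group_stab_def lie_Pg Ad_pa)

lemma lie_stab_Pg: "lie_stab n Pg \<gamma> = {X \<in> pa. \<forall>Y\<in>pa. \<gamma> (X * Y - Y * X) = 0}"
  by (simp add: lie_stab_def lie_Pg)

text \<open>Through the trace pairing the coadjoint action becomes conjugation of \<open>F\<close>.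
  The matrix is not unique: by \<open>pa_orth\<close> and \<open>tr_strict_upper\<close>, what the
  form fails to see of a matrix in \<open>sp\<close> is exactly its part strictly above the diagonal
  blocks.\<close>

definition gam :: "complex mat \<Rightarrow> complex mat \<Rightarrow> complex" where
  "gam F = (\<lambda>X\<in>pa. tr (F * X))"

lemma gam_dual: "F \<in> M \<Longrightarrow> gam F \<in> lie_dual n Pg"
  unfolding lie_dual_def lie_Pg gam_def
  by (auto simp: pa_add pa_smult pa_M mult_M tr_add[of _ n] tr_smult[of _ n])

lemma F0_sp: "F0 \<in> sp"
proof -
  have "adj F0 $$ (i, j) = (- F0) $$ (i, j)" if "i < n" "j < n" for i j
    using that r_le by (auto simp: adj_entry F0_def sg_def)
  then show ?thesis by (auto simp: sp_def intro!: eq_matI)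
qed

lemma tr_shift: assumes "g \<in> Sp" "F \<in> M" "X \<in> M"
  shows "tr (F * conj_by g X) = tr (conj_by (adj g) F * X)"
proof -
  have "F * conj_by g X = conj_by g (conj_by (adj g) F * X)"
    using assms by (simp add: conj_by_times conj_by_M Sp_adj conj_by_adj')
  then show ?thesis using assms by (simp add: tr_conj_by conj_by_M Sp_adj)
qed

definition el :: "nat \<Rightarrow> nat \<Rightarrow> complex mat" where
  "el a b = mat n n (\<lambda>(i, j). if i = a \<and> j = b then 1 else 0)"

lemma el_M [simp]: "el a b \<in> M" by (simp add: el_def)

lemma tr_el: assumes "F \<in> M" "a < n" "b < n" shows "tr (F * el a b) = F $$ (b, a)"
proof -
  have "tr (F * el a b) = (\<Sum>i<n. \<Sum>k<n. if i = b then (if k = a then F $$ (b, a) else 0) else 0)"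
    using assms by (simp add: tr_mult[of _ n]) (intro sum.cong, auto simp: el_def)
  also have "\<dots> = (\<Sum>i<n. if i = b then F $$ (b, a) else 0)" using assms by (intro sum.cong) auto
  finally show ?thesis using assms by simp
qed

lemma tr_adj_skew: assumes "F \<in> M" "X \<in> sp" shows "tr (adj F * X) = - tr (F * X)"
proof -
  have c: "X \<in> M" "adj X = - X" using assms by (auto simp: sp_def)
  have "tr (adj F * X) = tr (adj (adj F * X))" using assms c by (simp add: tr_adj)
  also have "\<dots> = - tr (X * F)" using assms c by (simp add: adj_mult adj_adj mult_M tr_uminus[of _ n])
  finally show ?thesis using tr_comm[of X n F] assms c by simp
qed

lemma el_skew_pa:
  assumes "i < n" "j < n" "lv i \<le> lv j"
  shows "el i j - adj (el i j) \<in> pa"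
proof -
  have "adj (el i j - adj (el i j)) = adj (el i j) - el i j" by (simp add: adj_minus adj_adj)
  also have "\<dots> = - (el i j - adj (el i j))" by (intro eq_matI) (auto simp: adj_def el_def)
  finally have "el i j - adj (el i j) \<in> sp" by (simp add: sp_def)
  moreover have "UT (el i j)" using assms by (auto simp: UT_def el_def)
  ultimately show ?thesis by (simp add: pa_def UT_minus UT_adj)
qed

text \<open>The skew-symmetrised unit \<open>el j i - adj (el j i)\<close> lies in \<open>pa\<close>
  because \<open>lv j \<le> lv i\<close>. Since \<open>N\<close> is skew, its two halves contribute
  equally to the trace, together twice the entry.\<close>

lemma pa_orth:
  assumes N: "N \<in> sp" and orth: "\<And>X. X \<in> pa \<Longrightarrow> tr (N * X) = 0"
    and ij: "i < n" "j < n" "lv j \<le> lv i"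
  shows "N $$ (i, j) = 0"
proof -
  have NM: "N \<in> M" using N by (rule sp_M)
  have "tr (N * adj (el j i)) = tr (adj (el j i) * N)" using NM by (intro tr_comm) auto
  also have "\<dots> = - tr (el j i * N)" by (rule tr_adj_skew[OF el_M N])
  also have "\<dots> = - tr (N * el j i)" using tr_comm[of "el j i" n N] NM by simp
  finally have "tr (N * (el j i - adj (el j i))) = 2 * N $$ (i, j)"
    using NM ij by (simp add: mult_M tr_minus[of _ n] tr_el)
  then show ?thesis using orth[OF el_skew_pa[of j i]] ij by simp
qed

lemma tr_strict_upper:
  assumes "N \<in> M" "X \<in> M" "UT X" "\<And>i j. i < n \<Longrightarrow> j < n \<Longrightarrow> lv j \<le> lv i \<Longrightarrow> N $$ (i, j) = 0"
  shows "tr (N * X) = 0"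
  unfolding tr_mult[OF assms(1,2)]
proof (intro sum.neutral ballI)
  fix i k assume "i \<in> {..<n}" "k \<in> {..<n}"
  then show "N $$ (i, k) * X $$ (k, i) = 0"
    using assms(3,4)[unfolded UT_def] by (cases "lv k \<le> lv i") auto
qed

section \<open>Projection to the diagonal blocks\<close>

definition dp :: "complex mat \<Rightarrow> complex mat" where
  "dp X = mat n n (\<lambda>(i, j). if lv i = lv j then X $$ (i, j) else 0)"

lemma dp_M [simp]: "dp X \<in> M" by (simp add: dp_def)
lemma dp_dim [simp]: "dim_row (dp X) = n" "dim_col (dp X) = n" by (simp_all add: dp_def)
lemma dp_entry: "i < n \<Longrightarrow> j < n \<Longrightarrow> dp X $$ (i, j) = (if lv i = lv j then X $$ (i, j) else 0)"
  by (simp add: dp_def)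
lemma dp_BD: "BD (dp X)" by (auto simp: BD_def dp_entry)
lemma dp_id: "X \<in> M \<Longrightarrow> BD X \<Longrightarrow> dp X = X" by (intro eq_matI) (auto simp: dp_entry BD_def)
lemma dp_one: "dp (1\<^sub>m n) = 1\<^sub>m n" by (intro eq_matI) (auto simp: dp_entry)

lemma lv_last: assumes "n - r \<le> k" "k < n" shows "t < lv k"
proof -
  have "du k < r" using assms by auto
  then show ?thesis using lv_first[of "du k"] lv_du[OF assms(2)] by linarith
qed

lemma lv_ge: "r \<le> k \<Longrightarrow> k < n \<Longrightarrow> t \<le> lv k"
  using lv_mid[of k] lv_last[of k] by (cases "k < n - r") auto

lemma lv_du_eq: "i < n \<Longrightarrow> j < n \<Longrightarrow> lv (du i) = lv (du j) \<longleftrightarrow> lv i = lv j"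
  using lv_du[of i] lv_du[of j] by linarith

lemma lv_du_less: "i < n \<Longrightarrow> j < n \<Longrightarrow> lv (du i) < lv (du j) \<longleftrightarrow> lv j < lv i"
  using lv_du[of i] lv_du[of j] by linarith

lemma dp_adj: "dp (adj X) = adj (dp X)"
proof (intro eq_matI)
  fix i j assume "i < dim_row (adj (dp X))" "j < dim_col (adj (dp X))"
  then have ij: "i < n" "j < n" by auto
  show "dp (adj X) $$ (i, j) = adj (dp X) $$ (i, j)"
    using ij lv_du_eq[OF ij(2,1)] by (auto simp: dp_entry adj_entry)
qed auto

text \<open>For block triangular factors a path i, k, j between indices of equal level cannot leave
  that level, so only the diagonal blocks contribute. On \<open>Pg\<close> this is the projection to
  the Levi factor.\<close>

lemma dp_mult: assumes "A \<in> M" "B \<in> M" "UT A" "UT B" shows "dp (A * B) = dp A * dp B"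
proof (rule eq_matI)
  fix i j assume "i < dim_row (dp A * dp B)" "j < dim_col (dp A * dp B)"
  then have ij: "i < n" "j < n" by auto
  have "A $$ (i, k) * B $$ (k, j) = dp A $$ (i, k) * dp B $$ (k, j)" if "k < n" "lv i = lv j" for k
  proof (cases "lv k = lv i")
    case False
    then have "lv k < lv i \<or> lv j < lv k" using that by linarith
    then show ?thesis using assms(3,4) False that ij by (auto simp: UT_def dp_entry)
  qed (use that ij in \<open>simp add: dp_entry\<close>)
  moreover have "dp A $$ (i, k) * dp B $$ (k, j) = 0" if "k < n" "lv i \<noteq> lv j" for k
    using that ij by (auto simp: dp_entry)
  ultimately have "(\<Sum>k<n. dp A $$ (i, k) * dp B $$ (k, j)) =
      (if lv i = lv j then (\<Sum>k<n. A $$ (i, k) * B $$ (k, j)) else 0)"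
    by (auto intro: sum.neutral)
  then show "dp (A * B) $$ (i, j) = (dp A * dp B) $$ (i, j)"
    unfolding mult_entry[OF dp_M dp_M ij] dp_entry[OF ij] mult_entry[OF assms(1,2) ij] by simp
qed auto

lemma dp_Sp: assumes "g \<in> Pg" shows "dp g \<in> Sp"
proof -
  have "adj (dp g) * dp g = dp (adj g * g)"
    using assms by (simp add: dp_mult Pg_M Pg_UT UT_adj dp_adj)
  also have "\<dots> = 1\<^sub>m n" using Sp_adj_left[OF Pg_Sp[OF assms]] by (simp add: dp_one)
  finally show ?thesis by (simp add: Sp_def)
qed

lemma La_sp: "X \<in> La \<Longrightarrow> X \<in> sp" and La_BD: "X \<in> La \<Longrightarrow> BD X" and La_pa: "X \<in> La \<Longrightarrow> X \<in> pa"
  and La_F0: "X \<in> La \<Longrightarrow> F0 * X = X * F0"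
  using La_iff[of X] by (auto simp: La_def pa_def)

lemma La_M: "X \<in> La \<Longrightarrow> X \<in> M" by (simp add: La_sp sp_M)

lemma La_antisym:
  assumes "D \<in> La" "i < r" "j < r" shows "D $$ (j, i) = - D $$ (i, j)"
proof -
  have n: "i < n" "j < n" "i < l" "j < l" using assms r_le by auto
  have "adj D $$ (j, i) = (- D) $$ (j, i)" using La_sp[OF assms(1)] by (simp add: sp_def)
  then have "D $$ (du i, du j) = - D $$ (j, i)"
    using n La_M[OF assms(1)] by (simp add: adj_entry sg_def)
  then show ?thesis using assms by (simp add: La_def)
qed

section \<open>Group elements relating two forms \<open>F0 + D'\<close> and
  \<open>F0 + D\<close>\<close>

context
  fixes D D' h
  assumes D: "D \<in> La" and D': "D' \<in> La" and h: "h \<in> Pg"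
    and eq: "\<And>X. X \<in> pa \<Longrightarrow> tr ((F0 + D') * conj_by h X) = tr ((F0 + D) * X)"
begin

lemma stab_entries:
  assumes ij: "i < n" "j < n" "lv j \<le> lv i"
  shows "(F0 * h) $$ (i, j) + (D' * h) $$ (i, j) = (h * F0) $$ (i, j) + (h * D) $$ (i, j)"
proof -
  have M: "D \<in> M" "D' \<in> M" "h \<in> M" "h \<in> Sp" using D D' h by (auto simp: La_M Pg_M Pg_Sp)
  define N where "N = conj_by (adj h) (F0 + D') - (F0 + D)"
  have NM: "N \<in> M" using M by (simp add: N_def conj_by_M Sp_adj)
  have Nsp: "N \<in> sp" using M D D' by (simp add: N_def sp_minus conj_by_sp sp_add F0_sp La_sp Sp_adj)
  have "tr (N * X) = 0" if "X \<in> pa" for X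
    using eq[OF that] tr_shift[OF M(4), of "F0 + D'" X] M that
    by (simp add: N_def mult_M(5) pa_M conj_by_M Sp_adj tr_minus[of _ n])
  then have N0: "N $$ (i, j) = 0" if "i < n" "j < n" "lv j \<le> lv i" for i j
    using pa_orth[OF Nsp] that by blast
  have "(h * N) $$ (i, j) = (\<Sum>k<n. h $$ (i, k) * N $$ (k, j))"
    using M NM ij by (simp add: mult_entry[of _ n] del: index_mult_mat(1))
  also have "\<dots> = 0"
  proof (intro sum.neutral ballI)
    fix k assume "k \<in> {..<n}"
    then show "h $$ (i, k) * N $$ (k, j) = 0"
      using N0[of k j] Pg_UT[OF h] ij unfolding UT_def by (cases "lv j \<le> lv k") auto
  qed
  finally have hN: "(h * N) $$ (i, j) = 0" .
  have "h * N = h * (adj h * (F0 + D') * h) - h * (F0 + D)"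
    using M by (simp add: N_def conj_by_Sp Sp_adj adj_adj mult_M(4))
  also have "h * (adj h * (F0 + D') * h) = (h * adj h) * (F0 + D') * h"
    using M by (simp only: mult_M(1) M_closed adj_carrier F0_M)
  also have "\<dots> = F0 * h + D' * h" using M by (simp add: Sp_adj_right mult_M)
  finally have "(F0 * h + D' * h - h * (F0 + D)) $$ (i, j) = 0" using hN by simp
  then show ?thesis using M ij by (simp add: mult_M(2) del: index_mult_mat(1))
qed

lemma strict_zero:
  assumes "i < n" "j < n" "lv j < lv i"
  shows "(D' * h) $$ (i, j) = 0" "(h * D) $$ (i, j) = 0"
proof -
  have "UT (D' * h)" "UT (h * D)"
    using D D' h by (auto intro!: UT_mult intro: La_M Pg_M Pg_UT BD_UT La_BD)
  then show "(D' * h) $$ (i, j) = 0" "(h * D) $$ (i, j) = 0"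
    using assms by (auto simp: UT_def simp del: index_mult_mat(1))
qed

text \<open>Below the diagonal blocks the products with \<open>D\<close> and \<open>D'\<close>
  vanish, so there \<open>F0 * h\<close> and \<open>h * F0\<close> agree.\<close>

lemma stab_strict:
  assumes ij: "i < n" "j < n" "lv j < lv i"
  shows "(if du i < r then h $$ (du i, j) else 0) = (if j < r then h $$ (i, du j) else 0)"
  using stab_entries[OF ij(1,2)] strict_zero[OF ij] ij Pg_M[OF h] F0_left[of h i j] F0_right[of h i j] by simp

lemma stab_first_last: assumes "i < r" "j < r" shows "h $$ (i, j) = h $$ (du i, du j)"
proof -
  have *: "i < n" "j < n" "lv i < t" "lv j < t" using assms r_le lv_first by auto
  then have "lv j < lv (du i)" using lv_du[of i] by linarith
  then show ?thesis using stab_strict[of "du i" j] * assms by simp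
qed

lemma stab_dp: "dp h \<in> Sg"
  unfolding Sg_def Pg_def
proof (intro CollectI conjI allI impI dp_Sp h dp_BD BD_UT[OF dp_BD])
  fix i j assume ij: "i < r" "j < r"
  then have "i < n" "j < n" using r_le by auto
  then show "dp h $$ (du i, du j) = dp h $$ (i, j)"
    using stab_first_last[OF ij] lv_du_eq[of i j] by (simp add: dp_entry)
qed

text \<open>Outside the corner of first rows and last columns, the entries of \<open>Z\<close>
  vanish by \<open>dp h = 1\<close>, by triangularity, or because \<open>stab_strict\<close> equates
  them with zero or with an entry below the diagonal blocks. In the corner the symplectic condition
  makes \<open>Z\<close> symmetric about the antidiagonal, whereas the equations on the diagonal
  blocks equate it with the skew matrix \<open>D' - D\<close>; so both are zero.\<close>

lemma stab_unipotent:
  assumes dp: "dp h = 1\<^sub>m n"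
  shows "h = 1\<^sub>m n" "D' = D"
proof -
  have hM: "h \<in> M" and hSp: "h \<in> Sp" and M: "D \<in> M" "D' \<in> M" using h D D' by (auto simp: Pg_M Pg_Sp La_M)
  define Z where "Z = h - 1\<^sub>m n"
  have ZM: "Z \<in> M" using hM by (simp add: Z_def)
  have h_eq: "h = 1\<^sub>m n + Z" using hM by (auto simp: Z_def intro!: eq_matI)
  have Z0: "Z $$ (i, j) = 0" if ij: "i < n" "j < n" and b: "\<not> (i < r \<and> n - r \<le> j)" for i j
  proof (cases "lv j \<le> lv i")
    case True
    show ?thesis
    proof (cases "lv j = lv i")
      case True
      have "h $$ (i, j) = dp h $$ (i, j)" using True ij by (simp add: dp_entry)
      then show ?thesis using dp ij hM by (simp add: Z_def)
    next
      case False
      then have "lv j < lv i" using True by simp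
      then show ?thesis using Pg_UT[OF h] ij hM by (auto simp: Z_def UT_def)
    qed
  next
    case False
    then have less: "lv i < lv j" and ne: "i \<noteq> j" by auto
    have "h $$ (i, j) = 0"
    proof (cases "i < r")
      case True
      then have j: "j < n - r" using b by auto
      show ?thesis
      proof (cases "j < r")
        case jr: True
        have "lv (du j) < lv (du i)" using lv_du_less[of j i] less ij by simp
        then show ?thesis using stab_first_last[OF True jr] Pg_UT[OF h] ij by (auto simp: UT_def)
      next
        case jr: False
        have "lv j = t" using lv_mid jr j by simp
        moreover have "lv i < t" using True lv_first by simp
        ultimately have "lv j < lv (du i)" using lv_du[OF ij(1)] by linarith
        then show ?thesis using stab_strict[of "du i" j] ij True jr by simp
      qed
    next
      case False
      show ?thesis
      proof (cases "i < n - r")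
        case True
        then have it: "lv i = t" using False lv_mid by simp
        have "\<not> j < n - r"
        proof
          assume "j < n - r"
          then have "lv j = t" using lv_mid[of j] lv_first[of j] less it by (cases "j < r") auto
          then show False using less it by simp
        qed
        then have "du j < r" using ij by auto
        moreover have "lv (du j) < lv i" using lv_du[OF ij(2)] less it by linarith
        moreover have "\<not> du i < r" using True by auto
        ultimately show ?thesis using stab_strict[of i "du j"] ij by simp
      next
        case iF: False
        then have dui: "du i < r" using ij by auto
        have "lv (du j) < lv (du i)" using lv_du_less[of j i] less ij by simp
        have "lv i > t" using lv_du[OF ij(1)] lv_first[OF dui] by linarith
        then have "lv (du j) < t" using lv_du[OF ij(2)] less by linarith
        have duj: "du j < r"
        proof (rule ccontr)
          assume "\<not> du j < r"
          then have "t \<le> lv (du j)"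
            using lv_ge[of "du j"] ij by simp
          then show False using \<open>lv (du j) < t\<close> by simp
        qed
        have "h $$ (i, j) = h $$ (du i, du j)" using stab_first_last[OF dui duj] ij by simp
        also have "\<dots> = 0" using \<open>lv (du j) < lv (du i)\<close> Pg_UT[OF h] ij by (auto simp: UT_def)
        finally show ?thesis .
      qed
    qed
    then show ?thesis using ij ne hM by (simp add: Z_def)
  qed
  have aZ0: "adj Z $$ (i, j) = 0" if ij: "i < n" "j < n" and b: "\<not> (i < r \<and> n - r \<le> j)" for i j
  proof -
    have "\<not> (du j < r \<and> n - r \<le> du i)" using b ij by auto
    then show ?thesis using ij Z0[of "du j" "du i"] by (simp add: adj_entry)
  qed
  have zero: "A * B = 0\<^sub>m n n" if A: "A \<in> M" "\<And>i j. i < n \<Longrightarrow> j < n \<Longrightarrow> \<not> (n - r \<le> j) \<Longrightarrow> A $$ (i, j) = 0"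
    and B: "B \<in> M" "\<And>i j. i < n \<Longrightarrow> j < n \<Longrightarrow> \<not> (i < r) \<Longrightarrow> B $$ (i, j) = 0" for A B
  proof (rule eq_matI)
    fix i j assume "i < dim_row (0\<^sub>m n n :: complex mat)" "j < dim_col (0\<^sub>m n n :: complex mat)"
    then have ij: "i < n" "j < n" by auto
    have "A $$ (i, k) * B $$ (k, j) = 0" if "k < n" for k
      using A(2)[of i k] B(2)[of k j] that ij r_le by (cases "k < r") auto
    then show "(A * B) $$ (i, j) = (0\<^sub>m n n) $$ (i, j)"
      using ij A(1) B(1) mult_entry[of A n B i j] by (auto intro: sum.neutral)
  qed (use A B in auto)
  have "adj Z * Z = 0\<^sub>m n n" using ZM aZ0 Z0 by (intro zero) auto
  moreover have "adj h * h = 1\<^sub>m n" by (rule Sp_adj_left[OF hSp])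
  moreover have "adj h * h = 1\<^sub>m n + (adj Z + Z) + adj Z * Z"
    using ZM unfolding h_eq by (simp add: adj_add mult_M) (intro eq_matI, auto simp del: index_mult_mat(1))
  ultimately have "1\<^sub>m n + (adj Z + Z) + 0\<^sub>m n n = 1\<^sub>m n" by simp
  then have e: "(1\<^sub>m n + (adj Z + Z) + 0\<^sub>m n n) $$ (i, j) = (1\<^sub>m n :: complex mat) $$ (i, j)" for i j by simp
  have Zs: "adj Z $$ (i, j) = - Z $$ (i, j)" if ij: "i < n" "j < n" for i j
    using e[of i j] ij ZM by (simp add: add_eq_0_iff2)
  have Zsym: "Z $$ (i, du j) = Z $$ (j, du i)" if ij: "i < r" "j < r" for i j
  proof -
    have n: "i < n" "j < n" "i < l" "j < l" "\<not> du j < l" using ij r_le by auto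
    then show ?thesis using Zs[of i "du j"] by (simp add: adj_entry sg_def)
  qed
  have DZ: "D' $$ (i, j) = Z $$ (i, du j) + D $$ (i, j)" if ij: "i < r" "j < r" "lv j \<le> lv i" for i j
  proof -
    have n: "i < n" "j < n" "i < l" "j < l" "i \<noteq> du j" using ij r_le by auto
    have a: "(D' * Z) $$ (i, j) = 0"
    proof -
      have "D' $$ (i, k) * Z $$ (k, j) = 0" if "k < n" for k
      proof -
        have "\<not> (k < r \<and> n - r \<le> j)" using ij r_le by linarith
        then show ?thesis using Z0[of k j] that n by simp
      qed
      then show ?thesis using mult_entry[OF M(2) ZM n(1,2)] by (auto intro: sum.neutral)
    qed
    have b: "(Z * D) $$ (i, j) = 0"
    proof -
      have "Z $$ (i, k) * D $$ (k, j) = 0" if "k < n" for k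
      proof (cases "k < n - r")
        case False
        then have "r \<le> k" using r_le by linarith
        then have "lv k \<noteq> lv j" using lv_ne[of j k] ij that by auto
        then show ?thesis using La_BD[OF D] that n by (auto simp: BD_def)
      qed (use Z0[of i k] that n in auto)
      then show ?thesis using mult_entry[OF ZM M(1) n(1,2)] by (auto intro: sum.neutral)
    qed
    have "\<not> du i < r" using ij r_le by auto
    then have "(D' * h) $$ (i, j) = h $$ (i, du j) + (h * D) $$ (i, j)"
      using stab_entries[OF n(1,2) ij(3)] F0_left[OF hM n(1,2)] F0_right[OF hM n(1,2)] ij by simp
    moreover have "(D' * h) $$ (i, j) = D' $$ (i, j)"
      using a n M ZM unfolding h_eq by (simp add: mult_M(2) del: index_mult_mat(1))
    moreover have "(h * D) $$ (i, j) = D $$ (i, j)"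
      using b n M ZM unfolding h_eq by (simp add: mult_M(3) del: index_mult_mat(1))
    moreover have "h $$ (i, du j) = Z $$ (i, du j)" using n hM by (simp add: Z_def)
    ultimately show ?thesis by simp
  qed
  \<comment> \<open>On a diagonal block compare (i, j) with (j, i): \<open>D\<close> and
    \<open>D'\<close> change sign, the entry of \<open>Z\<close> does not. Between different levels
    \<open>D\<close> and \<open>D'\<close> have no entries, and \<open>DZ\<close> gives the claim at
    once.\<close>
  have Z1: "Z $$ (i, du j) = 0" if ij: "i < r" "j < r" "lv j \<le> lv i" for i j
  proof -
    have n: "i < n" "j < n" using ij r_le by auto
    show ?thesis
    proof (cases "lv i = lv j")
      case True
      have "D' $$ (j, i) = Z $$ (j, du i) + D $$ (j, i)" using DZ[OF ij(2,1)] True by simp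
      then show ?thesis
        using DZ[OF ij] Zsym[OF ij(1,2)] La_antisym[OF D ij(1,2)] La_antisym[OF D' ij(1,2)] by simp
    next
      case False
      then show ?thesis using DZ[OF ij] La_BD[OF D] La_BD[OF D'] n by (simp add: BD_def)
    qed
  qed
  have Z2: "Z $$ (i, j) = 0" if ij: "i < n" "j < n" for i j
  proof (cases "i < r \<and> n - r \<le> j")
    case True
    then have j: "du j < r" using ij by auto
    have "Z $$ (i, du (du j)) = 0"
    proof (cases "lv (du j) \<le> lv i")
      case c: True
      show ?thesis by (rule Z1) (use True j c in auto)
    next
      case c: False
      have "Z $$ (i, du (du j)) = Z $$ (du j, du i)" by (rule Zsym) (use True j in auto)
      also have "\<dots> = 0" by (rule Z1) (use True j c in auto)
      finally show ?thesis .
    qed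
    then show ?thesis using ij by simp
  qed (use Z0[OF ij] in auto)
  then have "Z = 0\<^sub>m n n" using ZM by (intro eq_matI) auto
  then show h1: "h = 1\<^sub>m n" using h_eq by (auto intro!: eq_matI)
  show "D' = D"
  proof (rule eq_matI)
    fix i j assume "i < dim_row D" "j < dim_col D"
    then have ij: "i < n" "j < n" using M by auto
    show "D' $$ (i, j) = D $$ (i, j)"
    proof (cases "lv i = lv j")
      case True
      have "(F0 * h) $$ (i, j) = (h * F0) $$ (i, j)" by (simp add: h1)
      then show ?thesis using stab_entries[OF ij] True M by (simp add: h1)
    qed (use La_BD[OF D] La_BD[OF D'] ij in \<open>simp add: BD_def\<close>)
  qed (use M in auto)
qed

end

section \<open>Stabilisers of \<open>F0 + D\<close> and of \<open>F0\<close>\<close>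

lemma Sg_Pg: "h \<in> Sg \<Longrightarrow> h \<in> Pg" by (simp add: Sg_def)

lemma conj_by_commute:
  assumes "g \<in> Sp" "X \<in> M"
  shows "conj_by g X = X \<longleftrightarrow> g * X = X * g"
proof
  assume "conj_by g X = X"
  then have "X * g = conj_by g X * g" by simp
  also have "\<dots> = g * X * (adj g * g)" using assms Sp_M[OF assms(1)] by (simp add: conj_by_Sp mult_M)
  also have "\<dots> = g * X" using assms Sp_M[OF assms(1)] by (simp add: Sp_adj_left)
  finally show "g * X = X * g" by simp
next
  assume "g * X = X * g"
  then have "conj_by g X = X * (g * adj g)" using assms Sp_M[OF assms(1)] by (simp add: conj_by_Sp mult_M)
  then show "conj_by g X = X" using assms by (simp add: Sp_adj_right)
qed

lemma Sg_adj: assumes "h \<in> Sg" shows "adj h \<in> Sg"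
proof -
  have h: "h \<in> Sp" "BD h" "F0 * h = h * F0" using assms by (auto simp: Sg_iff)
  have "adj h * h = 1\<^sub>m n" "h * adj h = 1\<^sub>m n" using h Sp_adj_left Sp_adj_right by auto
  have "BD (adj h)" using BD_inverse[of h "adj h"] h Sp_M Sp_adj_right by auto
  moreover have "F0 * adj h = adj h * F0"
  proof -
    have "conj_by h F0 = F0" using h conj_by_commute by auto
    then have "conj_by (adj h) F0 = F0" using conj_by_adj[OF h(1), of F0] by simp
    then show ?thesis using conj_by_commute[of "adj h" F0] h Sp_adj by auto
  qed
  ultimately show ?thesis using h by (simp add: Sg_iff Sp_adj)
qed

lemma Sg_F0: "h \<in> Sg \<Longrightarrow> conj_by h F0 = F0"
  using conj_by_commute[of h F0] by (simp add: Sg_iff)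

lemma Sg_La: assumes "h \<in> Sg" "X \<in> La" shows "conj_by h X \<in> La"
proof -
  have h: "h \<in> Sp" "BD h" and X: "X \<in> sp" "BD X" "F0 * X = X * F0" using assms by (auto simp: Sg_iff La_iff)
  have "BD (conj_by h X)"
    using h X Sg_adj[OF assms(1)] by (simp add: conj_by_Sp BD_mult Sp_M sp_M Sg_iff)
  moreover have "F0 * conj_by h X = conj_by h X * F0"
    using conj_by_times[OF h(1) F0_M sp_M[OF X(1)]] conj_by_times[OF h(1) sp_M[OF X(1)] F0_M] Sg_F0[OF assms(1)] X(3) by simp
  ultimately show ?thesis using h X by (simp add: La_iff conj_by_sp)
qed

text \<open>Write \<open>h = d * g\<close> with \<open>d\<close> the diagonal blocks of
  \<open>h\<close>. As \<open>d\<close> fixes \<open>F0\<close>, the factor \<open>g\<close> relates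
  the forms of \<open>F0 + D'\<close> and \<open>F0 + D\<close>, where
  \<open>D' = conj_by (adj d) D\<close> again lies in \<open>La\<close>. Now
  \<open>stab_unipotent\<close> gives \<open>g = 1\<close> and \<open>D' = D\<close>, and the latter
  says that \<open>d\<close> commutes with \<open>D\<close>.\<close>

theorem stab_Levi:
  assumes D: "D \<in> La" and h: "h \<in> group_stab n Pg (gam (F0 + D))"
  shows "h \<in> Sg" "h * D = D * h"
proof -
  have hP: "h \<in> Pg" and eq: "\<And>X. X \<in> pa \<Longrightarrow> tr ((F0 + D) * conj_by h X) = tr ((F0 + D) * X)"
    using h by (auto simp: group_stab_Pg gam_def conj_by_pa)
  have DM: "D \<in> M" using La_M[OF D] .
  define d where "d = dp h"
  have dS: "d \<in> Sg" unfolding d_def by (rule stab_dp[OF D D hP]) (rule eq)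
  have dSp: "d \<in> Sp" "adj d \<in> Sp" and dM: "d \<in> M" "adj d \<in> M" and dP: "adj d \<in> Pg"
    using dS Sg_adj[OF dS] by (auto simp: Sg_iff Sp_M Sg_Pg)
  define D' where "D' = conj_by (adj d) D"
  have D': "D' \<in> La" unfolding D'_def by (rule Sg_La[OF Sg_adj[OF dS] D])
  have FD: "F0 + D' = conj_by (adj d) (F0 + D)"
    using dSp DM Sg_F0[OF Sg_adj[OF dS]] by (simp add: D'_def conj_by_add)
  define g where "g = adj d * h"
  have gP: "g \<in> Pg" using dP hP by (simp add: g_def Pg_mult)
  have "tr ((F0 + D') * conj_by g X) = tr ((F0 + D) * X)" if X: "X \<in> pa" for X
  proof -
    have "(F0 + D') * conj_by g X = conj_by (adj d) ((F0 + D) * conj_by h X)"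
      using X hP dSp DM by (simp add: FD g_def conj_by_mult conj_by_times Pg_Sp pa_M conj_by_M)
    then show ?thesis using eq[OF X] dSp DM X hP by (simp add: tr_conj_by pa_M conj_by_M Pg_Sp)
  qed
  note eq' = this
  have "dp g = adj d * d"
    using dP hP dp_id[of "adj d"] Sg_adj[OF dS]
    by (simp add: g_def dp_mult Pg_M Pg_UT Sg_iff d_def[symmetric])
  then have "dp g = 1\<^sub>m n" using dSp by (simp add: Sp_adj_left)
  then have g1: "g = 1\<^sub>m n" and DD: "D' = D"
    using stab_unipotent[OF D D' gP] eq' by blast+
  have "h = d * g" using dSp dM Pg_M[OF hP] by (simp add: g_def Sp_adj_right flip: mult_M(1))
  then have hd: "h = d" using g1 dM by simp
  then show "h \<in> Sg" using dS by simp
  have "conj_by d D = D" using DD conj_by_adj'[OF dSp(1) DM] by (simp add: D'_def)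
  then show "h * D = D * h" using conj_by_commute[OF dSp(1) DM] hd by simp
qed

text \<open>One inclusion is \<open>stab_Levi\<close> for \<open>D = 0\<close>; the other holds
  because conjugation by \<open>Sg\<close> fixes \<open>F0\<close>.\<close>

lemma stab_F0: "group_stab n Pg (gam F0) = Sg"
proof
  have La0: "0\<^sub>m n n \<in> La" using pa_zero by (auto simp: La_def BD_def) (use r_le in auto)
  have F00: "F0 + 0\<^sub>m n n = F0" by simp
  show "group_stab n Pg (gam F0) \<subseteq> Sg"
    using stab_Levi(1)[OF La0] unfolding F00 by blast
  show "Sg \<subseteq> group_stab n Pg (gam F0)"
  proof
    fix h assume h: "h \<in> Sg"
    have hP: "h \<in> Pg" using h by (rule Sg_Pg)
    have "tr (F0 * conj_by h X) = tr (F0 * X)" if "X \<in> pa" for X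
      using tr_shift[of h F0 X] Sg_F0[OF Sg_adj[OF h]] hP that by (simp add: Pg_Sp pa_M)
    then show "h \<in> group_stab n Pg (gam F0)"
      using hP by (auto simp: group_stab_Pg gam_def conj_by_pa)
  qed
qed

section \<open>The maximal reductive stabiliser\<close>

lemma Ad_eq: "Ad n Pg g = restrict (conj_by g) pa"
  by (simp add: Ad_def lie_Pg)

lemma Ad_GL: assumes g: "g \<in> Pg" shows "Ad n Pg g \<in> carrier (GL_on pa)"
proof -
  have Sp: "g \<in> Sp" using g by (rule Pg_Sp)
  have "bij_betw (conj_by g) pa pa"
    by (rule bij_betw_byWitness[of _ "conj_by (adj g)"])
      (auto simp: conj_by_adj[OF Sp] conj_by_adj'[OF Sp] pa_M conj_by_pa g Pg_adj)
  then have "Ad n Pg g \<in> Bij pa" by (simp add: Ad_eq Bij_def bij_betw_restrict_eq)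
  then show ?thesis
    using Sp by (auto simp: W.GL_carrier Ad_eq pa_add pa_smult conj_by_add conj_by_smult pa_M)
qed

lemma Ad_mult: assumes "g \<in> Pg" "h \<in> Pg"
  shows "Ad n Pg g \<otimes>\<^bsub>GL_on pa\<^esub> Ad n Pg h = Ad n Pg (g * h)"
proof -
  interpret G: group "GL_on pa" by (rule W.group_GL)
  show ?thesis
  proof (rule W.GL_eqI)
    show "Ad n Pg g \<otimes>\<^bsub>GL_on pa\<^esub> Ad n Pg h \<in> carrier (GL_on pa)" using assms by (simp add: Ad_GL)
    show "Ad n Pg (g * h) \<in> carrier (GL_on pa)" using assms by (simp add: Ad_GL Pg_mult)
    fix X assume "X \<in> pa"
    then show "(Ad n Pg g \<otimes>\<^bsub>GL_on pa\<^esub> Ad n Pg h) X = Ad n Pg (g * h) X"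
      using assms by (simp add: W.GL_mult_apply Ad_GL Ad_pa conj_by_pa conj_by_mult Pg_Sp pa_M)
  qed
qed

lemma Ad_one: "Ad n Pg (1\<^sub>m n) = \<one>\<^bsub>GL_on pa\<^esub>"
  by (auto simp: Ad_eq W.GL_one conj_by_one pa_M restrict_def fun_eq_iff)

lemma Ad_inv: assumes "g \<in> Pg" shows "inv\<^bsub>GL_on pa\<^esub> (Ad n Pg g) = Ad n Pg (adj g)"
proof -
  interpret G: group "GL_on pa" by (rule W.group_GL)
  have "Ad n Pg (adj g) \<otimes>\<^bsub>GL_on pa\<^esub> Ad n Pg g = \<one>\<^bsub>GL_on pa\<^esub>"
    using assms Sp_adj_left[OF Pg_Sp[OF assms]] by (simp only: Ad_mult Pg_adj Ad_one)
  then show ?thesis using assms by (intro G.inv_equality) (auto simp: Ad_GL Pg_adj)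
qed

lemma Ad_subgroup:
  assumes "G \<subseteq> Pg" "1\<^sub>m n \<in> G" "\<And>g h. g \<in> G \<Longrightarrow> h \<in> G \<Longrightarrow> g * h \<in> G" "\<And>g. g \<in> G \<Longrightarrow> adj g \<in> G"
  shows "subgroup (Ad n Pg ` G) (GL_on pa)"
proof (rule subgroup.intro)
  show "Ad n Pg ` G \<subseteq> carrier (GL_on pa)" using assms(1) Ad_GL by auto
  show "\<one>\<^bsub>GL_on pa\<^esub> \<in> Ad n Pg ` G" using assms(2) Ad_one by (metis imageI)
next
  fix x y assume "x \<in> Ad n Pg ` G" "y \<in> Ad n Pg ` G"
  then obtain g h where "x = Ad n Pg g" "y = Ad n Pg h" "g \<in> G" "h \<in> G" by auto
  then show "x \<otimes>\<^bsub>GL_on pa\<^esub> y \<in> Ad n Pg ` G" using assms(1,3) Ad_mult[of g h] by auto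
next
  fix x assume "x \<in> Ad n Pg ` G"
  then obtain g where "x = Ad n Pg g" "g \<in> G" by auto
  then show "inv\<^bsub>GL_on pa\<^esub> x \<in> Ad n Pg ` G" using assms(1,4) Ad_inv[of g] by auto
qed

lemma stab_Pg: "g \<in> group_stab n Pg \<gamma> \<Longrightarrow> g \<in> Pg"
  by (simp add: group_stab_Pg)

lemma stab_closed:
  shows "1\<^sub>m n \<in> group_stab n Pg \<gamma>"
    and "g \<in> group_stab n Pg \<gamma> \<Longrightarrow> h \<in> group_stab n Pg \<gamma> \<Longrightarrow> g * h \<in> group_stab n Pg \<gamma>"
    and "g \<in> group_stab n Pg \<gamma> \<Longrightarrow> adj g \<in> group_stab n Pg \<gamma>"
proof -
  show "1\<^sub>m n \<in> group_stab n Pg \<gamma>" by (simp add: group_stab_Pg Pg_one conj_by_one pa_M)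
  show "g * h \<in> group_stab n Pg \<gamma>" if "g \<in> group_stab n Pg \<gamma>" "h \<in> group_stab n Pg \<gamma>"
    using that by (simp add: group_stab_Pg Pg_mult conj_by_mult Pg_Sp pa_M conj_by_pa)
  show "adj g \<in> group_stab n Pg \<gamma>" if "g \<in> group_stab n Pg \<gamma>"
  proof -
    have g: "g \<in> Pg" "\<And>X. X \<in> pa \<Longrightarrow> \<gamma> (conj_by g X) = \<gamma> X" using that by (auto simp: group_stab_Pg)
    have "\<gamma> (conj_by (adj g) X) = \<gamma> X" if "X \<in> pa" for X
      using g(2)[of "conj_by (adj g) X"] g(1) that by (simp add: conj_by_pa Pg_adj conj_by_adj' Pg_Sp pa_M)
    then show ?thesis using g by (simp add: group_stab_Pg Pg_adj)
  qed
qed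

lemma stab_subgroup: "subgroup (Ad n Pg ` group_stab n Pg \<gamma>) (GL_on pa)"
  by (rule Ad_subgroup) (auto simp: stab_closed stab_Pg)

section \<open>The coadjoint action on linear forms\<close>

definition act :: "complex mat \<Rightarrow> (complex mat \<Rightarrow> complex) \<Rightarrow> complex mat \<Rightarrow> complex" where
  "act g \<gamma> = (\<lambda>X\<in>pa. \<gamma> (conj_by (adj g) X))"

lemma act_apply: "X \<in> pa \<Longrightarrow> act g \<gamma> X = \<gamma> (conj_by (adj g) X)" by (simp add: act_def)

lemma act_dual: assumes "g \<in> Pg" "\<gamma> \<in> lie_dual n Pg" shows "act g \<gamma> \<in> lie_dual n Pg"
proof -
  have g: "adj g \<in> Pg" "adj g \<in> Sp" using assms by (auto simp: Pg_adj Pg_Sp)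
  have \<gamma>: "\<And>X Y. X \<in> pa \<Longrightarrow> Y \<in> pa \<Longrightarrow> \<gamma> (X + Y) = \<gamma> X + \<gamma> Y"
    "\<And>c X. X \<in> pa \<Longrightarrow> \<gamma> (c \<cdot>\<^sub>m X) = c * \<gamma> X"
    using assms(2) by (auto simp: lie_dual_def lie_Pg)
  show ?thesis
    using g by (auto simp: lie_dual_def lie_Pg act_def pa_add pa_smult conj_by_add conj_by_smult pa_M conj_by_pa \<gamma>)
qed

lemma act_act: assumes "g \<in> Pg" "h \<in> Pg" shows "act g (act h \<gamma>) = act (g * h) \<gamma>"
proof
  fix X show "act g (act h \<gamma>) X = act (g * h) \<gamma> X"
    using assms by (cases "X \<in> pa")
      (auto simp: act_def conj_by_pa Pg_adj adj_mult Pg_M conj_by_mult Pg_Sp Sp_adj pa_M)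
qed

lemma act_one: "\<gamma> \<in> lie_dual n Pg \<Longrightarrow> act (1\<^sub>m n) \<gamma> = \<gamma>"
  by (auto simp: act_def lie_dual_def lie_Pg conj_by_one pa_M extensional_def fun_eq_iff)

lemma conj_Pg: "g \<in> Pg \<Longrightarrow> h \<in> Pg \<Longrightarrow> conj_by g h \<in> Pg"
  by (simp add: conj_by_Sp Pg_Sp Pg_mult Pg_adj)

lemma conj_by_conj:
  assumes "g \<in> Sp" "h \<in> Sp" "X \<in> M"
  shows "conj_by (conj_by g h) (conj_by g X) = conj_by g (conj_by h X)"
proof -
  have c: "g \<in> M" "h \<in> M" using assms by (auto simp: Sp_M)
  have "conj_by (conj_by g h) (conj_by g X) = conj_by (g * h * adj g * g) X"
    using assms c by (simp add: conj_by_Sp[of g h] conj_by_mult Sp_mult Sp_adj)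
  also have "g * h * adj g * g = g * h" using assms c by (simp add: mult_M Sp_adj_left)
  finally show ?thesis using assms by (simp add: conj_by_mult)
qed

lemma stab_act_sub:
  assumes g: "g \<in> Pg" shows "conj_by g ` group_stab n Pg \<gamma> \<subseteq> group_stab n Pg (act g \<gamma>)"
proof clarify
  fix h assume h: "h \<in> group_stab n Pg \<gamma>"
  have hP: "h \<in> Pg" using h by (rule stab_Pg)
  have "act g \<gamma> (conj_by (conj_by g h) X) = act g \<gamma> X" if X: "X \<in> pa" for X
  proof -
    define Y where "Y = conj_by (adj g) X"
    have Y: "Y \<in> pa" "X = conj_by g Y" using X g by (auto simp: Y_def conj_by_pa Pg_adj conj_by_adj' Pg_Sp pa_M)
    have "conj_by (conj_by g h) X = conj_by g (conj_by h Y)" using Y g hP by (simp add: conj_by_conj Pg_Sp pa_M)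
    then have "act g \<gamma> (conj_by (conj_by g h) X) = \<gamma> (conj_by h Y)"
      using Y g hP by (simp add: act_apply conj_by_pa conj_by_adj Pg_Sp pa_M)
    also have "\<dots> = \<gamma> Y" using h Y by (simp add: group_stab_Pg)
    finally show ?thesis using X by (simp add: act_apply Y_def)
  qed
  then show "conj_by g h \<in> group_stab n Pg (act g \<gamma>)" using g hP by (simp add: group_stab_Pg conj_Pg)
qed

lemma stab_act:
  assumes g: "g \<in> Pg" and \<gamma>: "\<gamma> \<in> lie_dual n Pg"
  shows "group_stab n Pg (act g \<gamma>) = conj_by g ` group_stab n Pg \<gamma>"
proof
  show "conj_by g ` group_stab n Pg \<gamma> \<subseteq> group_stab n Pg (act g \<gamma>)" by (rule stab_act_sub[OF g])
  have cancel: "act (adj g) (act g \<gamma>) = \<gamma>"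
    using g \<gamma> by (simp add: act_act Pg_adj Sp_adj_left Pg_Sp act_one)
  show "group_stab n Pg (act g \<gamma>) \<subseteq> conj_by g ` group_stab n Pg \<gamma>"
  proof
    fix h assume h: "h \<in> group_stab n Pg (act g \<gamma>)"
    then have "conj_by (adj g) h \<in> group_stab n Pg \<gamma>"
      using stab_act_sub[OF Pg_adj[OF g], of "act g \<gamma>"] cancel by auto
    moreover have "h = conj_by g (conj_by (adj g) h)"
      using h g by (simp add: conj_by_adj' Pg_Sp Pg_M stab_Pg)
    ultimately show "h \<in> conj_by g ` group_stab n Pg \<gamma>" by blast
  qed
qed

lemma lie_stab_act:
  assumes g: "g \<in> Pg" and X: "X \<in> lie_stab n Pg \<gamma>"
  shows "conj_by g X \<in> lie_stab n Pg (act g \<gamma>)"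
proof -
  have XP: "X \<in> pa" using X by (simp add: lie_stab_Pg)
  have "act g \<gamma> (conj_by g X * Y - Y * conj_by g X) = 0" if Y: "Y \<in> pa" for Y
  proof -
    define Y' where "Y' = conj_by (adj g) Y"
    have Y': "Y' \<in> pa" "Y = conj_by g Y'" using Y g by (auto simp: Y'_def conj_by_pa Pg_adj conj_by_adj' Pg_Sp pa_M)
    have "conj_by g X * Y - Y * conj_by g X = conj_by g (X * Y' - Y' * X)"
      using Y' XP g by (simp add: conj_by_times conj_by_minus Pg_Sp pa_M)
    then have "act g \<gamma> (conj_by g X * Y - Y * conj_by g X) = \<gamma> (X * Y' - Y' * X)"
      using Y' XP g bracket_pa[OF XP Y'(1)] by (simp add: act_apply conj_by_pa conj_by_adj Pg_Sp pa_M)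
    then show ?thesis using X Y' by (simp add: lie_stab_Pg)
  qed
  then show ?thesis using XP g by (simp add: lie_stab_Pg conj_by_pa)
qed

lemma nilpotent_act:
  assumes g: "g \<in> Pg" and \<gamma>: "\<gamma> \<in> lie_dual n Pg" and nil: "nilpotent_type n Pg \<gamma>"
  shows "nilpotent_type n Pg (act g \<gamma>)"
  unfolding nilpotent_type_def
proof
  fix X assume X: "X \<in> lie_stab n Pg (act g \<gamma>)"
  have cancel: "act (adj g) (act g \<gamma>) = \<gamma>"
    using g \<gamma> by (simp add: act_act Pg_adj Sp_adj_left Pg_Sp act_one)
  have "conj_by (adj g) X \<in> lie_stab n Pg \<gamma>"
    using lie_stab_act[OF Pg_adj[OF g] X] cancel by simp
  then have "\<gamma> (conj_by (adj g) X) = 0" using nil by (simp add: nilpotent_type_def)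
  then show "act g \<gamma> X = 0" using X by (simp add: lie_stab_Pg act_apply)
qed

section \<open>Conjugate transposition and reductivity\<close>

definition ct :: "complex mat \<Rightarrow> complex mat" where
  "ct A = mat n n (\<lambda>(i, j). cnj (A $$ (j, i)))"

lemma ct_M [simp]: "ct A \<in> M" by (simp add: ct_def)
lemma ct_dim [simp]: "dim_row (ct A) = n" "dim_col (ct A) = n" by (simp_all add: ct_def)
lemma ct_entry: "i < n \<Longrightarrow> j < n \<Longrightarrow> ct A $$ (i, j) = cnj (A $$ (j, i))" by (simp add: ct_def)

lemma ct_ct: "A \<in> M \<Longrightarrow> ct (ct A) = A" by (intro eq_matI) (auto simp: ct_entry)
lemma ct_one: "ct (1\<^sub>m n) = 1\<^sub>m n" by (intro eq_matI) (auto simp: ct_entry)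
lemma ct_adj: "ct (adj A) = adj (ct A)" by (intro eq_matI) (auto simp: ct_entry adj_entry sg_def)
lemma ct_mult: "A \<in> M \<Longrightarrow> B \<in> M \<Longrightarrow> ct (A * B) = ct B * ct A"
proof (rule eq_matI)
  fix i j assume AB: "A \<in> M" "B \<in> M" and "i < dim_row (ct B * ct A)" "j < dim_col (ct B * ct A)"
  then have ij: "i < n" "j < n" by auto
  have "A * B \<in> M" using AB by simp
  then show "ct (A * B) $$ (i, j) = (ct B * ct A) $$ (i, j)"
    unfolding mult_entry[OF ct_M ct_M ij] ct_entry[OF ij] mult_entry[OF AB ij(2,1)] cnj_sum complex_cnj_mult
    using ij by (intro sum.cong) (auto simp: ct_entry)
qed auto
lemma tr_ct: "A \<in> M \<Longrightarrow> tr (ct A) = cnj (tr A)"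
  by (simp add: tr_carrier[of _ n] ct_entry)

text \<open>The equations of \<open>Sg\<close> have real coefficients and are symmetric under
  transposition. This closure supplies the adjoints required by
  \<open>normal_unipotent_trivial\<close>.\<close>

lemma Sg_ct: assumes "s \<in> Sg" shows "ct s \<in> Sg"
proof -
  have s: "s \<in> Sp" "BD s" "\<And>i j. i < r \<Longrightarrow> j < r \<Longrightarrow> s $$ (du i, du j) = s $$ (i, j)"
    using assms by (auto simp: Sg_def Pg_Sp)
  have "adj (ct s) * ct s = ct (s * adj s)" using s by (simp add: ct_mult ct_adj Sp_M)
  then have "adj (ct s) * ct s = 1\<^sub>m n" using Sp_adj_right[OF s(1)] ct_one by simp
  moreover have "BD (ct s)" using s(2) by (auto simp: BD_def ct_entry)
  moreover have "ct s $$ (du i, du j) = ct s $$ (i, j)" if "i < r" "j < r" for i j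
    using s(3)[OF that(2,1)] that r_le by (simp add: ct_entry)
  ultimately show ?thesis using BD_UT by (auto simp: Sg_def Pg_def Sp_def)
qed

lemma tr_ct_self: assumes A: "A \<in> M" and 0: "tr (A * ct A) = 0" shows "A = 0\<^sub>m n n"
proof -
  have "tr (A * ct A) = (\<Sum>i<n. \<Sum>k<n. A $$ (i, k) * cnj (A $$ (i, k)))"
    using A by (simp add: tr_mult[of _ n] ct_entry)
  also have "\<dots> = of_real (\<Sum>i<n. \<Sum>k<n. (cmod (A $$ (i, k)))\<^sup>2)"
    by (simp add: complex_norm_square[symmetric] flip: of_real_power)
  finally have z: "(\<Sum>i<n. \<Sum>k<n. (cmod (A $$ (i, k)))\<^sup>2) = 0" using 0 by (metis of_real_eq_0_iff)
  have "A $$ (i, k) = 0" if "i < n" "k < n" for i k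
  proof -
    have "(\<Sum>k<n. (cmod (A $$ (i, k)))\<^sup>2) = 0"
      using z that by (subst (asm) sum_nonneg_eq_0_iff) (auto intro: sum_nonneg)
    then show ?thesis using that by (subst (asm) sum_nonneg_eq_0_iff) auto
  qed
  then show ?thesis using A by (intro eq_matI) auto
qed

text \<open>The stabiliser of a conjugate of \<open>gam F0\<close> is self-adjoint for the correspondingly
  conjugated Frobenius inner product.\<close>

lemma reductive_act_F0:
  assumes g: "g \<in> Pg" shows "reductive_type n Pg (act g (gam F0))"
proof -
  define H where "H = Ad n Pg ` group_stab n Pg (act g (gam F0))"
  define B where "B X Y = tr (conj_by (adj g) X * ct (conj_by (adj g) Y))" for X Y
  have gS: "g \<in> Sp" "adj g \<in> Sp" "adj g \<in> Pg" using g by (auto simp: Pg_Sp Pg_adj)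
  have cM: "conj_by (adj g) X \<in> M" if "X \<in> pa" for X using that gS by (simp add: conj_by_M pa_M)
  interpret I: mat_inner n pa B
  proof
    fix X Y Z assume XYZ: "X \<in> pa" "Y \<in> pa" "Z \<in> pa"
    then show "B (X - Y) Z = B X Z - B Y Z"
      using gS by (simp add: B_def conj_by_minus pa_M mult_M cM conj_by_M tr_minus[of _ n])
  next
    fix X Y assume XY: "X \<in> pa" "Y \<in> pa"
    have "cnj (B Y X) = tr (ct (conj_by (adj g) Y * ct (conj_by (adj g) X)))"
      using XY by (simp add: B_def tr_ct cM)
    then show "B X Y = cnj (B Y X)" using XY by (simp add: B_def ct_mult ct_ct cM)
  next
    fix X assume X: "X \<in> pa" "B X X = 0"
    then have "conj_by (adj g) X = 0\<^sub>m n n" using tr_ct_self cM by (simp add: B_def)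
    then have "X = conj_by g (0\<^sub>m n n)" using conj_by_adj'[OF gS(1) pa_M[OF X(1)]] by simp
    then show "X = 0\<^sub>m n n" using gS(1) Sp_M[OF gS(1)] by (simp add: conj_by_Sp)
  qed
  have stab: "group_stab n Pg (act g (gam F0)) = conj_by g ` Sg"
    by (simp add: stab_act g gam_dual stab_F0)
  have star: "\<exists>\<psi>\<in>H. \<forall>X\<in>pa. \<forall>Y\<in>pa. B (\<phi> X) Y = B X (\<psi> Y)" if phi: "\<phi> \<in> H" for \<phi>
  proof -
    obtain s where s: "s \<in> Sg" "\<phi> = Ad n Pg (conj_by g s)" using phi unfolding H_def stab by blast
    have sS: "s \<in> Sp" "s \<in> M" "ct s \<in> Sp" "ct s \<in> Sg" "s \<in> Pg" "ct s \<in> Pg"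
      using s Sg_ct[OF s(1)] by (auto simp: Sg_Pg Pg_Sp Sp_M)
    have *: "conj_by (adj g) (conj_by (conj_by g s') X) = conj_by s' (conj_by (adj g) X)"
      if "s' \<in> Sp" "X \<in> pa" for s' X
    proof -
      have "conj_by (conj_by g s') X = conj_by g (conj_by s' (conj_by (adj g) X))"
        using conj_by_conj[OF gS(1) that(1), of "conj_by (adj g) X"] that gS
        by (simp add: conj_by_adj' pa_M cM)
      then show ?thesis using conj_by_adj[OF gS(1)] that cM conj_by_M by simp
    qed
    have "B (\<phi> X) Y = B X (Ad n Pg (conj_by g (ct s)) Y)" if XY: "X \<in> pa" "Y \<in> pa" for X Y
    proof -
      define X' Y' where "X' = conj_by (adj g) X" and "Y' = conj_by (adj g) Y"
      have M': "X' \<in> M" "Y' \<in> M" using XY cM by (auto simp: X'_def Y'_def)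
      have "B (\<phi> X) Y = tr (s * (X' * (adj s * ct Y')))"
        using XY M' sS by (simp add: B_def s Ad_pa * X'_def[symmetric] Y'_def[symmetric] conj_by_Sp mult_M)
      also have "\<dots> = tr (X' * (adj s * ct Y') * s)" using M' sS by (intro tr_comm) auto
      also have "X' * (adj s * ct Y') * s = X' * ct (conj_by (ct s) Y')"
        using M' sS by (simp add: conj_by_Sp ct_mult ct_adj[symmetric] ct_ct mult_M)
      also have "tr \<dots> = B X (Ad n Pg (conj_by g (ct s)) Y)"
        using XY M' sS by (simp add: B_def Ad_pa * X'_def[symmetric] Y'_def[symmetric])
      finally show ?thesis .
    qed
    moreover have "Ad n Pg (conj_by g (ct s)) \<in> H" using sS by (auto simp: H_def stab)
    ultimately show ?thesis by blast
  qed
  have sub: "subgroup H (GL_on pa)" unfolding H_def by (rule stab_subgroup)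
  have "U = {\<one>\<^bsub>GL_on pa\<^esub>}" if "U \<lhd> (GL_on pa)\<lparr>carrier := H\<rparr>" "\<forall>\<phi>\<in>U. unipotent_on n pa \<phi>" for U
    using I.normal_unipotent_trivial[OF sub star that(1)] that(2) by blast
  with sub show ?thesis unfolding reductive_type_def reductive_subgroup_def lie_Pg H_def by blast
qed

text \<open>The grading element, acting by 1 on V_t, by 0 on the middle and by -1 on the dual of
  V_t. Under the bracket with it \<open>F0\<close> has weight -2 and the ideal S^2 V_t has weight 2;
  the first gives nilpotent type, the second recovers an element of the ideal from its
  exponential.\<close>

definition grad :: "complex mat" where
  "grad = mat n n (\<lambda>(i, j). if i = j then (if i < r then 1 else if i < n - r then 0 else -1) else 0)"

lemma grad_M [simp]: "grad \<in> M" by (simp add: grad_def)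
lemma grad_dim [simp]: "dim_row grad = n" "dim_col grad = n" by (simp_all add: grad_def)

lemma grad_pa: "grad \<in> pa"
proof -
  have "adj grad $$ (i, j) = (- grad) $$ (i, j)" if "i < n" "j < n" for i j
    using that r_le by (cases "i = j") (auto simp: adj_entry grad_def)
  then have "adj grad = - grad" by (intro eq_matI) (auto simp: grad_def)
  then show ?thesis by (auto simp: pa_def sp_def UT_def grad_def)
qed

text \<open>\<open>F0\<close> is an eigenvector of the bracket with \<open>grad\<close> for a
  nonzero eigenvalue. So the value of the form at \<open>X\<close> is a multiple of its value at the
  bracket of \<open>X\<close> with \<open>grad\<close>, which is zero for \<open>X\<close> in the
  stabiliser.\<close>

lemma nilpotent_F0: "nilpotent_type n Pg (gam F0)"
  unfolding nilpotent_type_def lie_stab_Pg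
proof clarify
  fix X assume X: "X \<in> pa" and st: "\<forall>Y\<in>pa. gam F0 (X * Y - Y * X) = 0"
  have KF: "(grad * F0 - F0 * grad) $$ (i, j) = (- 2 \<cdot>\<^sub>m F0) $$ (i, j)" if ij: "i < n" "j < n" for i j
  proof -
    have "(grad * F0) $$ (i, j) = - F0 $$ (i, j)"
      unfolding F0_right[OF grad_M ij] using ij r_le by (auto simp: F0_def grad_def)
    moreover have "(F0 * grad) $$ (i, j) = F0 $$ (i, j)"
      unfolding F0_left[OF grad_M ij] using ij r_le by (auto simp: F0_def grad_def)
    ultimately show ?thesis using ij grad_M by (simp del: index_mult_mat(1))
  qed
  have KF': "grad * F0 - F0 * grad = - 2 \<cdot>\<^sub>m F0" using grad_M KF by (intro eq_matI) auto
  have XM: "X \<in> M" using X by (rule pa_M)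
  have "gam F0 (X * grad - grad * X) = 0" using st grad_pa by blast
  then have "0 = tr (F0 * (X * grad - grad * X))" using bracket_pa[OF X grad_pa] by (simp add: gam_def)
  also have "\<dots> = tr ((F0 * X) * grad) - tr (F0 * (grad * X))"
    using XM grad_M by (simp add: mult_M tr_minus[of _ n])
  also have "tr ((F0 * X) * grad) = tr (grad * (F0 * X))" using XM grad_M by (intro tr_comm) auto
  also have "tr (grad * (F0 * X)) - tr (F0 * (grad * X)) = tr ((grad * F0 - F0 * grad) * X)"
    using XM grad_M by (simp add: mult_M tr_minus[of _ n])
  also have "\<dots> = - 2 * tr (F0 * X)" unfolding KF' using XM by (simp add: mult_M tr_smult[of _ n])
  finally show "gam F0 X = 0" using X by (simp add: gam_def)
qed

text \<open>The centre commutes with a diagonal element of \<open>Pg\<close> that has pairwise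
  distinct eigenvalues. Hence its elements, and with them its Lie algebra, are diagonal.\<close>

lemma centre_semisimple: assumes X: "X \<in> lie_algebra n (centre Pg)" shows "semisimple_mat X"
proof -
  have XM: "X \<in> M" using X by (simp add: lie_algebra_def)
  \<comment> \<open>Starting at 2 keeps the eigenvalues \<open>f i\<close> of the first half apart
    from their inverses on the dual half, since a product \<open>f i * f j\<close> is never
    1.\<close>
  define f :: "nat \<Rightarrow> complex" where "f i = of_nat (i + 2)" for i
  have f: "f i \<noteq> 0" "f i = f j \<longleftrightarrow> i = j" "f i * f j \<noteq> 1" for i j
  proof -
    show "f i \<noteq> 0" unfolding f_def of_nat_eq_0_iff by simp
    show "f i = f j \<longleftrightarrow> i = j" unfolding f_def of_nat_eq_iff by simp
    have "(i + 2) * (j + 2) \<noteq> (1::nat)" by simp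
    then have "of_nat ((i + 2) * (j + 2)) \<noteq> (of_nat 1 :: complex)" unfolding of_nat_eq_iff .
    then show "f i * f j \<noteq> 1" unfolding f_def of_nat_mult of_nat_1 .
  qed
  define c :: "nat \<Rightarrow> complex" where "c i = (if i < l then f i else 1 / f (du i))" for i
  have cd: "c i * c (du i) = 1" if "i < n" for i
    using that by (auto simp: c_def f)
  have mix: "c i \<noteq> c j" if "i < l" "\<not> j < l" "j < n" for i j
    using that f(1)[of "du j"] f(3)[of i "du j"] by (auto simp: c_def field_simps)
  have inj: "c i \<noteq> c j" if ij: "i < n" "j < n" "i \<noteq> j" for i j
  proof (cases "i < l"; cases "j < l")
    assume "\<not> i < l" "\<not> j < l"
    moreover have "du i \<noteq> du j" using ij by auto
    ultimately show ?thesis by (simp add: c_def f)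
  next
    assume "\<not> i < l" "j < l"
    then show ?thesis using mix[of j i] ij by auto
  qed (use ij mix[of i j] in \<open>auto simp: c_def f\<close>)
  define h where "h = mat n n (\<lambda>(i, j). if i = j then c i else 0)"
  have hM: "h \<in> M" by (simp add: h_def)
  have L: "(h * A) $$ (i, j) = c i * A $$ (i, j)" and R: "(A * h) $$ (i, j) = A $$ (i, j) * c j"
    if "A \<in> M" "i < n" "j < n" for A i j
  proof -
    have "(h * A) $$ (i, j) = (\<Sum>k<n. if k = i then c i * A $$ (i, j) else 0)"
      unfolding mult_entry[OF hM that] by (rule sum.cong) (use that in \<open>auto simp: h_def\<close>)
    then show "(h * A) $$ (i, j) = c i * A $$ (i, j)" using that by simp
    have "(A * h) $$ (i, j) = (\<Sum>k<n. if k = j then A $$ (i, j) * c j else 0)"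
      unfolding mult_entry[OF that(1) hM that(2,3)] by (rule sum.cong) (use that in \<open>auto simp: h_def\<close>)
    then show "(A * h) $$ (i, j) = A $$ (i, j) * c j" using that by simp
  qed
  have "adj h * h = 1\<^sub>m n"
  proof (rule eq_matI)
    fix i j assume "i < dim_row (1\<^sub>m n :: complex mat)" "j < dim_col (1\<^sub>m n :: complex mat)"
    then have ij: "i < n" "j < n" by auto
    have "adj h $$ (i, j) = (if i = j then c (du i) else 0)" using ij by (auto simp: adj_entry h_def)
    then show "(adj h * h) $$ (i, j) = 1\<^sub>m n $$ (i, j)"
      unfolding R[OF adj_carrier ij] using cd[OF ij(1)] ij by (auto simp: mult.commute)
  qed (use hM in auto)
  then have hP: "h \<in> Pg" using hM by (auto simp: Pg_def Sp_def UT_def h_def)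
  have off: "X $$ (i, j) = 0" if ij: "i < n" "j < n" "i \<noteq> j" for i j
  proof -
    have "(c j - c i) * X $$ (i, j) = 0"
    proof (rule lie_algebraD[OF X])
      show "(\<lambda>A. (c j - c i) * A $$ (i, j)) \<in> poly_functions (mat_coords n)"
        using ij by (intro poly_functions_cmult mat_coord)
      show "(c j - c i) * g $$ (i, j) = 0" if "g \<in> centre Pg" for g
      proof -
        have "g \<in> M" "g * h = h * g" using that hP by (auto simp: centre_def Pg_M)
        then show ?thesis using L[of g i j] R[of g i j] ij by (auto simp: algebra_simps)
      qed
      show "((\<lambda>t. (c j - c i) * (1\<^sub>m n + t \<cdot>\<^sub>m X) $$ (i, j)) has_field_derivative (c j - c i) * X $$ (i, j)) (at 0)"
        using XM ij by (auto intro!: derivative_eq_intros)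
    qed
    then show ?thesis using inj[OF ij] by simp
  qed
  have "diagonal_mat X" using XM off by (auto simp: diagonal_mat_def)
  then show ?thesis using similar_mat_refl[OF XM] by (auto simp: semisimple_mat_def)
qed

lemma strongly_qr: "strongly_quasi_reductive n Pg"
  unfolding strongly_quasi_reductive_def quasi_reductive_def
  using reductive_act_F0[OF Pg_one] act_one[OF gam_dual[OF F0_M]] gam_dual[OF F0_M] centre_semisimple by auto

theorem conj_class_sub_M_star: "conj_class Pg La \<subseteq> M_star n Pg"
proof
  fix L assume "L \<in> conj_class Pg La"
  then obtain g where g: "g \<in> Pg" "L = conj_by g ` La" by (auto simp: conj_class_def)
  have "L = lie_algebra n (group_stab n Pg (act g (gam F0)))"
    using g lie_conj[OF Pg_Sp[OF g(1)], of Sg]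
    by (simp add: stab_act gam_dual stab_F0 lie_Sg subset_iff Sg_Pg Pg_M)
  then show "L \<in> M_star n Pg"
    unfolding M_star_def
    using strongly_qr act_dual[OF g(1) gam_dual[OF F0_M]] reductive_act_F0[OF g(1)]
      nilpotent_act[OF g(1) gam_dual[OF F0_M] nilpotent_F0] by blast
qed

end

section \<open>A criterion for not being of reductive type\<close>

definition poly_fun :: "(complex \<Rightarrow> complex) \<Rightarrow> bool" where
  "poly_fun h \<longleftrightarrow> (\<exists>p. \<forall>t. h t = poly p t)"

lemma poly_fun_const: "poly_fun (\<lambda>_. c)"
  unfolding poly_fun_def by (rule exI[of _ "[:c:]"]) simp

lemma poly_fun_id: "poly_fun (\<lambda>t. t)"
  unfolding poly_fun_def by (rule exI[of _ "[:0, 1:]"]) simp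

lemma poly_fun_add: "poly_fun f \<Longrightarrow> poly_fun g \<Longrightarrow> poly_fun (\<lambda>t. f t + g t)"
  unfolding poly_fun_def by (metis poly_add)

lemma poly_fun_mult: "poly_fun f \<Longrightarrow> poly_fun g \<Longrightarrow> poly_fun (\<lambda>t. f t * g t)"
  unfolding poly_fun_def by (metis poly_mult)

lemma poly_fun_sum: "(\<And>k. k \<in> K \<Longrightarrow> poly_fun (f k)) \<Longrightarrow> poly_fun (\<lambda>t. \<Sum>k\<in>K. f k t)"
  by (induction K rule: infinite_finite_induct) (auto intro: poly_fun_const poly_fun_add)

lemma poly_fun_zeros:
  assumes "poly_fun h" "h a \<noteq> 0" shows "finite {t. h t = 0}"
proof -
  obtain p where p: "\<And>t. h t = poly p t" using assms(1) unfolding poly_fun_def by blast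
  then have "p \<noteq> 0" using assms(2) by auto
  then show ?thesis using poly_roots_finite p by simp
qed

lemma End_coord: "X \<in> W \<Longrightarrow> i < n \<Longrightarrow> j < n \<Longrightarrow> (\<lambda>\<phi>. \<phi> X $$ (i, j)) \<in> poly_functions (End_coords n W)"
  by (rule poly_functions.coord) (auto simp: End_coords_def)

text \<open>A closed set that misses one point of a polynomial curve meets it for finitely many
  parameters only, and two such sets cannot cover the infinite parameter line.\<close>

lemma zariski_connected_lines:
  fixes C :: "('a \<Rightarrow> complex) set"
  assumes lines: "\<And>x y. x \<in> U \<Longrightarrow> y \<in> U \<Longrightarrow> \<exists>c. c 0 = x \<and> c 1 = y \<and> range c \<subseteq> U \<and>
     (\<forall>f\<in>poly_functions C. poly_fun (\<lambda>t. f (c t)))"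
  shows "zariski_connected C U"
  unfolding zariski_connected_def
proof
  assume "\<exists>A B. zariski_closed_in C U A \<and> zariski_closed_in C U B \<and>
            A \<noteq> {} \<and> B \<noteq> {} \<and> A \<inter> B = {} \<and> A \<union> B = U"
  then obtain A B where AB: "zariski_closed_in C U A" "zariski_closed_in C U B"
    "A \<noteq> {}" "B \<noteq> {}" "A \<inter> B = {}" "A \<union> B = U" by blast
  then obtain x y where xy: "x \<in> A" "y \<in> B" by blast
  then obtain c where c: "c 0 = x" "c 1 = y" "range c \<subseteq> U" "\<And>f. f \<in> poly_functions C \<Longrightarrow> poly_fun (\<lambda>t. f (c t))"
    using lines[of x y] AB by blast
  have fin: "finite {t. c t \<in> S}" if S: "zariski_closed_in C U S" and a: "c a \<notin> S" for S a
  proof -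
    obtain F where F: "F \<subseteq> poly_functions C" "S = {x \<in> U. \<forall>f\<in>F. f x = 0}"
      using S unfolding zariski_closed_in_def by blast
    have "c a \<in> U" using c(3) by auto
    then obtain f where f: "f \<in> F" "f (c a) \<noteq> 0" using a F(2) by blast
    have "finite {t. f (c t) = 0}" using poly_fun_zeros[OF c(4), of f a] f F(1) by blast
    then show ?thesis by (rule rev_finite_subset) (use F(2) f in auto)
  qed
  have "c 1 \<notin> A" "c 0 \<notin> B" using c xy AB(5) by auto
  then have "finite ({t. c t \<in> A} \<union> {t. c t \<in> B})" using fin AB(1,2) by blast
  moreover have "{t. c t \<in> A} \<union> {t. c t \<in> B} = UNIV" using c(3) AB(6) by blast
  ultimately show False using infinite_UNIV_char_0[where 'a = complex] by simp
qed

section \<open>The truncated exponential\<close>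

context levelled begin

lemma mult_zero_M [simp]: "A \<in> M \<Longrightarrow> 0\<^sub>m n n * A = 0\<^sub>m n n" "A \<in> M \<Longrightarrow> A * 0\<^sub>m n n = 0\<^sub>m n n"
  "(0\<^sub>m n n - 0\<^sub>m n n :: complex mat) = 0\<^sub>m n n"
  by auto

text \<open>The exponential series cut after degree two, which is exact when the cube of
  \<open>Z\<close> vanishes. The cut keeps every entry polynomial in \<open>Z\<close>.\<close>

definition ex :: "complex mat \<Rightarrow> complex mat" where
  "ex Z = 1\<^sub>m n + Z + (1/2) \<cdot>\<^sub>m (Z * Z)"

lemma ex_M [simp]: "Z \<in> M \<Longrightarrow> ex Z \<in> M" by (simp add: ex_def)

lemma ex_zero: "ex (0\<^sub>m n n) = 1\<^sub>m n"
  by (auto simp: ex_def intro!: eq_matI)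

lemma ex_mult:
  assumes Z: "Z \<in> M" "Z' \<in> M" and comm: "Z * Z' = Z' * Z"
    and cube: "Z * (Z * Z') = 0\<^sub>m n n" "Z * (Z' * Z') = 0\<^sub>m n n"
  shows "ex Z * ex Z' = ex (Z + Z')"
  using Z unfolding ex_def
  by (simp add: mult_M cube comm[symmetric])
    (intro eq_matI, auto simp: algebra_simps simp del: index_mult_mat(1))

lemma ex_adj: "Z \<in> sp \<Longrightarrow> adj (ex Z) = ex (- Z)"
  by (simp add: ex_def adj_add adj_smult adj_mult sp_M sp_adj mult_M)

lemma ex_Sp:
  assumes Z: "Z \<in> sp" and cube: "Z * (Z * Z) = 0\<^sub>m n n"
  shows "ex Z \<in> Sp"
proof -
  have ZM: "Z \<in> M" using Z by (rule sp_M)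
  have "ex (- Z) * ex Z = ex (- Z + Z)"
    using ZM cube by (intro ex_mult) (auto simp: mult_M)
  also have "- Z + Z = 0\<^sub>m n n" using ZM by auto
  finally show ?thesis using Z ZM by (simp add: Sp_def ex_adj ex_zero)
qed

lemma ex_UT: "Z \<in> M \<Longrightarrow> UT Z \<Longrightarrow> UT (ex Z)"
  by (simp add: ex_def UT_add UT_one UT_smult UT_mult)

lemma ex_Pg: "Z \<in> pa \<Longrightarrow> Z * (Z * Z) = 0\<^sub>m n n \<Longrightarrow> ex Z \<in> Pg"
  by (simp add: Pg_def ex_Sp ex_UT pa_sp pa_M pa_UT)

lemma conj_by_ex: assumes "g \<in> Sp" "Z \<in> M" shows "conj_by g (ex Z) = ex (conj_by g Z)"
proof -
  have "conj_by g (1\<^sub>m n) = 1\<^sub>m n" using Sp_adj_right[OF assms(1)] Sp_M[OF assms(1)] assms by (simp add: conj_by_Sp)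
  then show ?thesis using assms by (simp add: ex_def conj_by_add conj_by_smult conj_by_times)
qed

lemma conj_ex: "Z \<in> sp \<Longrightarrow> Z * (Z * Z) = 0\<^sub>m n n \<Longrightarrow> conj_by (ex Z) Y = ex Z * Y * ex (- Z)"
  by (simp add: conj_by_Sp ex_Sp ex_adj)

text \<open>With \<open>ex Z = 1 + a\<close>, the map \<open>Ad (ex Z) - 1\<close> sends
  \<open>Y\<close> to \<open>(a Y - Y a) d\<close>, where the inverse \<open>d\<close> of
  \<open>ex Z\<close> commutes with \<open>a\<close> and \<open>a^3 = 0\<close>. Each iteration puts
  one more factor \<open>a\<close> on the left or on the right of \<open>Y\<close>.\<close>

lemma Ad_ex_unipotent:
  assumes Z: "Z \<in> pa" and cube: "Z * (Z * Z) = 0\<^sub>m n n"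
  shows "unipotent_on n pa (Ad n Pg (ex Z))"
proof -
  have ZM: "Z \<in> M" using Z by (rule pa_M)
  define a d where "a = Z + (1/2) \<cdot>\<^sub>m (Z * Z)" and "d = ex (- Z)"
  have aM: "a \<in> M" and dM: "d \<in> M" using ZM by (auto simp: a_def d_def)
  have ea: "ex Z = 1\<^sub>m n + a" using ZM by (auto simp: a_def ex_def intro!: eq_matI)
  have Sp: "ex Z \<in> Sp" using ex_Sp[OF pa_sp[OF Z] cube] .
  have ed: "ex Z * d = 1\<^sub>m n" using Sp_adj_right[OF Sp] Z by (simp add: d_def ex_adj pa_sp)
  have de: "d * ex Z = 1\<^sub>m n" using Sp_adj_left[OF Sp] Z by (simp add: d_def ex_adj pa_sp)
  have "d + a * d = 1\<^sub>m n" using ed aM dM by (simp add: ea mult_M)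
  moreover have "d + d * a = 1\<^sub>m n" using de aM dM by (simp add: ea mult_M)
  ultimately have "d + a * d = d + d * a" by simp
  then have ad: "a * d = d * a"
  proof -
    assume *: "d + a * d = d + d * a"
    show ?thesis
    proof (rule eq_matI)
      fix i j assume "i < dim_row (d * a)" "j < dim_col (d * a)"
      then have "i < n" "j < n" using aM dM by auto
      then show "(a * d) $$ (i, j) = (d * a) $$ (i, j)"
        using arg_cong[OF *, of "\<lambda>A. A $$ (i, j)"] aM dM by (simp del: index_mult_mat(1))
    qed (use aM dM in auto)
  qed
  have pM: "a ^\<^sub>m p \<in> M" for p using aM by simp
  have a3: "a * a * a = 0\<^sub>m n n"
    using ZM by (simp add: a_def mult_M cube)
  have p0: "a ^\<^sub>m p = 0\<^sub>m n n" if "3 \<le> p" for p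
    using that
  proof (induction p rule: dec_induct)
    case base
    have "a ^\<^sub>m 3 = 1\<^sub>m n * a * a * a" using aM by (simp add: numeral_3_eq_3)
    then show ?case using a3 aM by simp
  next
    case (step p)
    then show ?case using aM by simp
  qed
  have pc: "a * a ^\<^sub>m p = a ^\<^sub>m Suc p" for p
    using aM pM by (induction p) (auto simp flip: mult_M(1))
  have pd: "d * a ^\<^sub>m p = a ^\<^sub>m p * d" for p
  proof (induction p)
    case (Suc p)
    have "d * a ^\<^sub>m Suc p = (d * a ^\<^sub>m p) * a" using aM dM pM by (simp add: mult_M)
    also have "\<dots> = a ^\<^sub>m p * (a * d)" using aM dM pM Suc by (simp add: mult_M ad)
    finally show ?case using aM dM pM by (simp add: mult_M)
  qed (use aM dM in auto)
  define T where "T = (\<lambda>Y. Ad n Pg (ex Z) Y - Y)"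
  have TP: "T Y \<in> pa" if "Y \<in> pa" for Y
    using that ex_Pg[OF Z cube] by (simp add: T_def Ad_pa W.W_minus conj_by_pa)
  have Teq: "T Y = (a * Y - Y * a) * d" if Y: "Y \<in> pa" for Y
  proof -
    have YM: "Y \<in> M" using Y by (rule pa_M)
    have "T Y = ex Z * Y * d - Y * (ex Z * d)"
      using Y YM cube Z by (simp add: T_def Ad_pa conj_ex pa_sp d_def[symmetric] ed)
    also have "\<dots> = (a * Y - Y * a) * d"
      using YM aM dM unfolding ea by (simp add: mult_M) (intro eq_matI, auto simp del: index_mult_mat(1))
    finally show ?thesis .
  qed
  \<comment> \<open>Of five factors \<open>a\<close> shared between two sides at least three are on
    one side, where they give zero. The exponents \<open>p\<close> and \<open>q\<close> carry this
    count through the induction.\<close>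
  have step: "(T ^^ k) Y \<in> pa \<and> (\<forall>p q. 5 \<le> p + q + k \<longrightarrow> a ^\<^sub>m p * (T ^^ k) Y * a ^\<^sub>m q = 0\<^sub>m n n)"
    if Y: "Y \<in> pa" for k Y
  proof (induction k)
    case 0
    have "a ^\<^sub>m p * Y * a ^\<^sub>m q = 0\<^sub>m n n" if "5 \<le> p + q" for p q
    proof -
      have "3 \<le> p \<or> 3 \<le> q" using that by linarith
      then show ?thesis using p0[of p] p0[of q] pa_M[OF Y] pM[of p] pM[of q] carrier_matD[OF aM] by auto
    qed
    then show ?case using Y by simp
  next
    case (Suc k)
    define X where "X = (T ^^ k) Y"
    have XP: "X \<in> pa" and XM: "X \<in> M" using Suc by (auto simp: X_def pa_M)
    have X0: "a ^\<^sub>m p * X * a ^\<^sub>m q = 0\<^sub>m n n" if "5 \<le> p + q + k" for p q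
      using Suc that by (auto simp: X_def)
    have "a ^\<^sub>m p * T X * a ^\<^sub>m q = 0\<^sub>m n n" if pq: "5 \<le> p + q + Suc k" for p q
    proof -
      have "a ^\<^sub>m p * T X * a ^\<^sub>m q = (a ^\<^sub>m p * (a * X - X * a)) * (d * a ^\<^sub>m q)"
        using XM aM dM pM by (simp add: Teq[OF XP] mult_M)
      also have "\<dots> = (a ^\<^sub>m Suc p * X * a ^\<^sub>m q - a ^\<^sub>m p * X * (a * a ^\<^sub>m q)) * d"
        using XM aM dM pM by (simp add: pd mult_M)
      also have "\<dots> = 0\<^sub>m n n"
        using X0[of "Suc p" q] X0[of p "Suc q"] pq dM by (simp add: pc del: pow_mat.simps)
      finally show ?thesis .
    qed
    moreover have "T X \<in> pa" using TP XP by simp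
    ultimately show ?case by (simp add: X_def)
  qed
  have "(T ^^ 5) Y = 0\<^sub>m n n" if Y: "Y \<in> pa" for Y
  proof -
    have "a ^\<^sub>m 0 * (T ^^ 5) Y * a ^\<^sub>m 0 = 0\<^sub>m n n" and "(T ^^ 5) Y \<in> pa"
      using step[OF Y, of 5] by (auto simp del: pow_mat.simps)
    then show ?thesis using pa_M[of "(T ^^ 5) Y"] carrier_matD[OF aM] by simp
  qed
  then show ?thesis unfolding unipotent_on_def T_def by blast
qed

text \<open>If \<open>N\<close> is a commutative subspace stable under the stabiliser, then \<open>Ad (ex N)\<close> is a normal
  connected unipotent subgroup of it; it is closed as soon as \<open>Z\<close> can be recovered from
  \<open>Ad (ex Z)\<close> by a polynomial map \<open>\<rho>\<close>.\<close>

theorem reductive_type_no_ideal: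
  assumes red: "reductive_type n Pg \<gamma>"
    and N: "N \<subseteq> pa" "0\<^sub>m n n \<in> N" "\<And>Z Z'. Z \<in> N \<Longrightarrow> Z' \<in> N \<Longrightarrow> Z + Z' \<in> N"
      "\<And>c Z. Z \<in> N \<Longrightarrow> c \<cdot>\<^sub>m Z \<in> N"
    and comm: "\<And>Z Z'. Z \<in> N \<Longrightarrow> Z' \<in> N \<Longrightarrow> Z * Z' = Z' * Z"
    and cube: "\<And>Z Z' Z''. Z \<in> N \<Longrightarrow> Z' \<in> N \<Longrightarrow> Z'' \<in> N \<Longrightarrow> Z * (Z' * Z'') = 0\<^sub>m n n"
    and stab: "\<And>Z. Z \<in> N \<Longrightarrow> ex Z \<in> group_stab n Pg \<gamma>"
    and inv: "\<And>g Z. g \<in> group_stab n Pg \<gamma> \<Longrightarrow> Z \<in> N \<Longrightarrow> conj_by g Z \<in> N"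
    and \<rho>_poly: "\<And>i j. i < n \<Longrightarrow> j < n \<Longrightarrow> (\<lambda>\<phi>. \<rho> \<phi> $$ (i, j)) \<in> poly_functions (End_coords n pa)"
    and \<rho>_M: "\<And>\<phi>. \<rho> \<phi> \<in> M"
    and \<rho>_ex: "\<And>Z. Z \<in> N \<Longrightarrow> \<rho> (Ad n Pg (ex Z)) = Z"
    and \<rho>_N: "\<And>g. g \<in> group_stab n Pg \<gamma> \<Longrightarrow>
      (\<And>Y. Y \<in> pa \<Longrightarrow> conj_by g Y = ex (\<rho> (Ad n Pg g)) * Y * ex (- \<rho> (Ad n Pg g))) \<Longrightarrow> \<rho> (Ad n Pg g) \<in> N"
  shows "N = {0\<^sub>m n n}"
proof -
  let ?A = "Ad n Pg"
  define G where "G = group_stab n Pg \<gamma>"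
  define H where "H = ?A ` G"
  define U where "U = (\<lambda>Z. ?A (ex Z)) ` N"
  have GP: "g \<in> Pg" if "g \<in> G" for g using that by (simp add: G_def stab_Pg)
  have Npa: "Z \<in> pa" and NM: "Z \<in> M" and exG: "ex Z \<in> G" and exP: "ex Z \<in> Pg" if "Z \<in> N" for Z
    using that N(1) stab GP by (auto simp: pa_M G_def)
  have uminus: "- Z \<in> N" if "Z \<in> N" for Z
  proof -
    have "(-1) \<cdot>\<^sub>m Z = - Z" by (intro eq_matI) auto
    then show ?thesis using N(4)[OF that, of "-1"] by simp
  qed
  interpret GL: group "GL_on pa" by (rule W.group_GL)
  have subH: "subgroup H (GL_on pa)" unfolding H_def G_def by (rule stab_subgroup)
  interpret GH: group "(GL_on pa)\<lparr>carrier := H\<rparr>" by (rule GL.subgroup_imp_group[OF subH])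
  have UH: "U \<subseteq> H" using exG by (auto simp: U_def H_def)
  have invH: "inv\<^bsub>(GL_on pa)\<lparr>carrier := H\<rparr>\<^esub> ?A g = ?A (adj g)" if "g \<in> G" for g
    using GL.m_inv_consistent[OF subH, of "?A g"] that GP by (auto simp: H_def Ad_inv)
  have adj_ex: "adj (ex Z) = ex (- Z)" if "Z \<in> N" for Z using that by (simp add: ex_adj pa_sp Npa)
  have "U \<lhd> (GL_on pa)\<lparr>carrier := H\<rparr>"
    unfolding GH.normal_inv_iff
  proof (intro conjI ballI)
    show "subgroup U ((GL_on pa)\<lparr>carrier := H\<rparr>)"
    proof (rule subgroup.intro)
      show "U \<subseteq> carrier ((GL_on pa)\<lparr>carrier := H\<rparr>)" using UH by simp
      show "\<one>\<^bsub>(GL_on pa)\<lparr>carrier := H\<rparr>\<^esub> \<in> U" using N(2) Ad_one ex_zero unfolding U_def by force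
    next
      fix x y assume "x \<in> U" "y \<in> U"
      then obtain Z Z' where Z: "x = ?A (ex Z)" "y = ?A (ex Z')" "Z \<in> N" "Z' \<in> N" by (auto simp: U_def)
      have "x \<otimes>\<^bsub>GL_on pa\<^esub> y = ?A (ex (Z + Z'))"
        using Z by (simp add: Ad_mult exP ex_mult NM comm cube)
      then show "x \<otimes>\<^bsub>(GL_on pa)\<lparr>carrier := H\<rparr>\<^esub> y \<in> U" using N(3) Z by (auto simp: U_def)
    next
      fix x assume "x \<in> U"
      then obtain Z where Z: "x = ?A (ex Z)" "Z \<in> N" by (auto simp: U_def)
      then show "inv\<^bsub>(GL_on pa)\<lparr>carrier := H\<rparr>\<^esub> x \<in> U"
        using invH[OF exG[OF Z(2)]] uminus[OF Z(2)] by (auto simp: U_def adj_ex)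
    qed
  next
    fix x h assume x: "x \<in> carrier ((GL_on pa)\<lparr>carrier := H\<rparr>)" and h: "h \<in> U"
    obtain g where g: "x = ?A g" "g \<in> G" using x by (auto simp: H_def)
    obtain Z where Z: "h = ?A (ex Z)" "Z \<in> N" using h by (auto simp: U_def)
    have "x \<otimes>\<^bsub>GL_on pa\<^esub> h \<otimes>\<^bsub>GL_on pa\<^esub> ?A (adj g) = ?A (conj_by g (ex Z))"
      using g Z GP by (simp add: Ad_mult exP Pg_mult Pg_adj conj_by_Sp Pg_Sp)
    also have "\<dots> = ?A (ex (conj_by g Z))" using g Z GP by (simp add: conj_by_ex Pg_Sp NM)
    finally show "x \<otimes>\<^bsub>(GL_on pa)\<lparr>carrier := H\<rparr>\<^esub> h \<otimes>\<^bsub>(GL_on pa)\<lparr>carrier := H\<rparr>\<^esub>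
        inv\<^bsub>(GL_on pa)\<lparr>carrier := H\<rparr>\<^esub> x \<in> U"
      using g Z inv[of g Z] invH by (auto simp: U_def G_def)
  qed
  moreover have "zariski_closed_in (End_coords n pa) H U"
  proof -
    \<comment> \<open>The equations say that the operator acts as conjugation by
      \<open>ex (\<rho> \<phi>)\<close>. They are polynomial in the operator and hold on
      \<open>U\<close> because \<open>\<rho>\<close> recovers \<open>Z\<close>; by
      \<open>\<rho>_N\<close> they have no further solutions in \<open>H\<close>.\<close>
    define f where "f Y i j \<phi> = \<phi> Y $$ (i, j) - (ex (\<rho> \<phi>) * Y * ex (- \<rho> \<phi>)) $$ (i, j)"
      for Y i j and \<phi> :: "complex mat \<Rightarrow> complex mat"
    define F where "F = {f Y i j | Y i j. Y \<in> pa \<and> i < n \<and> j < n}"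
    have sq: "(\<lambda>\<phi>. (\<rho> \<phi> * \<rho> \<phi>) $$ (i, j)) \<in> poly_functions (End_coords n pa)" if "i < n" "j < n" for i j
      using that \<rho>_M by (intro mult_coord_poly \<rho>_poly) auto
    have exp: "(\<lambda>\<phi>. ex (\<rho> \<phi>) $$ (i, j)) \<in> poly_functions (End_coords n pa)" if "i < n" "j < n" for i j
    proof -
      have "(\<lambda>\<phi>. 1\<^sub>m n $$ (i, j) + \<rho> \<phi> $$ (i, j) + (1/2) * (\<rho> \<phi> * \<rho> \<phi>) $$ (i, j)) \<in> poly_functions (End_coords n pa)"
        using that by (intro poly_functions.add poly_functions_cmult poly_functions.const \<rho>_poly sq)
      moreover have "1\<^sub>m n $$ (i, j) + \<rho> \<phi> $$ (i, j) + (1/2) * (\<rho> \<phi> * \<rho> \<phi>) $$ (i, j) = ex (\<rho> \<phi>) $$ (i, j)" for \<phi>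
        using that \<rho>_M[of \<phi>] by (simp add: ex_def del: index_mult_mat(1) index_one_mat)
      ultimately show ?thesis by simp
    qed
    have exm: "(\<lambda>\<phi>. ex (- \<rho> \<phi>) $$ (i, j)) \<in> poly_functions (End_coords n pa)" if "i < n" "j < n" for i j
    proof -
      have "(\<lambda>\<phi>. 1\<^sub>m n $$ (i, j) + (-1) * \<rho> \<phi> $$ (i, j) + (1/2) * (\<rho> \<phi> * \<rho> \<phi>) $$ (i, j)) \<in> poly_functions (End_coords n pa)"
        using that by (intro poly_functions.add poly_functions_cmult poly_functions.const \<rho>_poly sq)
      moreover have "1\<^sub>m n $$ (i, j) + (-1) * \<rho> \<phi> $$ (i, j) + (1/2) * (\<rho> \<phi> * \<rho> \<phi>) $$ (i, j) = ex (- \<rho> \<phi>) $$ (i, j)" for \<phi>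
        using that \<rho>_M[of \<phi>] by (simp add: ex_def mult_M del: index_mult_mat(1) index_one_mat)
      ultimately show ?thesis by simp
    qed
    have "F \<subseteq> poly_functions (End_coords n pa)"
    proof
      fix h assume "h \<in> F"
      then obtain Y i j where h: "h = f Y i j" "Y \<in> pa" "i < n" "j < n" by (auto simp: F_def)
      have YM: "Y \<in> M" using h pa_M by auto
      have "(\<lambda>\<phi>. (ex (\<rho> \<phi>) * Y * ex (- \<rho> \<phi>)) $$ (i, j)) \<in> poly_functions (End_coords n pa)"
        using h YM \<rho>_M by (intro mult_coord_poly exp exm poly_functions.const) auto
      then show "h \<in> poly_functions (End_coords n pa)"
        unfolding h(1) f_def[abs_def] using h by (intro poly_functions_minus End_coord) auto
    qed
    moreover have "U = {\<phi> \<in> H. \<forall>h\<in>F. h \<phi> = 0}"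
    proof (intro equalityI subsetI)
      fix \<phi> assume "\<phi> \<in> U"
      then obtain Z where Z: "\<phi> = ?A (ex Z)" "Z \<in> N" by (auto simp: U_def)
      have "f Y i j \<phi> = 0" if "Y \<in> pa" for Y i j
        using that Z cube[OF Z(2) Z(2) Z(2)] by (simp add: f_def \<rho>_ex Ad_pa conj_ex pa_sp Npa)
      then show "\<phi> \<in> {\<phi> \<in> H. \<forall>h\<in>F. h \<phi> = 0}" using UH \<open>\<phi> \<in> U\<close> by (auto simp: F_def)
    next
      fix \<phi> assume \<phi>: "\<phi> \<in> {\<phi> \<in> H. \<forall>h\<in>F. h \<phi> = 0}"
      then obtain g where g: "\<phi> = ?A g" "g \<in> G" by (auto simp: H_def)
      have e: "conj_by g Y = ex (\<rho> \<phi>) * Y * ex (- \<rho> \<phi>)" if Y: "Y \<in> pa" for Y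
      proof (rule eq_matI)
        have M': "ex (\<rho> \<phi>) * Y * ex (- \<rho> \<phi>) \<in> M" using \<rho>_M[of \<phi>] pa_M[OF Y] by simp
        have M'': "conj_by g Y \<in> M" using g GP Y by (simp add: conj_by_M Pg_Sp pa_M)
        show "dim_row (conj_by g Y) = dim_row (ex (\<rho> \<phi>) * Y * ex (- \<rho> \<phi>))"
          "dim_col (conj_by g Y) = dim_col (ex (\<rho> \<phi>) * Y * ex (- \<rho> \<phi>))"
          using M' M'' by (auto simp del: index_mult_mat)
        fix i j assume "i < dim_row (ex (\<rho> \<phi>) * Y * ex (- \<rho> \<phi>))" "j < dim_col (ex (\<rho> \<phi>) * Y * ex (- \<rho> \<phi>))"
        then have "i < n" "j < n" using M' by (auto simp del: index_mult_mat)
        then have "f Y i j \<phi> = 0" using \<phi> Y unfolding F_def by blast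
        then show "conj_by g Y $$ (i, j) = (ex (\<rho> \<phi>) * Y * ex (- \<rho> \<phi>)) $$ (i, j)"
          using Y by (simp add: f_def g(1) Ad_pa)
      qed
      have \<rho>N: "\<rho> \<phi> \<in> N" using \<rho>_N[of g] g e by (simp add: G_def)
      have "\<phi> = ?A (ex (\<rho> \<phi>))"
      proof (rule W.GL_eqI)
        show "\<phi> \<in> carrier (GL_on pa)" using g GP Ad_GL by simp
        show "?A (ex (\<rho> \<phi>)) \<in> carrier (GL_on pa)" using \<rho>N exP Ad_GL by simp
        fix Y assume Y: "Y \<in> pa"
        have "\<phi> Y = conj_by g Y" using g Y by (simp add: Ad_pa)
        also have "\<dots> = ?A (ex (\<rho> \<phi>)) Y"
          using e[OF Y] Y \<rho>N cube[OF \<rho>N \<rho>N \<rho>N] by (simp add: Ad_pa conj_ex pa_sp Npa)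
        finally show "\<phi> Y = ?A (ex (\<rho> \<phi>)) Y" .
      qed
      then show "\<phi> \<in> U" using \<rho>N by (auto simp: U_def)
    qed
    ultimately show ?thesis unfolding zariski_closed_in_def by blast
  qed
  moreover have "zariski_connected (End_coords n pa) U"
  proof (rule zariski_connected_lines)
    fix x y assume "x \<in> U" "y \<in> U"
    then obtain Z Z' where Z: "x = ?A (ex Z)" "y = ?A (ex Z')" "Z \<in> N" "Z' \<in> N" by (auto simp: U_def)
    \<comment> \<open>The curve joining two elements of \<open>U\<close> is the image of the
      straight line from \<open>Z\<close> to \<open>Z'\<close>, which stays in the subspace
      \<open>N\<close>.\<close>
    define D where "D = Z' + (-1) \<cdot>\<^sub>m Z"
    have DN: "D \<in> N" using N(3,4) Z by (simp add: D_def)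
    define L where "L t = Z + t \<cdot>\<^sub>m D" for t
    have LN: "L t \<in> N" for t using N(3,4) Z DN by (simp add: L_def)
    have L0: "L 0 = Z" and L1: "L 1 = Z'"
      using NM[OF Z(3)] NM[OF Z(4)] by (auto simp: L_def D_def intro!: eq_matI)
    have Lp: "poly_fun (\<lambda>t. L t $$ (i, j))" if "i < n" "j < n" for i j
      using that NM[OF Z(3)] NM[OF DN]
      by (auto simp: L_def intro!: poly_fun_add poly_fun_mult poly_fun_const poly_fun_id)
    have mp: "poly_fun (\<lambda>t. (A t * B t) $$ (i, j))"
      if "i < n" "j < n" "\<And>t. A t \<in> M" "\<And>t. B t \<in> M"
        "\<And>k. k < n \<Longrightarrow> poly_fun (\<lambda>t. A t $$ (i, k))" "\<And>k. k < n \<Longrightarrow> poly_fun (\<lambda>t. B t $$ (k, j))" for A B i j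
      unfolding mult_entry[OF that(3,4,1,2)] using that by (intro poly_fun_sum poly_fun_mult) auto
    have sq: "poly_fun (\<lambda>t. (L t * L t) $$ (i, j))" if "i < n" "j < n" for i j
      using that LN NM by (intro mp Lp) auto
    have e1: "poly_fun (\<lambda>t. ex (L t) $$ (i, j))" if "i < n" "j < n" for i j
    proof -
      have "ex (L t) $$ (i, j) = 1\<^sub>m n $$ (i, j) + L t $$ (i, j) + (1/2) * (L t * L t) $$ (i, j)" for t
        using that NM[OF LN[of t]] by (simp add: ex_def del: index_mult_mat(1) index_one_mat)
      then show ?thesis using that
        by (simp only:) (intro poly_fun_add poly_fun_mult poly_fun_const Lp sq)
    qed
    have e2: "poly_fun (\<lambda>t. ex (- L t) $$ (i, j))" if "i < n" "j < n" for i j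
    proof -
      have "ex (- L t) $$ (i, j) = 1\<^sub>m n $$ (i, j) + (-1) * L t $$ (i, j) + (1/2) * (L t * L t) $$ (i, j)" for t
        using that NM[OF LN[of t]] by (simp add: ex_def mult_M del: index_mult_mat(1) index_one_mat)
      then show ?thesis using that
        by (simp only:) (intro poly_fun_add poly_fun_mult poly_fun_const Lp sq)
    qed
    have "poly_fun (\<lambda>t. f (?A (ex (L t))))" if "f \<in> poly_functions (End_coords n pa)" for f
      using that
    proof induction
      case (coord f)
      then obtain Y i j where f: "f = (\<lambda>\<phi>. \<phi> Y $$ (i, j))" "Y \<in> pa" "i < n" "j < n" by (auto simp: End_coords_def)
      have "f (?A (ex (L t))) = (ex (L t) * Y * ex (- L t)) $$ (i, j)" for t
        using f LN[of t] cube[OF LN LN LN, of t t t] by (simp add: Ad_pa conj_ex pa_sp Npa)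
      moreover have "poly_fun (\<lambda>t. (ex (L t) * Y * ex (- L t)) $$ (i, j))"
        using f pa_M[OF f(2)] NM LN by (intro mp e1 e2 poly_fun_const) auto
      ultimately show ?case by simp
    qed (auto intro: poly_fun_const poly_fun_add poly_fun_mult)
    then show "\<exists>c. c 0 = x \<and> c 1 = y \<and> range c \<subseteq> U \<and> (\<forall>f\<in>poly_functions (End_coords n pa). poly_fun (\<lambda>t. f (c t)))"
      using L0 L1 LN Z by (intro exI[of _ "\<lambda>t. ?A (ex (L t))"]) (auto simp: U_def)
  qed
  moreover have "\<forall>\<phi>\<in>U. unipotent_on n pa \<phi>"
    using Ad_ex_unipotent cube Npa by (auto simp: U_def)
  ultimately have U1: "U = {\<one>\<^bsub>GL_on pa\<^esub>}"
    using red unfolding reductive_type_def reductive_subgroup_def lie_Pg H_def G_def by blast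
  have "Z = 0\<^sub>m n n" if "Z \<in> N" for Z
  proof -
    have "?A (ex Z) \<in> U" "?A (ex (0\<^sub>m n n)) \<in> U" using that N(2) by (auto simp: U_def)
    then have "?A (ex Z) = ?A (ex (0\<^sub>m n n))" using U1 by auto
    then show ?thesis using \<rho>_ex that N(2) by metis
  qed
  then show ?thesis using N(2) by blast
qed

section \<open>Nondegeneracy on the flag\<close>

text \<open>The symplectic matrices with this support form the ideal \<open>S\<^sup>2 V\<^sub>t\<close> of the parabolic
  subalgebra; \<open>Zv v w\<close> below is the product of \<open>v\<close> and \<open>w\<close> in it.\<close>

definition corner where
  "corner Z \<longleftrightarrow> (\<forall>i<n. \<forall>j<n. \<not> (i < r \<and> n - r \<le> j) \<longrightarrow> Z $$ (i, j) = 0)"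

lemma lv_last_iff: "j < n \<Longrightarrow> t < lv j \<longleftrightarrow> n - r \<le> j"
  using lv_last[of j] lv_mid[of j] lv_first[of j] by (cases "j < r"; cases "j < n - r") auto

lemma corner_UT: "corner Z \<Longrightarrow> UT Z"
  unfolding UT_def
proof (intro allI impI)
  fix i j assume "corner Z" "i < n" "j < n" "lv j < lv i"
  moreover from this have "\<not> (i < r \<and> n - r \<le> j)" using lv_first[of i] lv_last[of j] by auto
  ultimately show "Z $$ (i, j) = 0" unfolding corner_def by blast
qed

lemma corner_mult_zero:
  assumes "Z \<in> M" "Z' \<in> M" "corner Z" "corner Z'" shows "Z * Z' = 0\<^sub>m n n"
proof (rule eq_matI)
  fix i j assume "i < dim_row (0\<^sub>m n n :: complex mat)" "j < dim_col (0\<^sub>m n n :: complex mat)"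
  then have ij: "i < n" "j < n" by auto
  have "Z $$ (i, k) * Z' $$ (k, j) = 0" if "k < n" for k
  proof (cases "k < r")
    case True
    then have "\<not> n - r \<le> k" using r_le by linarith
    then show ?thesis using assms(3) ij that unfolding corner_def by auto
  qed (use assms(4) ij that in \<open>auto simp: corner_def\<close>)
  then show "(Z * Z') $$ (i, j) = 0\<^sub>m n n $$ (i, j)"
    using ij mult_entry[OF assms(1,2) ij] by (auto intro: sum.neutral)
qed (use assms in auto)

text \<open>Together with \<open>corner_right\<close>: the corner matrices form a two-sided ideal
  among the block triangular ones, hence are stable under conjugation by \<open>Pg\<close>.\<close>

lemma corner_left: assumes "Z \<in> M" "Y \<in> M" "corner Z" "UT Y" shows "corner (Y * Z)"
  unfolding corner_def
proof (intro allI impI)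
  fix i j assume ij: "i < n" "j < n" "\<not> (i < r \<and> n - r \<le> j)"
  have "Y $$ (i, k) * Z $$ (k, j) = 0" if "k < n" for k
  proof (cases "k < r \<and> n - r \<le> j")
    case True
    then have "lv k < lv i" using ij that by (intro lv_ne) auto
    then show ?thesis using assms(4) ij that unfolding UT_def by auto
  qed (use assms(3) ij that in \<open>auto simp: corner_def\<close>)
  then show "(Y * Z) $$ (i, j) = 0"
    using mult_entry[OF assms(2,1) ij(1,2)] by (auto intro: sum.neutral)
qed

lemma corner_right: assumes "Z \<in> M" "Y \<in> M" "corner Z" "UT Y" shows "corner (Z * Y)"
  unfolding corner_def
proof (intro allI impI)
  fix i j assume ij: "i < n" "j < n" "\<not> (i < r \<and> n - r \<le> j)"
  have "Z $$ (i, k) * Y $$ (k, j) = 0" if "k < n" for k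
  proof (cases "i < r \<and> n - r \<le> k")
    case True
    then have "t < lv k" "\<not> t < lv j" using ij that lv_last_iff by auto
    then show ?thesis using assms(4) ij that unfolding UT_def by auto
  qed (use assms(3) ij that in \<open>auto simp: corner_def\<close>)
  then show "(Z * Y) $$ (i, j) = 0"
    using mult_entry[OF assms(1,2) ij(1,2)] by (auto intro: sum.neutral)
qed

lemma corner_conj: "g \<in> Pg \<Longrightarrow> Z \<in> M \<Longrightarrow> corner Z \<Longrightarrow> corner (conj_by g Z)"
  by (simp add: conj_by_Sp Pg_Sp corner_left corner_right Pg_M Pg_UT UT_adj)

lemma corner_ex: "Z \<in> M \<Longrightarrow> corner Z \<Longrightarrow> ex Z = 1\<^sub>m n + Z"
  by (auto simp: ex_def corner_mult_zero intro!: eq_matI)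

lemma corner_uminus: "Z \<in> M \<Longrightarrow> corner Z \<Longrightarrow> corner (- Z)" by (auto simp: corner_def)

text \<open>\<open>Z * Y\<close> is again a corner matrix, so its product with \<open>Z\<close>
  vanishes and the conjugation series stops after the bracket.\<close>

lemma corner_conj_ex:
  assumes Z: "Z \<in> M" "corner Z" and Y: "Y \<in> M" "UT Y"
  shows "ex Z * Y * ex (- Z) = Y + (Z * Y - Y * Z)"
proof -
  have "Z * Y * Z = 0\<^sub>m n n" using Z Y by (intro corner_mult_zero corner_right) auto
  then have 0: "Z * (Y * Z) = 0\<^sub>m n n" using Z Y by (simp add: mult_M)
  show ?thesis using Z Y
    by (simp add: corner_ex corner_uminus mult_M 0) (intro eq_matI, auto simp del: index_mult_mat(1))
qed

lemma grad_corner: assumes Z: "Z \<in> M" "corner Z"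
  shows "Z * grad - grad * Z = (-2) \<cdot>\<^sub>m Z"
proof (rule eq_matI)
  fix i j assume "i < dim_row ((-2) \<cdot>\<^sub>m Z)" "j < dim_col ((-2) \<cdot>\<^sub>m Z)"
  then have ij: "i < n" "j < n" using Z by auto
  have "(Z * grad) $$ (i, j) = (\<Sum>k<n. if k = j then Z $$ (i, j) * grad $$ (j, j) else 0)"
    unfolding mult_entry[OF Z(1) grad_M ij] by (rule sum.cong) (use ij in \<open>auto simp: grad_def\<close>)
  moreover have "(grad * Z) $$ (i, j) = (\<Sum>k<n. if k = i then grad $$ (i, i) * Z $$ (i, j) else 0)"
    unfolding mult_entry[OF grad_M Z(1) ij] by (rule sum.cong) (use ij in \<open>auto simp: grad_def\<close>)
  ultimately have "(Z * grad - grad * Z) $$ (i, j) = Z $$ (i, j) * grad $$ (j, j) - grad $$ (i, i) * Z $$ (i, j)"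
    using ij Z by (simp del: index_mult_mat(1))
  also have "\<dots> = -2 * Z $$ (i, j)"
    using Z(2) ij r_le unfolding corner_def by (cases "i < r \<and> n - r \<le> j") (auto simp: grad_def)
  finally show "(Z * grad - grad * Z) $$ (i, j) = ((-2) \<cdot>\<^sub>m Z) $$ (i, j)" using ij Z by simp
qed (use Z in auto)

lemma dual_add: "\<gamma> \<in> lie_dual n Pg \<Longrightarrow> X \<in> pa \<Longrightarrow> Y \<in> pa \<Longrightarrow> \<gamma> (X + Y) = \<gamma> X + \<gamma> Y"
  and dual_smult: "\<gamma> \<in> lie_dual n Pg \<Longrightarrow> X \<in> pa \<Longrightarrow> \<gamma> (c \<cdot>\<^sub>m X) = c * \<gamma> X"
  by (auto simp: lie_dual_def lie_Pg)

text \<open>The corner elements stabilising the form make up a subspace \<open>N\<close> in which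
  all products vanish and which the group stabiliser preserves. So
  \<open>reductive_type_no_ideal\<close> applies to it.\<close>

theorem corner_stab_trivial:
  assumes \<gamma>: "\<gamma> \<in> lie_dual n Pg" and red: "reductive_type n Pg \<gamma>"
    and Z: "Z \<in> pa" "corner Z" "\<And>Y. Y \<in> pa \<Longrightarrow> \<gamma> (Z * Y - Y * Z) = 0"
  shows "Z = 0\<^sub>m n n"
proof -
  define N where "N = {Z \<in> pa. corner Z \<and> (\<forall>Y\<in>pa. \<gamma> (Z * Y - Y * Z) = 0)}"
  \<comment> \<open>\<open>Ad (ex Z)\<close> sends \<open>grad\<close> to \<open>grad - 2 Z\<close>,
    and \<open>grad\<close> has no entry in the corner; so -1/2 times the corner of the image is
    \<open>Z\<close>.\<close>
  define \<rho> where "\<rho> \<phi> = mat n n (\<lambda>(i, j). if i < r \<and> n - r \<le> j then (-1/2) * \<phi> grad $$ (i, j) else 0)"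
    for \<phi> :: "complex mat \<Rightarrow> complex mat"
  have \<rho>_corner: "corner (\<rho> \<phi>)" and \<rho>_M: "\<rho> \<phi> \<in> M" for \<phi> by (auto simp: corner_def \<rho>_def)
  have sub: "(A + B) * C - C * (A + B) = (A * C - C * A) + (B * C - C * B)"
    if "A \<in> M" "B \<in> M" "C \<in> M" for A B C :: "complex mat"
    using that by (simp add: mult_M) (intro eq_matI, auto simp del: index_mult_mat(1))
  have subc: "(c \<cdot>\<^sub>m A) * C - C * (c \<cdot>\<^sub>m A) = c \<cdot>\<^sub>m (A * C - C * A)"
    if "A \<in> M" "C \<in> M" for A C :: "complex mat" and c
    using that by (simp add: mult_M) (intro eq_matI, auto simp: algebra_simps simp del: index_mult_mat(1))
  have conj: "conj_by (ex W) Y = Y + (W * Y - Y * W)" if "W \<in> pa" "corner W" "Y \<in> pa" for W Y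
    using that by (simp add: conj_ex corner_mult_zero pa_sp pa_M corner_conj_ex pa_UT)
  have "N = {0\<^sub>m n n}"
  proof (rule reductive_type_no_ideal[OF red, of N \<rho>])
    show "N \<subseteq> pa" by (auto simp: N_def)
    have "\<gamma> (0\<^sub>m n n) = 0" using dual_smult[OF \<gamma> pa_zero, of 0] by auto
    then show "0\<^sub>m n n \<in> N" by (auto simp: N_def pa_zero corner_def pa_M)
  next
    fix A B assume "A \<in> N" "B \<in> N"
    then show "A + B \<in> N"
      using \<gamma> by (auto simp: N_def pa_add pa_M sub dual_add bracket_pa) (auto simp: corner_def dest: pa_M)
  next
    fix c A assume "A \<in> N"
    then show "c \<cdot>\<^sub>m A \<in> N"
      using \<gamma> by (auto simp: N_def pa_smult pa_M subc dual_smult bracket_pa) (auto simp: corner_def dest: pa_M)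
  next
    fix A B assume "A \<in> N" "B \<in> N"
    then show "A * B = B * A" by (simp add: N_def corner_mult_zero pa_M)
  next
    fix A B C assume "A \<in> N" "B \<in> N" "C \<in> N"
    then show "A * (B * C) = 0\<^sub>m n n" by (simp add: N_def corner_mult_zero pa_M)
  next
    fix A assume A: "A \<in> N"
    then have AP: "A \<in> pa" "corner A" "\<And>Y. Y \<in> pa \<Longrightarrow> \<gamma> (A * Y - Y * A) = 0" by (auto simp: N_def)
    have "ex A \<in> Pg" using AP by (simp add: ex_Pg corner_mult_zero pa_M)
    then show "ex A \<in> group_stab n Pg \<gamma>"
      using AP \<gamma> by (simp add: group_stab_Pg conj dual_add bracket_pa)
  next
    fix g A assume g: "g \<in> group_stab n Pg \<gamma>" and A: "A \<in> N"
    have gP: "g \<in> Pg" using g by (rule stab_Pg)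
    have AP: "A \<in> pa" "corner A" "\<And>Y. Y \<in> pa \<Longrightarrow> \<gamma> (A * Y - Y * A) = 0" using A by (auto simp: N_def)
    have "\<gamma> (conj_by g A * Y - Y * conj_by g A) = 0" if Y: "Y \<in> pa" for Y
    proof -
      define Y' where "Y' = conj_by (adj g) Y"
      have Y': "Y' \<in> pa" "Y = conj_by g Y'" using Y gP by (auto simp: Y'_def conj_by_pa Pg_adj conj_by_adj' Pg_Sp pa_M)
      have "conj_by g A * Y - Y * conj_by g A = conj_by g (A * Y' - Y' * A)"
        using Y' AP gP by (simp add: conj_by_times conj_by_minus Pg_Sp pa_M)
      then show ?thesis using g Y' AP bracket_pa[OF AP(1) Y'(1)] by (simp add: group_stab_Pg)
    qed
    then show "conj_by g A \<in> N" using AP gP by (simp add: N_def conj_by_pa corner_conj pa_M)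
  next
    fix i j assume ij: "i < n" "j < n"
    have "(\<lambda>\<phi>. (-1/2) * \<phi> grad $$ (i, j)) \<in> poly_functions (End_coords n pa)"
      using ij grad_pa by (intro poly_functions_cmult End_coord)
    then show "(\<lambda>\<phi>. \<rho> \<phi> $$ (i, j)) \<in> poly_functions (End_coords n pa)"
      using ij poly_functions.const[of 0 "End_coords n pa"]
      by (cases "i < r \<and> n - r \<le> j") (auto simp: \<rho>_def)
  next
    show "\<rho> \<phi> \<in> M" for \<phi> by (rule \<rho>_M)
  next
    fix A assume A: "A \<in> N"
    then have AP: "A \<in> pa" "corner A" and AM: "A \<in> M" by (auto simp: N_def pa_M)
    have *: "Ad n Pg (ex A) grad = grad + (-2) \<cdot>\<^sub>m A"
      using AP by (simp add: Ad_pa grad_pa conj grad_corner pa_M)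
    show "\<rho> (Ad n Pg (ex A)) = A"
    proof (rule eq_matI)
      fix i j assume "i < dim_row A" "j < dim_col A"
      then have ij: "i < n" "j < n" using AM by auto
      have e: "Ad n Pg (ex A) grad $$ (i, j) = grad $$ (i, j) + (-2) * A $$ (i, j)"
        unfolding * using ij AM by simp
      show "\<rho> (Ad n Pg (ex A)) $$ (i, j) = A $$ (i, j)"
      proof (cases "i < r \<and> n - r \<le> j")
        case True
        then have "grad $$ (i, j) = 0" using ij r_le by (auto simp: grad_def)
        then show ?thesis using True ij e by (simp add: \<rho>_def)
      qed (use ij AP(2) in \<open>auto simp: \<rho>_def corner_def\<close>)
    qed (use AM \<rho>_M in auto)
  next
    fix g assume g: "g \<in> group_stab n Pg \<gamma>"
      and eq: "\<And>Y. Y \<in> pa \<Longrightarrow> conj_by g Y = ex (\<rho> (Ad n Pg g)) * Y * ex (- \<rho> (Ad n Pg g))"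
    \<comment> \<open>\<open>W\<close> is cut out of \<open>conj_by g grad\<close>, which lies in
      \<open>sp\<close>, so it is skew and belongs to \<open>pa\<close>. Since \<open>g\<close>
      sends each \<open>Y\<close> to \<open>Y + [W, Y]\<close> and fixes the form, \<open>W\<close>
      stabilises the form.\<close>
    define W where "W = \<rho> (Ad n Pg g)"
    have gP: "g \<in> Pg" using g by (rule stab_Pg)
    have WM: "W \<in> M" and Wc: "corner W" using \<rho>_M \<rho>_corner by (auto simp: W_def)
    have cg: "conj_by g grad \<in> sp" and cgM: "conj_by g grad \<in> M"
      using conj_by_pa[OF gP grad_pa] by (auto simp: pa_sp pa_M)
    have W: "W = mat n n (\<lambda>(i, j). if i < r \<and> n - r \<le> j then (-1/2) * conj_by g grad $$ (i, j) else 0)"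
      unfolding W_def \<rho>_def Ad_pa[OF grad_pa] ..
    have "adj W = - W"
    proof (rule eq_matI)
      fix i j assume "i < dim_row (- W)" "j < dim_col (- W)"
      then have ij: "i < n" "j < n" using WM by auto
      have "adj (conj_by g grad) $$ (i, j) = (- conj_by g grad) $$ (i, j)" using sp_adj[OF cg] by simp
      then have "sg i * sg j * conj_by g grad $$ (du j, du i) = - conj_by g grad $$ (i, j)"
        using ij cgM by (simp add: adj_entry)
      moreover have "(du j < r \<and> n - r \<le> du i) \<longleftrightarrow> (i < r \<and> n - r \<le> j)" using ij by auto
      ultimately show "adj W $$ (i, j) = (- W) $$ (i, j)"
        using ij by (auto simp: adj_entry W)
    qed (use WM in auto)
    then have WP: "W \<in> pa" using WM corner_UT[OF Wc] by (simp add: pa_def sp_def)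
    have "\<gamma> (W * Y - Y * W) = 0" if Y: "Y \<in> pa" for Y
    proof -
      have "conj_by g Y = Y + (W * Y - Y * W)"
        using eq[OF Y] corner_conj_ex[OF WM Wc pa_M[OF Y] pa_UT[OF Y]] by (simp add: W_def)
      moreover have "\<gamma> (conj_by g Y) = \<gamma> Y" using g Y by (simp add: group_stab_Pg)
      ultimately show ?thesis using dual_add[OF \<gamma> Y bracket_pa[OF WP Y]] by simp
    qed
    then show "\<rho> (Ad n Pg g) \<in> N" using WP Wc by (simp add: N_def W_def)
  qed
  moreover have "Z \<in> N" using Z by (simp add: N_def)
  ultimately show ?thesis by simp
qed

section \<open>Products of vectors in S^2 V_t and nondegeneracy\<close>

definition Zv :: "(nat \<Rightarrow> complex) \<Rightarrow> (nat \<Rightarrow> complex) \<Rightarrow> complex mat" where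
  "Zv v w = mat n n (\<lambda>(i, j). if i < r \<and> n - r \<le> j then v i * w (du j) + w i * v (du j) else 0)"

lemma Zv_M [simp]: "Zv v w \<in> M" by (simp add: Zv_def)
lemma Zv_dim [simp]: "dim_row (Zv v w) = n" "dim_col (Zv v w) = n" by (simp_all add: Zv_def)
lemma Zv_corner: "corner (Zv v w)" by (simp add: corner_def Zv_def)
lemma Zv_sym: "Zv v w = Zv w v" by (intro eq_matI) (auto simp: Zv_def)

lemma Zv_pa: "Zv v w \<in> pa"
proof -
  have "adj (Zv v w) = - Zv v w"
    by (intro eq_matI) (use r_le in \<open>auto simp: adj_entry Zv_def sg_def\<close>)
  then show ?thesis using corner_UT[OF Zv_corner] by (simp add: pa_def sp_def)
qed

lemma Zv_add: "Zv (\<lambda>i. v i + v' i) w = Zv v w + Zv v' w"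
  by (intro eq_matI) (auto simp: Zv_def algebra_simps)
lemma Zv_smult: "Zv (\<lambda>i. c * v i) w = c \<cdot>\<^sub>m Zv v w"
  by (intro eq_matI) (auto simp: Zv_def algebra_simps)

text \<open>The derivation rule for the action of \<open>Y\<close> on the square of
  \<open>v\<close>. Skewness of \<open>Y\<close> rewrites its entries on the dual block by those on
  V_t, so that only the vector \<open>Y v\<close> appears.\<close>

lemma Zv_bracket:
  assumes Y: "Y \<in> pa"
  shows "Zv v v * Y - Y * Zv v v = (-2) \<cdot>\<^sub>m Zv (\<lambda>i. \<Sum>k<r. Y $$ (i, k) * v k) v"
proof (rule eq_matI)
  let ?u = "\<lambda>i. \<Sum>k<r. Y $$ (i, k) * v k"
  fix i j assume "i < dim_row ((-2) \<cdot>\<^sub>m Zv ?u v)" "j < dim_col ((-2) \<cdot>\<^sub>m Zv ?u v)"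
  then have ij: "i < n" "j < n" by auto
  have YM: "Y \<in> M" using Y by (rule pa_M)
  have nr: "{..<n} \<inter> {k. k < r} = {..<r}" using r_le by auto
  show "(Zv v v * Y - Y * Zv v v) $$ (i, j) = ((-2) \<cdot>\<^sub>m Zv ?u v) $$ (i, j)"
  proof (cases "i < r \<and> n - r \<le> j")
    case False
    have "corner (Zv v v * Y)" "corner (Y * Zv v v)"
      by (rule corner_right[OF Zv_M YM Zv_corner pa_UT[OF Y]], rule corner_left[OF Zv_M YM Zv_corner pa_UT[OF Y]])
    then have "(Zv v v * Y) $$ (i, j) = 0" "(Y * Zv v v) $$ (i, j) = 0"
      using False ij unfolding corner_def by blast+
    then show ?thesis using False ij YM by (auto simp: Zv_def simp del: index_mult_mat(1))
  next
    case True
    have sj: "sg j = -1" "du j < r" using True ij r_le by (auto simp: sg_def)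
    have Yd: "Y $$ (du k, j) = - Y $$ (du j, k)" if "k < r" for k
    proof -
      have k: "k < n" "\<not> du k < l" using that r_le by auto
      have "adj Y $$ (du k, j) = (- Y) $$ (du k, j)" using sp_adj[OF pa_sp[OF Y]] by simp
      then show ?thesis using k ij YM sj by (simp add: adj_entry sg_def)
    qed
    have "(Zv v v * Y) $$ (i, j) = (\<Sum>k<n. Zv v v $$ (i, du k) * Y $$ (du k, j))"
      unfolding mult_entry[OF Zv_M YM ij] by (rule sum_du)
    also have "\<dots> = (\<Sum>k<n. if k < r then - 2 * v i * (Y $$ (du j, k) * v k) else 0)"
    proof (rule sum.cong)
      fix k assume "k \<in> {..<n}"
      then show "Zv v v $$ (i, du k) * Y $$ (du k, j) = (if k < r then - 2 * v i * (Y $$ (du j, k) * v k) else 0)"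
        using Yd[of k] True ij by (auto simp: Zv_def algebra_simps)
    qed simp
    also have "\<dots> = - 2 * v i * ?u (du j)" by (simp add: sum.If_cases nr sum_distrib_left)
    finally have 1: "(Zv v v * Y) $$ (i, j) = - 2 * v i * ?u (du j)" .
    have "(Y * Zv v v) $$ (i, j) = (\<Sum>k<n. if k < r then 2 * v (du j) * (Y $$ (i, k) * v k) else 0)"
      unfolding mult_entry[OF YM Zv_M ij] by (rule sum.cong) (use ij True in \<open>auto simp: Zv_def algebra_simps\<close>)
    also have "\<dots> = 2 * v (du j) * ?u i" by (simp add: sum.If_cases nr sum_distrib_left)
    finally have 2: "(Y * Zv v v) $$ (i, j) = 2 * v (du j) * ?u i" .
    have "(Zv v v * Y - Y * Zv v v) $$ (i, j) = - 2 * v i * ?u (du j) - 2 * v (du j) * ?u i"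
      using 1 2 ij YM by (simp del: index_mult_mat(1))
    also have "\<dots> = ((-2) \<cdot>\<^sub>m Zv ?u v) $$ (i, j)"
      using True ij by (simp add: Zv_def algebra_simps)
    finally show ?thesis .
  qed
qed (use pa_M[OF Y] in auto)

text \<open>Membership in a member of the flag, which is indexed by the highest level it
  contains.\<close>

definition supp :: "nat \<Rightarrow> (nat \<Rightarrow> complex) \<Rightarrow> bool" where
  "supp c v \<longleftrightarrow> (\<forall>j. v j \<noteq> 0 \<longrightarrow> j < r \<and> lv j \<le> c)"

text \<open>If \<open>v\<close> is in the radical of the quadratic form on a flag member, then
  \<open>Y v\<close> stays in that member because \<open>Y\<close> is block triangular, and the form
  kills every bracket of \<open>Zv v v\<close> with \<open>pa\<close>. By
  \<open>corner_stab_trivial\<close> the square of \<open>v\<close> is zero, hence so is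
  \<open>v\<close>.\<close>

theorem flag_nondegenerate:
  assumes \<gamma>: "\<gamma> \<in> lie_dual n Pg" and red: "reductive_type n Pg \<gamma>"
    and v: "supp c v" and orth: "\<And>w. supp c w \<Longrightarrow> \<gamma> (Zv w v) = 0"
  shows "v i = 0"
proof -
  have "\<gamma> (Zv v v * Y - Y * Zv v v) = 0" if Y: "Y \<in> pa" for Y
  proof -
    let ?u = "\<lambda>i. \<Sum>k<r. Y $$ (i, k) * v k"
    define u where "u i = (if i < r then ?u i else 0)" for i
    have "supp c u" unfolding supp_def
    proof (intro allI impI)
      fix i assume "u i \<noteq> 0"
      then have i: "i < r" and "?u i \<noteq> 0" by (auto simp: u_def split: if_splits)
      then obtain k where k: "k < r" "Y $$ (i, k) * v k \<noteq> 0" by (meson lessThan_iff sum.not_neutral_contains_not_neutral)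
      then have "lv k \<le> c" using v by (auto simp: supp_def)
      moreover have "\<not> lv k < lv i" using k i r_le pa_UT[OF Y] unfolding UT_def by auto
      ultimately show "i < r \<and> lv i \<le> c" using i by auto
    qed
    moreover have "Zv ?u v = Zv u v"
      by (intro eq_matI) (use r_le in \<open>auto simp: Zv_def u_def\<close>)
    ultimately have "\<gamma> (Zv ?u v) = 0" using orth by simp
    then show ?thesis using dual_smult[OF \<gamma> Zv_pa] by (simp add: Zv_bracket[OF Y])
  qed
  then have Z0: "Zv v v = 0\<^sub>m n n" by (rule corner_stab_trivial[OF \<gamma> red Zv_pa Zv_corner])
  show "v i = 0"
  proof (cases "i < r")
    case True
    then have "Zv v v $$ (i, du i) = 2 * (v i * v i)" using r_le by (simp add: Zv_def)
    moreover have "Zv v v $$ (i, du i) = 0" using Z0 True r_le by simp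
    ultimately show ?thesis by simp
  qed (use v in \<open>auto simp: supp_def\<close>)
qed

end

text \<open>Padding the system with a zero row gives a square matrix whose transpose kills the last
  unit vector; its determinant is therefore zero.\<close>

lemma homogeneous_nontrivial_solution:
  fixes a :: "nat \<Rightarrow> nat \<Rightarrow> complex"
  obtains x where "\<And>k. k < m \<Longrightarrow> (\<Sum>j\<le>m. a k j * x j) = 0" "\<exists>j\<le>m. x j \<noteq> 0"
proof -
  define A where "A = mat (Suc m) (Suc m) (\<lambda>(k, j). if k < m then a k j else 0)"
  have A: "A \<in> carrier_mat (Suc m) (Suc m)" by (simp add: A_def)
  have "transpose_mat A *\<^sub>v unit_vec (Suc m) m = 0\<^sub>v (Suc m)"
    by (intro eq_vecI) (auto simp: A_def scalar_prod_def unit_vec_def if_distrib[of "\<lambda>x. _ * x"] intro!: sum.neutral)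
  moreover have "unit_vec (Suc m) m \<noteq> (0\<^sub>v (Suc m) :: complex vec)" by simp
  ultimately have "det (transpose_mat A) = 0"
    using det_0_iff_vec_prod_zero[of "transpose_mat A" "Suc m"] A by (metis transpose_carrier_mat unit_vec_carrier)
  then have "det A = 0" using det_transpose[OF A] by simp
  then obtain v where v: "v \<in> carrier_vec (Suc m)" "v \<noteq> 0\<^sub>v (Suc m)" "A *\<^sub>v v = 0\<^sub>v (Suc m)"
    using det_0_iff_vec_prod_zero[OF A] by blast
  show thesis
  proof (rule that[of "\<lambda>j. v $ j"])
    fix k assume k: "k < m"
    have "0 = (A *\<^sub>v v) $ k" using v k by simp
    also have "\<dots> = (\<Sum>j<Suc m. a k j * v $ j)"
      using k v(1) by (auto simp: A_def scalar_prod_def atLeast0LessThan intro!: sum.cong)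
    finally show "(\<Sum>j\<le>m. a k j * v $ j) = 0" by (simp add: lessThan_Suc_atMost)
  next
    show "\<exists>j\<le>m. v $ j \<noteq> 0"
    proof (rule ccontr)
      assume "\<not> (\<exists>j\<le>m. v $ j \<noteq> 0)"
      then have "v = 0\<^sub>v (Suc m)" using v(1) by (intro eq_vecI) auto
      then show False using v(2) by simp
    qed
  qed
qed

context levelled begin

text \<open>Gram--Schmidt adapted to the flag. If no vector of the current space that is orthogonal to
  the previous ones had nonzero length, a nonzero such vector would be in the radical.\<close>

theorem flag_orthonormal_basis:
  assumes \<gamma>: "\<gamma> \<in> lie_dual n Pg" and red: "reductive_type n Pg \<gamma>"
  shows "m \<le> r \<Longrightarrow> \<exists>b. (\<forall>k<m. supp (lv k) (b k)) \<and>
    (\<forall>k<m. \<forall>k'<m. \<gamma> (Zv (b k) (b k')) = (if k = k' then 2 else 0))"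
proof (induction m)
  case (Suc m)
  then obtain b where b: "\<And>k. k < m \<Longrightarrow> supp (lv k) (b k)"
    and on: "\<And>k k'. k < m \<Longrightarrow> k' < m \<Longrightarrow> \<gamma> (Zv (b k) (b k')) = (if k = k' then 2 else 0)" by auto
  have m: "m < r" "m < n" using Suc.prems r_le by auto
  define c where "c = lv m"
  define q where "q v w = \<gamma> (Zv v w)" for v w
  have qs: "q v w = q w v" for v w by (simp add: q_def Zv_sym)
  have qa: "q (\<lambda>i. v i + v' i) w = q v w + q v' w" for v v' w
    using dual_add[OF \<gamma> Zv_pa Zv_pa] by (simp add: q_def Zv_add)
  have qm: "q (\<lambda>i. x * v i) w = x * q v w" for x v w
    using dual_smult[OF \<gamma> Zv_pa] by (simp add: q_def Zv_smult)
  have qa2: "q w (\<lambda>i. v i + v' i) = q w v + q w v'" for v v' w using qa qs by metis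
  have qm2: "q w (\<lambda>i. x * v i) = x * q w v" for x v w using qm qs by metis
  have qz: "q (\<lambda>i. 0) w = 0" for w using qm[of 0 "\<lambda>i. 0" w] by simp
  have qsum: "finite K \<Longrightarrow> q (\<lambda>i. \<Sum>k\<in>K. f k i) w = (\<Sum>k\<in>K. q (f k) w)" for K :: "nat set" and f w
    by (induction K rule: finite_induct) (auto simp: qz qa)
  have bc: "supp c (b k)" if "k < m" for k
    using b[OF that] lv_mono[of k m] that m unfolding supp_def c_def by (meson le_trans less_imp_le)
  have sadd: "supp c v \<Longrightarrow> supp c w \<Longrightarrow> supp c (\<lambda>i. v i + w i)" for v w
    unfolding supp_def by (metis add.right_neutral)
  have smul: "supp c v \<Longrightarrow> supp c (\<lambda>i. x * v i)" for v x unfolding supp_def by auto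
  define C where "C = {v. supp c v \<and> (\<forall>k<m. q v (b k) = 0)}"
  have Cadd: "v \<in> C \<Longrightarrow> w \<in> C \<Longrightarrow> (\<lambda>i. v i + w i) \<in> C" for v w by (auto simp: C_def qa sadd)
  \<comment> \<open>Subtracting the components along the earlier vectors does not change pairings
    with \<open>C\<close>, so a vector of \<open>C\<close> orthogonal to all of \<open>C\<close> is
    orthogonal to the whole flag member. The divisor 2 is the value of the form at each
    \<open>b k\<close>.\<close>
  have proj: "\<exists>w'\<in>C. \<forall>u\<in>C. q u w = q u w'" if w: "supp c w" for w
  proof -
    define s where "s i = (\<Sum>k<m. (- (q w (b k) / 2)) * b k i)" for i
    define w' where "w' i = w i + s i" for i
    have ss: "supp c s" unfolding supp_def
    proof (intro allI impI)
      fix j assume "s j \<noteq> 0"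
      then obtain k where "k < m" "b k j \<noteq> 0" unfolding s_def
        by (metis (no_types, lifting) lessThan_iff mult_zero_right sum.neutral)
      then show "j < r \<and> lv j \<le> c" using bc by (auto simp: supp_def)
    qed
    have qsb: "q s (b k) = - q w (b k)" if k: "k < m" for k
    proof -
      have "q s (b k) = (\<Sum>k'<m. (- (q w (b k') / 2)) * q (b k') (b k))"
        unfolding s_def[abs_def] by (subst qsum) (auto simp: qm[of "- (q w (b _) / 2)"] simp del: mult_minus_left)
      also have "\<dots> = (\<Sum>k'<m. if k' = k then - q w (b k) else 0)"
        using on[OF _ k] by (intro sum.cong) (auto simp: q_def)
      finally show ?thesis using k by simp
    qed
    have "w' \<in> C" unfolding C_def w'_def[abs_def] using w ss qsb by (auto simp: sadd qa)
    moreover have "q u w = q u w'" if u: "u \<in> C" for u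
    proof -
      have "q s u = (\<Sum>k'<m. (- (q w (b k') / 2)) * q (b k') u)"
        unfolding s_def[abs_def] by (subst qsum) (auto simp: qm[of "- (q w (b _) / 2)"] simp del: mult_minus_left)
      also have "\<dots> = 0" using u by (intro sum.neutral) (auto simp: C_def qs[of _ u])
      finally show ?thesis unfolding w'_def[abs_def] qa2 qs[of u s] by simp
    qed
    ultimately show ?thesis by blast
  qed
  define e where "e j i = (if i = j then 1 else 0 :: complex)" for j i :: nat
  \<comment> \<open>There are \<open>m + 1\<close> coordinates of level at most \<open>lv m\<close>
    at hand and \<open>m\<close> orthogonality conditions, so \<open>C\<close> contains a nonzero
    vector.\<close>
  obtain x where x: "\<And>k. k < m \<Longrightarrow> (\<Sum>j\<le>m. q (e j) (b k) * x j) = 0" "\<exists>j\<le>m. x j \<noteq> 0"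
    using homogeneous_nontrivial_solution[of m "\<lambda>k j. q (e j) (b k)"] by blast
  define v where "v i = (\<Sum>j\<le>m. x j * e j i)" for i
  have v_eq: "v i = (if i \<le> m then x i else 0)" for i
    by (auto simp: v_def e_def if_distrib[of "\<lambda>y. _ * y"] cong: if_cong)
  have "supp c v" unfolding supp_def
  proof (intro allI impI)
    fix j assume "v j \<noteq> 0"
    then have "j \<le> m" by (simp add: v_eq split: if_splits)
    then show "j < r \<and> lv j \<le> c" using m lv_mono[of j m] by (simp add: c_def)
  qed
  moreover have "q v (b k) = 0" if "k < m" for k
  proof -
    have "q v (b k) = (\<Sum>j\<le>m. x j * q (e j) (b k))"
      unfolding v_def[abs_def] by (subst qsum) (auto simp: qm)
    then show ?thesis using x(1)[OF that] by (simp add: mult.commute)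
  qed
  ultimately have vC: "v \<in> C" by (simp add: C_def)
  have v0: "\<exists>j. v j \<noteq> 0" using x(2) v_eq by auto
  have "\<exists>u\<in>C. q u u \<noteq> 0"
  proof (rule ccontr)
    assume "\<not> (\<exists>u\<in>C. q u u \<noteq> 0)"
    then have iso: "q u u = 0" if "u \<in> C" for u using that by blast
    have "q w v = 0" if w: "supp c w" for w
    proof -
      obtain w' where w': "w' \<in> C" "q v w = q v w'" using proj[OF w] vC by blast
      \<comment> \<open>Polarisation: where all squares vanish, so do all pairings.\<close>
      have "q (\<lambda>i. v i + w' i) (\<lambda>i. v i + w' i) = 0" using iso Cadd vC w' by blast
      then have "2 * q v w' = 0" using iso[OF vC] iso[OF w'(1)] by (simp add: qa qa2 qs[of w' v])
      then show ?thesis using w' qs by simp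
    qed
    then have "v j = 0" for j
      using flag_nondegenerate[OF \<gamma> red, of c v] vC by (simp add: q_def C_def)
    then show False using v0 by simp
  qed
  then obtain u where u: "u \<in> C" "q u u \<noteq> 0" by blast
  \<comment> \<open>The target value is 2 because \<open>Zv u u\<close> is twice the outer square of
    \<open>u\<close>; the form \<open>gam F0\<close> takes this value on the square of a standard
    basis vector.\<close>
  define z where "z = csqrt (2 / q u u)"
  have z: "z * (z * q u u) = 2" using u(2) power2_csqrt[of "2 / q u u"]
    by (simp add: z_def power2_eq_square flip: mult.assoc)
  define b' where "b' = b(m := (\<lambda>i. z * u i))"
  have bm: "b' m = (\<lambda>i. z * u i)" and bl: "k < m \<Longrightarrow> b' k = b k" for k by (auto simp: b'_def)
  have "supp (lv k) (b' k)" if "k < Suc m" for k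
    using that b u smul[of u z] by (cases "k = m") (auto simp: bm bl C_def c_def)
  moreover have "q (b' k) (b' k') = (if k = k' then 2 else 0)" if "k < Suc m" "k' < Suc m" for k k'
  proof -
    have 1: "q (b' m) (b' m) = 2" by (simp add: bm qm qm2 z)
    have 2: "q (b' m) (b' k) = 0" if "k < m" for k using u that by (simp add: bm bl qm C_def)
    show ?thesis
      using that 1 2 2[of k] on[of k k', folded q_def] qs[of "b' k" "b' m"] by (cases "k = m"; cases "k' = m") (auto simp: bl less_Suc_eq)
  qed
  ultimately show ?case unfolding q_def by blast
qed auto

section \<open>Normal form of a linear form of reductive type\<close>

lemma linear_functional_entries:
  fixes h :: "complex mat \<Rightarrow> complex"
  assumes add: "\<And>X Y. X \<in> M \<Longrightarrow> Y \<in> M \<Longrightarrow> h (X + Y) = h X + h Y"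
    and smult: "\<And>c X. X \<in> M \<Longrightarrow> h (c \<cdot>\<^sub>m X) = c * h X"
    and X: "X \<in> M"
  shows "h X = (\<Sum>p\<in>{..<n} \<times> {..<n}. X $$ p * h (el (fst p) (snd p)))"
proof -
  have "h (mat n n (\<lambda>p. if p \<in> S then X $$ p else 0)) = (\<Sum>p\<in>S. X $$ p * h (el (fst p) (snd p)))"
    if "S \<subseteq> {..<n} \<times> {..<n}" "finite S" for S
    using that(2,1)
  proof (induction S rule: finite_induct)
    case empty
    have "h (0\<^sub>m n n) = 0" using smult[of "0\<^sub>m n n" 0] by auto
    moreover have "mat n n (\<lambda>p. if p \<in> {} then X $$ p else 0) = 0\<^sub>m n n" by (intro eq_matI) auto
    ultimately show ?case by simp
  next
    case (insert p S)
    have "mat n n (\<lambda>q. if q \<in> insert p S then X $$ q else 0) =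
        X $$ p \<cdot>\<^sub>m el (fst p) (snd p) + mat n n (\<lambda>p. if p \<in> S then X $$ p else 0)"
      by (rule eq_matI) (use insert in \<open>auto simp: el_def\<close>)
    then show ?case using insert by (simp add: add smult)
  qed
  note * = this[of "{..<n} \<times> {..<n}"]
  have "mat n n (\<lambda>p. if p \<in> {..<n} \<times> {..<n} then X $$ p else 0) = X"
    using X by (intro eq_matI) auto
  then show ?thesis using * by simp
qed

text \<open>\<open>T\<close> projects all matrices onto \<open>pa\<close> by skew-symmetrising and
  dropping the entries below the diagonal blocks. Composition with it extends the form to all
  matrices, where it is a trace form; as \<open>pa\<close> lies in \<open>sp\<close>, the skew part
  \<open>F'\<close> represents the same form.\<close>

lemma dual_rep:
  assumes \<gamma>: "\<gamma> \<in> lie_dual n Pg"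
  obtains F where "F \<in> sp" "\<gamma> = gam F"
proof -
  define T where "T X = mat n n (\<lambda>(i, j). if lv j < lv i then 0 else (X $$ (i, j) - adj X $$ (i, j)) / 2)"
    for X :: "complex mat"
  have TM: "T X \<in> M" for X by (simp add: T_def)
  have Tpa: "T X \<in> pa" if "X \<in> M" for X
  proof -
    have "adj (T X) = - T X"
    proof (rule eq_matI)
      fix i j assume "i < dim_row (- T X)" "j < dim_col (- T X)"
      then have ij: "i < n" "j < n" by (auto simp: T_def)
      show "adj (T X) $$ (i, j) = (- T X) $$ (i, j)"
        using ij lv_du_less[OF ij(2,1)] lv_du_less[OF ij] lv_du_less[OF ij(2,1)]
        by (auto simp: adj_entry T_def sg_du lv_du_less field_simps sg_def)
    qed (auto simp: T_def)
    then show ?thesis using TM by (auto simp: pa_def sp_def UT_def T_def)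
  qed
  have Tid: "T X = X" if "X \<in> pa" for X
  proof (rule eq_matI)
    fix i j assume "i < dim_row X" "j < dim_col X"
    then have ij: "i < n" "j < n" using pa_M[OF that] by auto
    have "adj X $$ (i, j) = - X $$ (i, j)" using sp_adj[OF pa_sp[OF that]] ij pa_M[OF that] by simp
    then show "T X $$ (i, j) = X $$ (i, j)" using ij pa_UT[OF that] by (auto simp: T_def UT_def)
  qed (use pa_M[OF that] in \<open>auto simp: T_def\<close>)
  have Tadd: "T (X + Y) = T X + T Y" if "X \<in> M" "Y \<in> M" for X Y
    using that by (intro eq_matI) (auto simp: T_def adj_add field_simps)
  have Tsm: "T (c \<cdot>\<^sub>m X) = c \<cdot>\<^sub>m T X" if "X \<in> M" for X c
    using that by (intro eq_matI) (auto simp: T_def adj_smult field_simps)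
  define F where "F = mat n n (\<lambda>(j, i). \<gamma> (T (el i j)))"
  have FM: "F \<in> M" by (simp add: F_def)
  have FX: "\<gamma> X = tr (F * X)" if X: "X \<in> pa" for X
  proof -
    have XM: "X \<in> M" using X by (rule pa_M)
    have "\<gamma> X = \<gamma> (T X)" by (simp add: Tid X)
    also have "\<dots> = (\<Sum>p\<in>{..<n} \<times> {..<n}. X $$ p * \<gamma> (T (el (fst p) (snd p))))"
      by (rule linear_functional_entries[of "\<lambda>X. \<gamma> (T X)"])
        (use \<gamma> XM Tpa in \<open>auto simp: Tadd Tsm dual_add dual_smult\<close>)
    also have "\<dots> = (\<Sum>i<n. \<Sum>j<n. X $$ (i, j) * F $$ (j, i))"
      unfolding sum.cartesian_product by (intro sum.cong) (auto simp: F_def)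
    also have "\<dots> = tr (X * F)" using tr_mult[OF XM FM] by simp
    finally show ?thesis using tr_comm[OF XM FM] by simp
  qed
  define F' where "F' = (1/2) \<cdot>\<^sub>m (F - adj F)"
  have F'sp: "F' \<in> sp"
    using FM by (auto simp: F'_def sp_def adj_smult adj_minus adj_adj intro!: eq_matI)
      (simp add: field_simps)
  have "tr (F' * X) = \<gamma> X" if X: "X \<in> pa" for X
    using FX[OF X] tr_adj_skew[OF FM pa_sp[OF X]] FM pa_M[OF X]
    by (simp add: F'_def mult_M tr_smult[of _ n] tr_minus[of _ n])
  then have "\<gamma> = gam F'" using \<gamma> by (auto simp: gam_def lie_dual_def lie_Pg extensional_def fun_eq_iff)
  then show thesis using F'sp that by blast
qed

lemma act_gam: assumes "g \<in> Pg" "F \<in> M" shows "act g (gam F) = gam (conj_by g F)"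
proof
  fix X show "act g (gam F) X = gam (conj_by g F) X"
    using assms tr_shift[of "adj g" F X]
    by (cases "X \<in> pa") (auto simp: act_def gam_def conj_by_pa Pg_adj Pg_Sp Sp_adj adj_adj Pg_M pa_M)
qed

lemma gam_eqI:
  assumes "F \<in> sp" "F' \<in> sp" "\<And>i j. i < n \<Longrightarrow> j < n \<Longrightarrow> lv j \<le> lv i \<Longrightarrow> F $$ (i, j) = F' $$ (i, j)"
  shows "gam F = gam F'"
proof
  fix X show "gam F X = gam F' X"
  proof (cases "X \<in> pa")
    case True
    have "tr ((F - F') * X) = 0"
      using assms True sp_M[OF assms(1)] sp_M[OF assms(2)] by (intro tr_strict_upper) (auto simp: pa_M pa_UT)
    then show ?thesis using assms True by (simp add: gam_def mult_M sp_M pa_M tr_minus[of _ n])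
  qed (simp add: gam_def)
qed

lemma Zv_unit:
  assumes ij: "i < r" "j < r"
  shows "Zv (\<lambda>k. if k = i then 1 else 0) (\<lambda>k. if k = j then 1 else 0) = el i (du j) + el j (du i)"
proof (rule eq_matI)
  fix p q assume "p < dim_row (el i (du j) + el j (du i))" "q < dim_col (el i (du j) + el j (du i))"
  then have pq: "p < n" "q < n" by (auto simp: el_def)
  define u where "u = du q"
  have dq: "q = du k \<longleftrightarrow> n - r \<le> q \<and> u = k" if "k < r" for k using that pq r_le by (auto simp: u_def)
  define c where "c \<longleftrightarrow> p < r \<and> n - r \<le> q"
  have A: "(p = i \<and> q = du j) = (c \<and> p = i \<and> u = j)" and B: "(p = j \<and> q = du i) = (c \<and> p = j \<and> u = i)"
    using dq[OF ij(1)] dq[OF ij(2)] ij unfolding c_def by blast+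
  have L: "Zv (\<lambda>k. if k = i then 1 else 0) (\<lambda>k. if k = j then 1 else 0) $$ (p, q) =
      (if c then (if p = i then 1 else 0) * (if u = j then 1 else 0)
        + (if p = j then 1 else 0) * (if u = i then 1 else 0) else 0)"
    using pq by (simp only: Zv_def index_mat prod.case u_def c_def)
  have R: "(el i (du j) + el j (du i)) $$ (p, q) =
      (if c \<and> p = i \<and> u = j then 1 else 0) + (if c \<and> p = j \<and> u = i then 1 else 0)"
    unfolding el_def A[symmetric] B[symmetric]
    using pq by (simp only: index_add_mat dim_row_mat dim_col_mat index_mat prod.case)
  show "Zv (\<lambda>k. if k = i then 1 else 0) (\<lambda>k. if k = j then 1 else 0) $$ (p, q) =
      (el i (du j) + el j (du i)) $$ (p, q)"
    unfolding L R by (cases c; cases "p = i"; cases "p = j"; cases "u = i"; cases "u = j") simp_all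
qed (auto simp: el_def)

text \<open>Take the orthonormal basis adapted to the flag as new basis of V_t and the dual basis on
  the dual space. This change of basis belongs to \<open>Pg\<close> and brings the quadratic form on
  V_t to the standard one.\<close>

lemma Levi_step:
  assumes \<gamma>: "\<gamma> \<in> lie_dual n Pg" and red: "reductive_type n Pg \<gamma>"
  obtains g F where "g \<in> Pg" "F \<in> sp" "\<gamma> = act g (gam F)"
    "\<And>i j. i < r \<Longrightarrow> j < r \<Longrightarrow> F $$ (du i, j) = (if i = j then 1 else 0)"
proof -
  obtain b where b: "\<And>k. k < r \<Longrightarrow> supp (lv k) (b k)"
    and on: "\<And>k k'. k < r \<Longrightarrow> k' < r \<Longrightarrow> \<gamma> (Zv (b k) (b k')) = (if k = k' then 2 else 0)"
    using flag_orthonormal_basis[OF \<gamma> red, of r] by auto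
  define e where "e j i = (if i = j then 1 else 0 :: complex)" for j i :: nat
  define X where "X = mat n n (\<lambda>(i, j). if i < r \<and> j < r then b j i else if i = j then 1 else 0)"
  \<comment> \<open>Orthonormality gives the inverse of \<open>X\<close> explicitly: the coordinates
    of a vector are its pairings with the \<open>b i\<close>, halved because the form takes the
    value 2 at each of them.\<close>
  define Y where "Y = mat n n (\<lambda>(i, j). if i < r \<and> j < r then \<gamma> (Zv (e j) (b i)) / 2 else if i = j then 1 else 0)"
  have M: "X \<in> M" "Y \<in> M" by (auto simp: X_def Y_def)
  have nr: "{..<n} \<inter> {k. k < r} = {..<r}" using r_le by auto
  have q_exp: "\<gamma> (Zv v w) = (\<Sum>k<r. v k * \<gamma> (Zv (e k) w))" for v w
  proof -
    have "\<gamma> (Zv (\<lambda>i. if i < m then v i else 0) w) = (\<Sum>k<m. v k * \<gamma> (Zv (e k) w))" for m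
    proof (induction m)
      case 0
      have e: "Zv (\<lambda>i. 0) w = 0 \<cdot>\<^sub>m Zv (\<lambda>i. 0) w" by (intro eq_matI) (auto simp: Zv_def)
      have "\<gamma> (Zv (\<lambda>i. 0) w) = 0"
        by (subst e) (simp add: dual_smult[OF \<gamma> Zv_pa])
      then show ?case by simp
    next
      case (Suc m)
      have "(\<lambda>i. if i < Suc m then v i else 0) = (\<lambda>i. (if i < m then v i else 0) + v m * e m i)"
        by (auto simp: e_def fun_eq_iff less_Suc_eq)
      then show ?case
        using Suc dual_add[OF \<gamma> Zv_pa pa_smult[OF Zv_pa]] dual_smult[OF \<gamma> Zv_pa] by (simp add: Zv_add Zv_smult)
    qed
    moreover have "Zv (\<lambda>i. if i < r then v i else 0) w = Zv v w"
      by (intro eq_matI) (auto simp: Zv_def)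
    ultimately show ?thesis by metis
  qed
  have YX: "Y * X = 1\<^sub>m n"
  proof (rule eq_matI)
    fix i j assume "i < dim_row (1\<^sub>m n :: complex mat)" "j < dim_col (1\<^sub>m n :: complex mat)"
    then have ij: "i < n" "j < n" by auto
    show "(Y * X) $$ (i, j) = 1\<^sub>m n $$ (i, j)"
    proof (cases "i < r")
      case True
      have "(Y * X) $$ (i, j) = (\<Sum>k<n. if k < r then (if j < r then b j k * \<gamma> (Zv (e k) (b i)) / 2 else 0) else 0)"
        unfolding mult_entry[OF M(2,1) ij] by (rule sum.cong) (use True ij in \<open>auto simp: X_def Y_def\<close>)
      also have "\<dots> = (if j < r then (\<Sum>k<r. b j k * \<gamma> (Zv (e k) (b i))) / 2 else 0)"
        by (simp add: sum.If_cases nr sum_divide_distrib)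
      also have "\<dots> = (if j < r then \<gamma> (Zv (b j) (b i)) / 2 else 0)" by (simp add: q_exp[of "b j"])
      finally show ?thesis using True ij on[of j i] by auto
    next
      case False
      have "(Y * X) $$ (i, j) = (\<Sum>k<n. if k = i then X $$ (i, j) else 0)"
        unfolding mult_entry[OF M(2,1) ij] by (rule sum.cong) (use False ij in \<open>auto simp: Y_def\<close>)
      then show ?thesis using False ij by (simp add: X_def)
    qed
  qed (use M in auto)
  have XY: "X * Y = 1\<^sub>m n" using mat_mult_left_right_inverse[OF M(2,1) YX] .
  have UTX: "UT X" unfolding UT_def
  proof (intro allI impI)
    fix i j assume ij: "i < n" "j < n" "lv j < lv i"
    have "b j i = 0" if "j < r" using b[OF that] ij(3) unfolding supp_def by (meson leD)
    then show "X $$ (i, j) = 0" using ij by (auto simp: X_def)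
  qed
  have UTY: "UT Y" by (rule UT_inverse[OF M XY UTX])
  define x where "x = X - 1\<^sub>m n"
  have xM: "x \<in> M" using M by (simp add: x_def)
  have Xx: "X = 1\<^sub>m n + x" using M by (auto simp: x_def intro!: eq_matI)
  have x0: "x $$ (i, j) = 0" if "i < n" "j < n" "\<not> (i < r \<and> j < r)" for i j
    using that by (auto simp: x_def X_def)
  have ax0: "adj x $$ (i, j) = 0" if "i < n" "j < n" "\<not> (n - r \<le> i \<and> n - r \<le> j)" for i j
  proof -
    have "\<not> (du j < r \<and> du i < r)" using that by auto
    then show ?thesis using that x0 by (simp add: adj_entry)
  qed
  have zero: "A * B = 0\<^sub>m n n" if AB: "A \<in> M" "B \<in> M"
    and AB0: "\<And>i k j. i < n \<Longrightarrow> k < n \<Longrightarrow> j < n \<Longrightarrow> A $$ (i, k) = 0 \<or> B $$ (k, j) = 0" for A B :: "complex mat"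
  proof (rule eq_matI)
    fix i j assume "i < dim_row (0\<^sub>m n n :: complex mat)" "j < dim_col (0\<^sub>m n n :: complex mat)"
    then have ij: "i < n" "j < n" by auto
    have "A $$ (i, k) * B $$ (k, j) = 0" if "k < n" for k using AB0[OF ij(1) that ij(2)] by auto
    then show "(A * B) $$ (i, j) = 0\<^sub>m n n $$ (i, j)"
      using ij mult_entry[OF AB ij] by (auto intro: sum.neutral)
  qed (use AB in auto)
  have dis: "\<not> (k < r \<and> n - r \<le> k)" for k using r_le by linarith
  have "x * adj x = 0\<^sub>m n n" by (rule zero) (use xM x0 ax0 dis in \<open>auto, blast\<close>)
  moreover have "adj x * x = 0\<^sub>m n n" by (rule zero) (use xM x0 ax0 dis in \<open>auto, blast\<close>)
  \<comment> \<open>\<open>X\<close> differs from 1 only in the first block and \<open>adj X\<close>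
    only in the last, so the cross terms vanish.\<close>
  ultimately have XaX: "X * adj X = adj X * X" 
    using xM unfolding Xx by (simp add: adj_add mult_M) (intro eq_matI, auto)
  \<comment> \<open>\<open>adj Y\<close> is the inverse of \<open>adj X\<close> and acts on the dual
    block only: it makes the product symplectic without disturbing the action of \<open>X\<close> on
    V_t.\<close>
  define g where "g = X * adj Y"
  have gM: "g \<in> M" using M by (simp add: g_def)
  have "adj g * g = Y * (adj X * X) * adj Y" using M by (simp add: g_def adj_mult adj_adj mult_M)
  also have "\<dots> = (Y * X) * adj (Y * X)" using M by (simp add: XaX[symmetric] adj_mult mult_M)
  finally have "adj g * g = 1\<^sub>m n" by (simp add: YX)
  then have gP: "g \<in> Pg" using M gM UTX UTY by (simp add: Pg_def Sp_def g_def UT_mult UT_adj)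
  have gS: "g \<in> Sp" using gP by (rule Pg_Sp)
  have conjZ: "conj_by g (Zv (e i) (e j)) = Zv (b i) (b j)" if ij: "i < r" "j < r" for i j
  proof -
    let ?Z = "Zv (e i) (e j)"
    define y where "y = Y - 1\<^sub>m n"
    have yM: "y \<in> M" using M by (simp add: y_def)
    have Yy: "Y = 1\<^sub>m n + y" using M by (auto simp: y_def intro!: eq_matI)
    have y0: "y $$ (i, j) = 0" if "i < n" "j < n" "\<not> (i < r \<and> j < r)" for i j
      using that by (auto simp: y_def Y_def)
    have ay0: "adj y $$ (i, j) = 0" if "i < n" "j < n" "\<not> (n - r \<le> i \<and> n - r \<le> j)" for i j
    proof -
      have "\<not> (du j < r \<and> du i < r)" using that by auto
      then show ?thesis using that y0 by (simp add: adj_entry)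
    qed
    have Z0: "?Z $$ (p, q) = 0" if "p < n" "q < n" "\<not> (p < r \<and> n - r \<le> q)" for p q
      using that Zv_corner[of "e i" "e j"] unfolding corner_def by blast
    have "adj y * ?Z = 0\<^sub>m n n" by (rule zero) (use yM ay0 Z0 dis in \<open>auto, blast\<close>)
    moreover have "?Z * y = 0\<^sub>m n n" by (rule zero) (use yM y0 Z0 dis in \<open>auto, blast\<close>)
    ultimately have "adj Y * ?Z = ?Z" "?Z * Y = ?Z" using yM unfolding Yy by (auto simp: adj_add mult_M)
    then have c: "conj_by g ?Z = X * ?Z * adj X"
    proof -
      have "conj_by g ?Z = X * adj Y * ?Z * (Y * adj X)"
        using M gS by (simp add: conj_by_Sp g_def adj_mult adj_adj)
      also have "\<dots> = X * (adj Y * ?Z) * Y * adj X" using M by (simp only: mult_M(1) M_closed adj_carrier Zv_M)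
      also have "\<dots> = X * (?Z * Y) * adj X"
        unfolding \<open>adj Y * ?Z = ?Z\<close> using M by (simp only: mult_M(1) M_closed adj_carrier Zv_M)
      finally show ?thesis unfolding \<open>?Z * Y = ?Z\<close> .
    qed
    have Zel: "?Z = el i (du j) + el j (du i)"
      using Zv_unit[OF ij] by (simp add: e_def[abs_def])
    have elX: "(X * el a c * adj X) $$ (p, q) = X $$ (p, a) * adj X $$ (c, q)"
      if "a < n" "c < n" "p < n" "q < n" for a c p q
    proof -
      have "(X * el a c) $$ (p, k) = (if k = c then X $$ (p, a) else 0)" if "k < n" for k
      proof -
        have "(X * el a c) $$ (p, k) = (\<Sum>m<n. if m = a then (if k = c then X $$ (p, a) else 0) else 0)"
          unfolding mult_entry[OF M(1) el_M \<open>p < n\<close> that]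
          by (rule sum.cong) (use \<open>k < n\<close> \<open>a < n\<close> in \<open>auto simp: el_def\<close>)
        then show ?thesis using \<open>a < n\<close> by simp
      qed
      note Xel = this
      have "(X * el a c * adj X) $$ (p, q) = (\<Sum>k<n. if k = c then X $$ (p, a) * adj X $$ (c, q) else 0)"
        unfolding mult_entry[OF M_closed(1)[OF M(1) el_M] adj_carrier that(3,4)]
        by (rule sum.cong) (use Xel in auto)
      then show ?thesis using that by simp
    qed
    show ?thesis
    proof (rule eq_matI)
      fix p q assume "p < dim_row (Zv (b i) (b j))" "q < dim_col (Zv (b i) (b j))"
      then have pq: "p < n" "q < n" by auto
      have ijn: "i < n" "j < n" "\<not> du i < l" "\<not> du j < l" using ij r_le by auto
      have "conj_by g ?Z $$ (p, q) = (X * el i (du j) * adj X + X * el j (du i) * adj X) $$ (p, q)"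
        using c M unfolding Zel by (simp add: mult_M)
      also have "\<dots> = X $$ (p, i) * adj X $$ (du j, q) + X $$ (p, j) * adj X $$ (du i, q)"
        using pq ijn M elX[of i "du j" p q] elX[of j "du i" p q] by (simp del: index_mult_mat(1))
      also have "\<dots> = - sg q * (X $$ (p, i) * X $$ (du q, j) + X $$ (p, j) * X $$ (du q, i))"
        using pq ijn by (simp add: adj_entry sg_def)
      also have "\<dots> = Zv (b i) (b j) $$ (p, q)"
      proof (cases "p < r \<and> n - r \<le> q")
        case True
        then have "\<not> q < l" "du q < r" using pq r_le by auto
        then show ?thesis using True pq ij ijn(1,2) by (simp add: X_def Zv_def sg_def)
      next
        case False
        have 1: "X $$ (p, k) = 0" if "\<not> p < r" "k < r" for k
          using that pq r_le by (auto simp: X_def)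
        have 2: "X $$ (du q, k) = 0" if "\<not> n - r \<le> q" "k < r" for k
          using that pq r_le by (auto simp: X_def)
        show ?thesis using False pq ij 1 2 by (cases "p < r") (auto simp: Zv_def)
      qed
      finally show "conj_by g ?Z $$ (p, q) = Zv (b i) (b j) $$ (p, q)" .
    qed (use conj_by_M[OF gS Zv_M] in auto)
  qed
  have aP: "adj g \<in> Pg" using gP by (rule Pg_adj)
  have "act (adj g) \<gamma> \<in> lie_dual n Pg" by (rule act_dual[OF aP \<gamma>])
  then obtain F where F: "F \<in> sp" "act (adj g) \<gamma> = gam F" using dual_rep by blast
  have FM: "F \<in> M" using F by (simp add: sp_M)
  have "\<gamma> = act g (gam F)"
    using act_act[OF gP aP] F(2) act_one[OF \<gamma>] Sp_adj_right[OF gS] by metis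
  moreover have "F $$ (du i, j) = (if i = j then 1 else 0)" if ij: "i < r" "j < r" for i j
  proof -
    have ijn: "i < n" "j < n" "i < l" "j < l" "\<not> du i < l" "\<not> du j < l" using ij r_le by auto
    have "gam F (Zv (e i) (e j)) = \<gamma> (Zv (b i) (b j))"
      using conjZ[OF ij] gP gM unfolding F(2)[symmetric] by (simp add: act_apply Zv_pa adj_adj)
    then have "tr (F * Zv (e i) (e j)) = (if i = j then 2 else 0)" using on ij by (simp add: gam_def Zv_pa)
    moreover have Zel: "Zv (e i) (e j) = el i (du j) + el j (du i)"
      using Zv_unit[OF ij] by (simp add: e_def[abs_def])
    moreover have "tr (F * (el i (du j) + el j (du i))) = F $$ (du j, i) + F $$ (du i, j)"
      using FM ijn by (simp add: mult_M tr_add[of _ n] tr_el)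
    moreover have "F $$ (du j, i) = F $$ (du i, j)"
    proof -
      have "adj F $$ (du j, i) = (- F) $$ (du j, i)" using F(1) by (simp add: sp_adj)
      then show ?thesis using ijn FM by (simp add: adj_entry sg_def)
    qed
    ultimately show ?thesis by (auto split: if_splits)
  qed
  ultimately show thesis using that gP F(1) by blast
qed

text \<open>Completing the square: as the block of \<open>F\<close> in the last rows and first
  columns is a permuted identity, an element of the unipotent radical can cancel the entries in the
  last rows and middle columns. The quadratic term of its exponential lies in the corner and does
  not reach these entries.\<close>

lemma Heisenberg_step:
  assumes F: "F \<in> sp" and F0: "\<And>i j. i < r \<Longrightarrow> j < r \<Longrightarrow> F $$ (du i, j) = (if i = j then 1 else 0)"
  obtains g F' where "g \<in> Pg" "F' \<in> sp" "gam F = act g (gam F')"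
    "\<And>i j. i < r \<Longrightarrow> j < r \<Longrightarrow> F' $$ (du i, j) = (if i = j then 1 else 0)"
    "\<And>i j. n - r \<le> i \<Longrightarrow> i < n \<Longrightarrow> r \<le> j \<Longrightarrow> j < n - r \<Longrightarrow> F' $$ (i, j) = 0"
    "\<And>i j. r \<le> i \<Longrightarrow> i < n - r \<Longrightarrow> j < r \<Longrightarrow> F' $$ (i, j) = 0"
proof -
  have FM: "F \<in> M" using F by (rule sp_M)
  have Fs: "sg i * sg j * F $$ (du j, du i) = - F $$ (i, j)" if "i < n" "j < n" for i j
    using sp_adj[OF F] that FM adj_entry[of i j F] by simp
  \<comment> \<open>For \<open>i < r\<close> the entry is chosen so that row \<open>du i\<close> of
    \<open>F * (1 + Y)\<close> vanishes in the middle columns. The second clause is its mirror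
    image, which puts \<open>Y\<close> into \<open>sp\<close>.\<close>
  define Y where "Y = mat n n (\<lambda>(i, j). if i < r \<and> r \<le> j \<and> j < n - r then - F $$ (du i, j)
    else if r \<le> i \<and> i < n - r \<and> n - r \<le> j then F $$ (i, du j) else 0)"
  have YM: "Y \<in> M" by (simp add: Y_def)
  have "adj Y = - Y"
  proof (rule eq_matI)
    fix i j assume "i < dim_row (- Y)" "j < dim_col (- Y)"
    then have ij: "i < n" "j < n" using YM by auto
    have eq: "r \<le> du k \<and> du k < n - r \<longleftrightarrow> r \<le> k \<and> k < n - r" "n - r \<le> du k \<longleftrightarrow> k < r" "du k < r \<longleftrightarrow> n - r \<le> k"
      if "k < n" for k using that r_le by auto
    show "adj Y $$ (i, j) = (- Y) $$ (i, j)"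
    proof (cases "i < r \<and> r \<le> j \<and> j < n - r")
      case True
      then have "sg i = 1" "sg (du i) = -1" using r_le ij by (auto simp: sg_def)
      then show ?thesis using True ij eq[of i] eq[of j] Fs[of "du i" j] r_le
        by (auto simp: adj_entry Y_def)
    next
      case 1: False
      show ?thesis
      proof (cases "r \<le> i \<and> i < n - r \<and> n - r \<le> j")
        case True
        then have "sg j = -1" "sg (du j) = 1" using r_le ij by (auto simp: sg_def)
        then show ?thesis using True ij eq[of i] eq[of j] Fs[of i "du j"] r_le
          by (auto simp: adj_entry Y_def)
      next
        case False
        have "Y $$ (i, j) = 0" using 1 False unfolding Y_def index_mat(1)[OF ij] prod.case by argo
        moreover have "Y $$ (du j, du i) = 0"
        proof -
          have d: "du j < n" "du i < n" using ij by auto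
          have "\<not> (du j < r \<and> r \<le> du i \<and> du i < n - r)" "\<not> (r \<le> du j \<and> du j < n - r \<and> n - r \<le> du i)"
            using 1 False eq[OF ij(1)] eq[OF ij(2)] by blast+
          then show ?thesis unfolding Y_def index_mat(1)[OF d] prod.case by argo
        qed
        ultimately show ?thesis using ij YM by (simp add: adj_entry)
      qed
    qed
  qed (use YM in auto)
  moreover have "UT Y" unfolding UT_def
  proof (intro allI impI)
    fix i j assume ij: "i < n" "j < n" "lv j < lv i"
    have "\<not> (i < r \<and> r \<le> j \<and> j < n - r)" "\<not> (r \<le> i \<and> i < n - r \<and> n - r \<le> j)"
      using ij lv_ne[of i j] lv_mid[of i] lv_last[of j] by auto
    then show "Y $$ (i, j) = 0" unfolding Y_def index_mat(1)[OF ij(1,2)] prod.case by argo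
  qed
  ultimately have YP: "Y \<in> pa" using YM by (simp add: pa_def sp_def)
  have col0: "Y $$ (i, j) = 0" if "i < n" "j < r" for i j using that r_le by (auto simp: Y_def)
  have row0: "Y $$ (i, j) = 0" if "n - r \<le> i" "i < n" "j < n" for i j using that r_le by (auto simp: Y_def)
  have mid0: "Y $$ (i, j) = 0" if "i < n" "j < n - r" "r \<le> i" for i j using that by (auto simp: Y_def)
  have sq: "(Y * Y) $$ (i, j) = 0" if ij: "i < n" "j < n" "\<not> (i < r \<and> n - r \<le> j)" for i j
  proof -
    have "Y $$ (i, k) * Y $$ (k, j) = 0" if "k < n" for k
      using ij that r_le by (auto simp: Y_def)
    then show ?thesis using mult_entry[OF YM YM ij(1,2)] by (auto intro: sum.neutral)
  qed
  have cube: "Y * (Y * Y) = 0\<^sub>m n n"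
  proof (rule eq_matI)
    fix i j assume "i < dim_row (0\<^sub>m n n :: complex mat)" "j < dim_col (0\<^sub>m n n :: complex mat)"
    then have ij: "i < n" "j < n" by auto
    have "Y $$ (i, k) * (Y * Y) $$ (k, j) = 0" if "k < n" for k
      using sq[of k j] col0[of i k] ij that by (cases "k < r") auto
    then show "(Y * (Y * Y)) $$ (i, j) = 0\<^sub>m n n $$ (i, j)"
      using ij mult_entry[of Y n "Y * Y" i j] YM by (auto intro: sum.neutral)
  qed (use YM in auto)
  define h where "h = ex Y"
  have hP: "h \<in> Pg" using ex_Pg[OF YP cube] by (simp add: h_def)
  have hS: "h \<in> Sp" using hP by (rule Pg_Sp)
  have hM: "h \<in> M" using hP by (rule Pg_M)
  define F' where "F' = conj_by (adj h) F"
  have F': "F' \<in> sp" unfolding F'_def by (rule conj_by_sp[OF Sp_adj[OF hS] F])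
  have F'M: "F' \<in> M" using F' by (rule sp_M)
  have gF: "gam F = act h (gam F')"
    using hP F'M FM hS by (simp add: act_gam F'_def conj_by_adj')
  have ah: "adj h = ex (- Y)" unfolding h_def by (rule ex_adj[OF pa_sp[OF YP]])
  \<comment> \<open>The last rows of \<open>adj h\<close> are those of the identity, so in the last
    rows only the right factor \<open>h\<close> changes \<open>F\<close>.\<close>
  have arow: "(adj h * A) $$ (i, j) = A $$ (i, j)" if "A \<in> M" "n - r \<le> i" "i < n" "j < n" for A i j
  proof -
    have "adj h $$ (i, k) = (if k = i then 1 else 0)" if "k < n" for k
      using that \<open>n - r \<le> i\<close> \<open>i < n\<close> YM row0[of i k] sq[of i k] r_le
      by (auto simp: ah ex_def mult_M simp del: index_mult_mat(1))
    then have "(adj h * A) $$ (i, j) = (\<Sum>k<n. if k = i then A $$ (i, j) else 0)"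
      unfolding mult_entry[OF adj_carrier that(1,3,4)] by (intro sum.cong) auto
    then show ?thesis using that by simp
  qed
  have F'eq: "F' $$ (i, j) = (F * h) $$ (i, j)" if "n - r \<le> i" "i < n" "j < n" for i j
    using arow[of "F * h" i j] that FM hM hS by (simp add: F'_def conj_by_Sp Sp_adj adj_adj mult_M)
  have hcol: "h $$ (k, j) = (if k = j then 1 else 0) + Y $$ (k, j)" if "k < n" "j < n - r" for k j
    using that YM sq[of k j] by (simp add: h_def ex_def del: index_mult_mat(1))
  have last_first: "F' $$ (du i, j) = (if i = j then 1 else 0)" if ij: "i < r" "j < r" for i j
  proof -
    have ijn: "i < n" "j < n" "j < n - r" "n - r \<le> du i" "du i < n" using ij r_le by auto
    have "(F * h) $$ (du i, j) = (\<Sum>k<n. if k = j then F $$ (du i, j) else 0)"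
      unfolding mult_entry[OF FM hM ijn(5,2)]
      by (rule sum.cong) (use hcol[OF _ ijn(3)] col0[OF _ ij(2)] in auto)
    then show ?thesis using F'eq[OF ijn(4,5,2)] F0[OF ij] ijn by simp
  qed
  have last_mid: "F' $$ (i, j) = 0" if ij: "n - r \<le> i" "i < n" "r \<le> j" "j < n - r" for i j
  proof -
    have jn: "j < n" and di: "du i < r" "du (du i) = i" using ij by auto
    have "(F * h) $$ (i, j) = (\<Sum>k<n. (if k = j then F $$ (i, j) else 0) + (if k = du i then - F $$ (i, j) else 0))"
      unfolding mult_entry[OF FM hM ij(2) jn]
    proof (rule sum.cong)
      fix k assume k: "k \<in> {..<n}"
      have "F $$ (i, k) * Y $$ (k, j) = (if k = du i then - F $$ (i, j) else 0)"
      proof (cases "k < r")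
        case True
        have "F $$ (i, k) = (if du i = k then 1 else 0)" using F0[OF di(1) True] di(2) by simp
        moreover have "Y $$ (du i, j) = - F $$ (i, j)" using ij di by (simp add: Y_def)
        ultimately show ?thesis by auto
      qed (use mid0[of k j] k ij di in auto)
      then show "F $$ (i, k) * h $$ (k, j) = (if k = j then F $$ (i, j) else 0) + (if k = du i then - F $$ (i, j) else 0)"
        using hcol[of k j] k ij by (auto simp: distrib_left)
    qed simp
    then show ?thesis using F'eq[OF ij(1,2) jn] jn ij by (simp add: sum.distrib)
  qed
  have mid_first: "F' $$ (i, j) = 0" if ij: "r \<le> i" "i < n - r" "j < r" for i j
  proof -
    have ijn: "i < n" "j < n" using ij r_le by auto
    have "F' $$ (du j, du i) = 0" using ij r_le by (intro last_mid) auto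
    moreover have "adj F' $$ (i, j) = (- F') $$ (i, j)" using F' by (simp add: sp_adj)
    ultimately show ?thesis using ijn F'M by (simp add: adj_entry)
  qed
  show thesis by (rule that[OF hP F' gF last_first last_mid mid_first])
qed

text \<open>The block of \<open>F\<close> on V_t is split into \<open>d\<close>, the skew part of
  its diagonal blocks, which becomes \<open>D\<close>, and a symmetric \<open>s\<close>. Conjugation
  of \<open>F0 + D\<close> by \<open>1 - Z\<close> adds \<open>- Z * F0\<close> to that block, and a
  corner element \<open>Z\<close> in \<open>sp\<close> can produce any symmetric \<open>s\<close> in
  this way.\<close>

lemma corner_step:
  assumes F: "F \<in> sp"
    and F1: "\<And>i j. i < r \<Longrightarrow> j < r \<Longrightarrow> F $$ (du i, j) = (if i = j then 1 else 0)"
    and F2: "\<And>i j. n - r \<le> i \<Longrightarrow> i < n \<Longrightarrow> r \<le> j \<Longrightarrow> j < n - r \<Longrightarrow> F $$ (i, j) = 0"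
    and F3: "\<And>i j. r \<le> i \<Longrightarrow> i < n - r \<Longrightarrow> j < r \<Longrightarrow> F $$ (i, j) = 0"
  obtains g D where "g \<in> Pg" "D \<in> La" "gam F = act g (gam (F0 + D))"
proof -
  have FM: "F \<in> M" using F by (rule sp_M)
  have Fs: "F $$ (i, j) = - (sg i * sg j * F $$ (du j, du i))" if "i < n" "j < n" for i j
  proof -
    have "- F $$ (i, j) = sg i * sg j * F $$ (du j, du i)" using sp_adj[OF F] that FM adj_entry[of i j F] by simp
    then show ?thesis by (metis minus_minus)
  qed
  define d where "d i j = (if lv i = lv j then (F $$ (i, j) - F $$ (j, i)) / 2 else 0)" for i j
  \<comment> \<open>The form sees only entries with \<open>lv j \<le> lv i\<close>; above the
    diagonal blocks \<open>s\<close> is therefore filled in by symmetry instead of following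
    \<open>F\<close>.\<close>
  define s where "s i j = (if lv i = lv j then (F $$ (i, j) + F $$ (j, i)) / 2
    else if lv j < lv i then F $$ (i, j) else F $$ (j, i))" for i j
  have ds: "d i j = - d j i" and ss: "s i j = s j i" for i j by (auto simp: d_def s_def field_simps)
  define D where "D = mat n n (\<lambda>(i, j). if i < r \<and> j < r then d i j
    else if n - r \<le> i \<and> n - r \<le> j then d (du i) (du j)
    else if r \<le> i \<and> i < n - r \<and> r \<le> j \<and> j < n - r then F $$ (i, j) else 0)"
  define Z where "Z = mat n n (\<lambda>(i, j). if i < r \<and> n - r \<le> j then - s i (du j) else 0)"
  have DM: "D \<in> M" and ZM: "Z \<in> M" by (auto simp: D_def Z_def)
  have eq: "r \<le> du k \<and> du k < n - r \<longleftrightarrow> r \<le> k \<and> k < n - r" "n - r \<le> du k \<longleftrightarrow> k < r" "du k < r \<longleftrightarrow> n - r \<le> k"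
      if "k < n" for k using that r_le by auto
  have dis: "\<not> (k < r \<and> n - r \<le> k)" for k using r_le by linarith
  have "adj D = - D"
  proof (rule eq_matI)
    fix i j assume "i < dim_row (- D)" "j < dim_col (- D)"
    then have ij: "i < n" "j < n" using DM by auto
    consider "i < r \<and> j < r" | "n - r \<le> i \<and> n - r \<le> j" | "r \<le> i \<and> i < n - r \<and> r \<le> j \<and> j < n - r"
      | "\<not> (i < r \<and> j < r)" "\<not> (n - r \<le> i \<and> n - r \<le> j)" "\<not> (r \<le> i \<and> i < n - r \<and> r \<le> j \<and> j < n - r)" by blast
    then show "adj D $$ (i, j) = (- D) $$ (i, j)"
    proof cases
      case 1
      then have "sg i = 1" "sg j = 1" using r_le by (auto simp: sg_def)
      then show ?thesis using 1 ij eq[of i] eq[of j] dis[of "du i"] ds[of j i] by (auto simp: adj_entry D_def)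
    next
      case 2
      then have "sg i = -1" "sg j = -1" using r_le ij by (auto simp: sg_def)
      then show ?thesis using 2 ij eq[of i] eq[of j] dis[of i] ds[of "du j" "du i"] by (auto simp: adj_entry D_def)
    next
      case 3
      then show ?thesis using ij eq[of i] eq[of j] Fs[OF ij] by (auto simp: adj_entry D_def)
    next
      case 4
      have "D $$ (i, j) = 0" using 4 unfolding D_def index_mat(1)[OF ij] prod.case by argo
      moreover have "D $$ (du j, du i) = 0"
      proof -
        have d: "du j < n" "du i < n" using ij by auto
        have "\<not> (du j < r \<and> du i < r)" "\<not> (n - r \<le> du j \<and> n - r \<le> du i)"
          "\<not> (r \<le> du j \<and> du j < n - r \<and> r \<le> du i \<and> du i < n - r)"
          using 4 eq[OF ij(1)] eq[OF ij(2)] by blast+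
        then show ?thesis unfolding D_def index_mat(1)[OF d] prod.case by argo
      qed
      ultimately show ?thesis using ij DM by (simp add: adj_entry)
    qed
  qed (use DM in auto)
  moreover have BD: "BD D" unfolding BD_def
  proof (intro allI impI)
    fix i j assume ij: "i < n" "j < n" "lv i \<noteq> lv j"
    then show "D $$ (i, j) = 0" using lv_du_eq[of i j] lv_mid[of i] lv_mid[of j] by (auto simp: D_def d_def)
  qed
  moreover have "D $$ (du i, du j) = D $$ (i, j)" if ij: "i < r" "j < r" for i j
    using ij r_le eq[of i] eq[of j] dis[of "du i"] by (auto simp: D_def)
  ultimately have DL: "D \<in> La" using DM BD_UT[OF BD] by (simp add: La_def pa_def sp_def)
  have Zc: "corner Z" by (simp add: corner_def Z_def)
  have "adj Z = - Z"
  proof (rule eq_matI)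
    fix i j assume "i < dim_row (- Z)" "j < dim_col (- Z)"
    then have ij: "i < n" "j < n" using ZM by auto
    show "adj Z $$ (i, j) = (- Z) $$ (i, j)"
    proof (cases "i < r \<and> n - r \<le> j")
      case True
      then have "sg i = 1" "sg j = -1" using r_le ij by (auto simp: sg_def)
      then show ?thesis using True ij eq[of i] eq[of j] ss[of i "du j"] by (auto simp: adj_entry Z_def)
    qed (use ij eq[of i] eq[of j] in \<open>auto simp: adj_entry Z_def\<close>)
  qed (use ZM in auto)
  then have Zsp: "Z \<in> sp" using ZM by (simp add: sp_def)
  then have ZP: "Z \<in> pa" using corner_UT[OF Zc] by (simp add: pa_def)
  define h where "h = ex Z"
  have hP: "h \<in> Pg" unfolding h_def using ZM Zc by (intro ex_Pg ZP) (simp add: corner_mult_zero)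
  have hS: "h \<in> Sp" using hP by (rule Pg_Sp)
  define C where "C = conj_by (adj h) (F0 + D)"
  have FDsp: "F0 + D \<in> sp" using DL by (simp add: sp_add F0_sp La_sp)
  have Csp: "C \<in> sp" unfolding C_def by (rule conj_by_sp[OF Sp_adj[OF hS] FDsp])
  have CM: "C \<in> M" using Csp by (rule sp_M)
  define E where "E = F0 + D"
  have EM: "E \<in> M" using DM by (simp add: E_def)
  have h1: "h = 1\<^sub>m n + Z" unfolding h_def by (rule corner_ex[OF ZM Zc])
  have ah: "adj h = 1\<^sub>m n - Z" using ZM Zsp unfolding h1 by (auto simp: adj_add sp_adj intro!: eq_matI)
  have C_eq: "C = (E - Z * E) + (E - Z * E) * Z"
  proof -
    have "C = adj h * E * h" using hS by (simp add: C_def conj_by_Sp Sp_adj adj_adj Sp_M E_def)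
    also have "\<dots> = (1\<^sub>m n - Z) * E * (1\<^sub>m n + Z)" by (subst ah, subst h1, rule refl)
    also have "\<dots> = (E - Z * E) + (E - Z * E) * Z" using EM ZM by (simp add: mult_M)
    finally show ?thesis .
  qed
  have main: "C $$ (i, j) = F $$ (i, j)" if ij: "i < n" "j < n" "lv j \<le> lv i" and j: "j < n - r" for i j
  proof -
    have "((E - Z * E) * Z) $$ (i, j) = 0"
    proof -
      have "(E - Z * E) $$ (i, k) * Z $$ (k, j) = 0" if "k < n" for k
        using Zc that j ij dis[of j] by (auto simp: corner_def)
      then show ?thesis using mult_entry[of "E - Z * E" n Z i j] EM ZM ij by (auto intro: sum.neutral)
    qed
    then have C1: "C $$ (i, j) = E $$ (i, j) - (Z * E) $$ (i, j)"
      using ij EM ZM by (simp add: C_eq del: index_mult_mat(1))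
    have Eij: "E $$ (i, j) = F0 $$ (i, j) + D $$ (i, j)" using ij DM by (simp add: E_def)
    consider (a) "i < r" "j < r" | (b) "r \<le> i" "i < n - r" | (c) "n - r \<le> i"
      using lv_ne[of i j] ij by (cases "i < r"; cases "j < r"; cases "i < n - r") auto
    then show ?thesis
    proof cases
      case a
      have "(Z * E) $$ (i, j) = (\<Sum>k<n. if k = du j then Z $$ (i, du j) else 0)"
        unfolding mult_entry[OF ZM EM ij(1,2)]
      proof (rule sum.cong)
        fix k assume k: "k \<in> {..<n}"
        show "Z $$ (i, k) * E $$ (k, j) = (if k = du j then Z $$ (i, du j) else 0)"
        proof (cases "n - r \<le> k")
          case True
          have "D $$ (k, j) = 0" using True a k j dis[of k] dis[of j] ij by (auto simp: D_def)
          then show ?thesis using a k ij DM by (auto simp: E_def F0_def)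
        next
          case False
          then have "k \<noteq> du j" using a r_le by auto
          then show ?thesis using False k ij by (auto simp: Z_def)
        qed
      qed simp
      then have "(Z * E) $$ (i, j) = - s i j" using ij a eq[of j] by (simp add: Z_def)
      moreover have "F0 $$ (i, j) = 0" using a ij r_le by (auto simp: F0_def)
      moreover have "D $$ (i, j) = d i j" using a ij by (simp add: D_def)
      ultimately show ?thesis using C1 Eij ij(3) by (auto simp: d_def s_def field_simps)
    next
      case b
      have "(Z * E) $$ (i, j) = 0"
      proof -
        have "Z $$ (i, k) * E $$ (k, j) = 0" if "k < n" for k using b ij that by (simp add: Z_def)
        then show ?thesis using mult_entry[OF ZM EM ij(1,2)] by (auto intro: sum.neutral)
      qed
      moreover have "F0 $$ (i, j) = 0" using b ij r_le by (auto simp: F0_def)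
      moreover have "D $$ (i, j) = F $$ (i, j)"
        using b ij j F3[of i j] by (cases "j < r") (auto simp: D_def)
      ultimately show ?thesis using C1 Eij by simp
    next
      case c
      have ir: "\<not> i < r" using c dis[of i] by blast
      have "(Z * E) $$ (i, j) = 0"
      proof -
        have "Z $$ (i, k) * E $$ (k, j) = 0" if "k < n" for k using ir ij that by (simp add: Z_def)
        then show ?thesis using mult_entry[OF ZM EM ij(1,2)] by (auto intro: sum.neutral)
      qed
      moreover have "D $$ (i, j) = 0" using c ir ij j by (auto simp: D_def)
      moreover have "F0 $$ (i, j) = F $$ (i, j)"
      proof (cases "j < r")
        case True
        have "F $$ (du (du i), j) = (if du i = j then 1 else 0)" using c ij True by (intro F1) auto
        then show ?thesis using True ij by (auto simp: F0_def)
      next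
        case False
        then show ?thesis using F2[OF c ij(1) _ j] ij by (simp add: F0_def)
      qed
      ultimately show ?thesis using C1 Eij by simp
    qed
  qed
  have "gam F = gam C"
  proof (rule gam_eqI[OF F Csp])
    fix i j assume ij: "i < n" "j < n" "lv j \<le> lv i"
    show "F $$ (i, j) = C $$ (i, j)"
    proof (cases "j < n - r")
      case True
      then show ?thesis using main ij by simp
    next
      case False
      then have "t < lv i" using lv_last[of j] ij by simp
      then have i: "n - r \<le> i" using lv_last_iff ij by simp
      \<comment> \<open>Both indices lie in the last block here; skewness of \<open>C\<close> and
        \<open>F\<close> moves the entry to the first block, which \<open>main\<close>
        covers.\<close>
      have Cs: "C $$ (i, j) = - (sg i * sg j * C $$ (du j, du i))"
      proof -
        have "- C $$ (i, j) = sg i * sg j * C $$ (du j, du i)" using sp_adj[OF Csp] ij CM adj_entry[of i j C] by simp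
        then show ?thesis by (metis minus_minus)
      qed
      have "C $$ (du j, du i) = F $$ (du j, du i)"
      proof (rule main)
        show "lv (du i) \<le> lv (du j)" using lv_du[OF ij(1)] lv_du[OF ij(2)] ij(3) by linarith
        show "du i < n - r" using i ij r_le by linarith
      qed (use ij in auto)
      then show ?thesis using Cs Fs[OF ij(1,2)] by simp
    qed
  qed
  also have "\<dots> = act (adj h) (gam (F0 + D))"
    using hP FDsp by (simp add: act_gam Pg_adj sp_M C_def)
  finally show thesis using that Pg_adj[OF hP] DL by blast
qed

theorem normal_form:
  assumes \<gamma>: "\<gamma> \<in> lie_dual n Pg" and red: "reductive_type n Pg \<gamma>"
  obtains g D where "g \<in> Pg" "D \<in> La" "\<gamma> = act g (gam (F0 + D))"
proof -
  show thesis
  proof (rule Levi_step[OF \<gamma> red])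
    fix g F assume 1: "g \<in> Pg" "F \<in> sp" "\<gamma> = act g (gam F)"
      and F1: "\<And>i j. i < r \<Longrightarrow> j < r \<Longrightarrow> F $$ (du i, j) = (if i = j then 1 else 0)"
    show thesis
    proof (rule Heisenberg_step[OF 1(2)])
      show "\<And>i j. i < r \<Longrightarrow> j < r \<Longrightarrow> F $$ (du i, j) = (if i = j then 1 else 0)" by (rule F1)
    next
      fix h F' assume 2: "h \<in> Pg" "F' \<in> sp" "gam F = act h (gam F')"
        and F2: "\<And>i j. i < r \<Longrightarrow> j < r \<Longrightarrow> F' $$ (du i, j) = (if i = j then 1 else 0)"
          "\<And>i j. n - r \<le> i \<Longrightarrow> i < n \<Longrightarrow> r \<le> j \<Longrightarrow> j < n - r \<Longrightarrow> F' $$ (i, j) = 0"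
          "\<And>i j. r \<le> i \<Longrightarrow> i < n - r \<Longrightarrow> j < r \<Longrightarrow> F' $$ (i, j) = 0"
      show thesis
      proof (rule corner_step[OF 2(2)])
        show "\<And>i j. i < r \<Longrightarrow> j < r \<Longrightarrow> F' $$ (du i, j) = (if i = j then 1 else 0)" by (rule F2(1))
        show "\<And>i j. n - r \<le> i \<Longrightarrow> i < n \<Longrightarrow> r \<le> j \<Longrightarrow> j < n - r \<Longrightarrow> F' $$ (i, j) = 0" by (rule F2(2))
        show "\<And>i j. r \<le> i \<Longrightarrow> i < n - r \<Longrightarrow> j < r \<Longrightarrow> F' $$ (i, j) = 0" by (rule F2(3))
      next
        fix k D assume 3: "k \<in> Pg" "D \<in> La" "gam F' = act k (gam (F0 + D))"
        have "\<gamma> = act (g * (h * k)) (gam (F0 + D))"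
          unfolding 1(3) 2(3) 3(3) act_act[OF 2(1) 3(1)] act_act[OF 1(1) Pg_mult[OF 2(1) 3(1)]] ..
        then show thesis using that 1 2 3 Pg_mult by blast
      qed
    qed
  qed
qed

end

section \<open>Vanishing power traces\<close>

text \<open>Choose a polynomial that vanishes at 0 and at every value other than \<open>d i\<close>.
  Having no constant term, its sum over all \<open>d j\<close> is a combination of vanishing power
  sums; but this sum is also the multiplicity of \<open>d i\<close> times a nonzero value.\<close>

lemma power_sums_zero:
  fixes d :: "nat \<Rightarrow> complex"
  assumes ps: "\<And>k. 1 \<le> k \<Longrightarrow> (\<Sum>i<m. d i ^ k) = 0" and i: "i < m"
  shows "d i = 0"
proof (rule ccontr)
  assume nz: "d i \<noteq> 0"
  define S where "S = d ` {..<m} - {d i}"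
  have fin: "finite S" by (simp add: S_def)
  define p where "p = [:0, 1:] * (\<Prod>a\<in>S. [:- a, 1:])"
  have p_eval: "poly p x = x * (\<Prod>a\<in>S. x - a)" for x by (simp add: p_def poly_prod)
  have "coeff p 0 = 0" by (simp add: p_def coeff_mult)
  have "(\<Sum>j<m. poly p (d j)) = (\<Sum>j<m. \<Sum>k\<le>degree p. coeff p k * d j ^ k)"
    by (simp add: poly_altdef)
  also have "\<dots> = (\<Sum>k\<le>degree p. coeff p k * (\<Sum>j<m. d j ^ k))"
    by (subst sum.swap) (simp add: sum_distrib_left)
  also have "\<dots> = 0"
  proof (rule sum.neutral, rule)
    fix k show "coeff p k * (\<Sum>j<m. d j ^ k) = 0"
      using ps[of k] \<open>coeff p 0 = 0\<close> by (cases "k = 0") auto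
  qed
  finally have 0: "(\<Sum>j<m. poly p (d j)) = 0" .
  have "poly p (d j) = (if d j = d i then poly p (d i) else 0)" if "j < m" for j
    using that fin by (auto simp: p_eval S_def)
  then have "(\<Sum>j<m. poly p (d j)) = (\<Sum>j<m. if d j = d i then poly p (d i) else 0)" by simp
  also have "\<dots> = of_nat (card {j \<in> {..<m}. d j = d i}) * poly p (d i)"
    by (simp add: sum.If_cases Int_def)
  finally have "of_nat (card {j \<in> {..<m}. d j = d i}) * poly p (d i) = 0" using 0 by simp
  moreover have "card {j \<in> {..<m}. d j = d i} \<noteq> 0" using i by auto
  moreover have "poly p (d i) \<noteq> 0" using nz fin by (auto simp: p_eval S_def)
  ultimately show False by simp
qed

lemma upper_triangular_mult:
  assumes A: "A \<in> carrier_mat m m" "B \<in> carrier_mat m m"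
    and ut: "\<And>i j. i < m \<Longrightarrow> j < i \<Longrightarrow> A $$ (i, j) = (0::complex)" "\<And>i j. i < m \<Longrightarrow> j < i \<Longrightarrow> B $$ (i, j) = 0"
  shows "\<And>i j. i < m \<Longrightarrow> j < i \<Longrightarrow> (A * B) $$ (i, j) = 0"
    and "\<And>i. i < m \<Longrightarrow> (A * B) $$ (i, i) = A $$ (i, i) * B $$ (i, i)"
proof -
  fix i j assume ij: "i < m" "j < i"
  have "A $$ (i, k) * B $$ (k, j) = 0" if "k < m" for k
    using ut(1)[of i k] ut(2)[of k j] ij that by (cases "k < i") auto
  then show "(A * B) $$ (i, j) = 0" using mult_entry[OF A, of i j] ij by (auto intro: sum.neutral)
next
  fix i assume i: "i < m"
  have "(A * B) $$ (i, i) = (\<Sum>k<m. if k = i then A $$ (i, i) * B $$ (i, i) else 0)"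
    unfolding mult_entry[OF A i i]
  proof (rule sum.cong)
    fix k assume "k \<in> {..<m}"
    then show "A $$ (i, k) * B $$ (k, i) = (if k = i then A $$ (i, i) * B $$ (i, i) else 0)"
      using ut(1)[of i k] ut(2)[of k i] i by (cases "k < i"; cases "k = i") auto
  qed simp
  then show "(A * B) $$ (i, i) = A $$ (i, i) * B $$ (i, i)" using i by simp
qed

text \<open>After triangularisation the diagonal has vanishing power sums, hence is zero; each
  further power of a strictly triangular matrix then moves the support one diagonal up.\<close>

lemma trace_powers_nilpotent:
  fixes A :: "complex mat"
  assumes A: "A \<in> carrier_mat m m" and trz: "\<And>k. 1 \<le> k \<Longrightarrow> tr (A ^\<^sub>m k) = 0"
  shows "A ^\<^sub>m m = 0\<^sub>m m m"
proof -
  obtain es where "char_poly A = (\<Prod>a\<leftarrow>es. [:- a, 1:])" using char_poly_factorized[OF A] by blast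
  then obtain B where B: "B \<in> carrier_mat m m" "upper_triangular B" "similar_mat A B"
    using schur_decomposition_exists[OF A] by blast
  obtain P Q where wit: "similar_mat_wit A B P Q" using B(3) unfolding similar_mat_def by blast
  note w = similar_mat_witD2[OF A wit]
  note PQ = w(6,7,2)
  have Bk: "B ^\<^sub>m k \<in> carrier_mat m m" for k using B by simp
  have pw: "A ^\<^sub>m k = P * B ^\<^sub>m k * Q" for k
    by (rule similar_mat_witD2(3)[OF pow_carrier_mat[OF A] similar_mat_wit_pow[OF wit]])
  have ut: "(B ^\<^sub>m k) $$ (i, j) = 0" if "i < m" "j < i" for i j k
    using that
  proof (induction k arbitrary: i j)
    case (Suc k)
    show ?case unfolding pow_mat.simps
      by (rule upper_triangular_mult(1)[OF Bk B(1)]) (use Suc B in auto)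
  qed (use B in auto)
  have dg: "(B ^\<^sub>m k) $$ (i, i) = (B $$ (i, i)) ^ k" if "i < m" for i k
  proof (induction k)
    case (Suc k)
    have "(B ^\<^sub>m k * B) $$ (i, i) = (B ^\<^sub>m k) $$ (i, i) * B $$ (i, i)"
      by (rule upper_triangular_mult(2)[OF Bk B(1)]) (use ut B that in auto)
    then show ?case using Suc by (simp add: mult.commute)
  qed (use that B in auto)
  have trk: "tr (A ^\<^sub>m k) = (\<Sum>i<m. B $$ (i, i) ^ k)" for k
  proof -
    have "tr (A ^\<^sub>m k) = tr (P * (B ^\<^sub>m k * Q))" using PQ Bk[of k] by (simp add: pw assoc_mult_mat[of _ m m _ m _ m])
    also have "\<dots> = tr (B ^\<^sub>m k * Q * P)" using PQ Bk[of k] by (intro tr_comm[of _ m]) auto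
    also have "B ^\<^sub>m k * Q * P = B ^\<^sub>m k"
      using PQ right_mult_one_mat[OF Bk[of k]] Bk[of k] by (simp add: assoc_mult_mat[of _ m m _ m _ m])
    finally show ?thesis using tr_carrier[OF Bk[of k]] dg by simp
  qed
  have d0: "B $$ (i, i) = 0" if "i < m" for i
  proof (rule power_sums_zero[OF _ that])
    fix k :: nat assume "1 \<le> k"
    then show "(\<Sum>i<m. B $$ (i, i) ^ k) = 0" using trz[of k] trk[of k] by simp
  qed
  have strict: "(B ^\<^sub>m k) $$ (i, j) = 0" if "i < m" "j < m" "j < i + k" for i j k
    using that
  proof (induction k arbitrary: j)
    case 0
    then show ?case using B by auto
  next
    case (Suc k)
    have "(B ^\<^sub>m k) $$ (i, p) * B $$ (p, j) = 0" if p: "p < m" for p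
    proof (cases "p < i + k")
      case False
      then have "j \<le> p" using Suc.prems by simp
      then have "B $$ (p, j) = 0" using d0[OF p] B(1,2) p unfolding upper_triangular_def by (cases "j = p") auto
      then show ?thesis by simp
    qed (use Suc.IH Suc.prems p in auto)
    then show ?case using mult_entry[OF Bk[of k] B(1) Suc.prems(1,2)] by (auto intro: sum.neutral)
  qed
  have "B ^\<^sub>m m = 0\<^sub>m m m" using Bk[of m] strict by (intro eq_matI) auto
  then show ?thesis using pw[of m] PQ by simp
qed

section \<open>Linear forms of reductive and nilpotent type\<close>

context levelled begin

section \<open>Powers of elements of \<open>La\<close>\<close>

lemma pow_M [simp]: "A \<in> M \<Longrightarrow> A ^\<^sub>m k \<in> M" by simp

lemma pow_commute: assumes "A \<in> M" "B \<in> M" "A * B = B * A" shows "A ^\<^sub>m k * B = B * A ^\<^sub>m k"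
proof (induction k)
  case (Suc k)
  have "A ^\<^sub>m Suc k * B = A ^\<^sub>m k * (B * A)" using assms by (simp add: mult_M)
  also have "\<dots> = (A ^\<^sub>m k * B) * A" using assms by (simp add: mult_M)
  also have "\<dots> = B * A ^\<^sub>m Suc k" using Suc assms by (simp add: mult_M)
  finally show ?case .
qed (use assms in auto)

lemma pow_add: assumes "A \<in> M" shows "A ^\<^sub>m (j + k) = A ^\<^sub>m j * A ^\<^sub>m k"
  using assms by (induction k) (auto simp: mult_M)

lemma pow_mult: assumes "A \<in> M" shows "(A ^\<^sub>m j) ^\<^sub>m k = A ^\<^sub>m (j * k)"
  using assms by (induction k) (auto simp: pow_add[symmetric] add.commute)

text \<open>The adjoint of the k-th power of \<open>D\<close> is (-1)^k times that power, so odd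
  powers stay skew.\<close>

lemma La_odd_power: assumes "D \<in> La" shows "D ^\<^sub>m (2 * k + 1) \<in> La"
proof (induction k)
  case 0
  then show ?case using assms La_M[OF assms] by simp
next
  case (Suc k)
  define X where "X = D ^\<^sub>m (2 * k + 1)"
  have DM: "D \<in> M" and XM: "X \<in> M" using La_M[OF assms] by (auto simp: X_def simp del: pow_mat.simps)
  have X: "X \<in> sp" "BD X" "F0 * X = X * F0" using Suc by (auto simp: X_def La_iff)
  have D: "D \<in> sp" "BD D" "F0 * D = D * F0" using assms by (auto simp: La_iff)
  have XD: "X * D = D * X" unfolding X_def by (rule pow_commute[OF DM DM refl])
  have eq: "D ^\<^sub>m (2 * Suc k + 1) = X * D * D" using DM by (simp add: X_def mult_M)
  have "adj (X * D * D) = - (D * (D * X))" using X D DM XM by (simp add: adj_mult sp_adj mult_M)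
  also have "D * (D * X) = X * D * D"   proof -
    have "D * (D * X) = D * (X * D)" unfolding XD ..
    also have "\<dots> = (D * X) * D" using DM XM by (simp only: mult_M(1))
    finally show ?thesis unfolding XD .
  qed
  finally have "X * D * D \<in> sp" using DM XM by (simp add: sp_def)
  moreover have "BD (X * D * D)" using X D DM XM by (simp add: BD_mult)
  moreover have "F0 * (X * D * D) = X * D * D * F0"
  proof -
    have "F0 * (X * D * D) = (F0 * X) * D * D" using DM XM by (simp add: mult_M)
    also have "\<dots> = X * (F0 * D) * D" using DM XM by (simp add: X(3) mult_M)
    also have "\<dots> = X * D * (F0 * D)" using DM XM by (simp add: D(3) mult_M)
    also have "\<dots> = X * D * D * F0" using DM XM by (simp add: D(3) mult_M)
    finally show ?thesis .
  qed
  ultimately show ?case unfolding eq by (simp add: La_iff)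
qed

lemma tr_F0_BD: assumes "X \<in> M" "BD X" shows "tr (F0 * X) = 0"
proof -
  have "F0 $$ (i, k) * X $$ (k, i) = 0" if "i < n" "k < n" for i k
  proof (cases "k < r \<and> i = du k")
    case True
    then have "lv k < lv i" using that r_le by (intro lv_ne) auto
    then show ?thesis using that assms(2) by (simp add: BD_def)
  qed (use that in \<open>auto simp: F0_def\<close>)
  then show ?thesis unfolding tr_mult[OF F0_M assms(1)] by (intro sum.neutral ballI) auto
qed

text \<open>An odd power \<open>X\<close> of \<open>D\<close> commutes with \<open>F0 + D\<close>
  and so lies in the Lie stabiliser; the form takes the value \<open>tr (D * X)\<close> there,
  because \<open>F0\<close> has no entry in the diagonal blocks. Only traces of even powers are
  reached, hence the trace criterion is applied to the square of \<open>D\<close>.\<close>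

lemma nilpotent_type_Levi:
  assumes D: "D \<in> La" and nil: "nilpotent_type n Pg (gam (F0 + D))"
  obtains m where "D ^\<^sub>m m = 0\<^sub>m n n"
proof -
  have DM: "D \<in> M" using La_M[OF D] .
  have "tr (D ^\<^sub>m (2 * k + 2)) = 0" for k
  proof -
    define X where "X = D ^\<^sub>m (2 * k + 1)"
    have XL: "X \<in> La" unfolding X_def by (rule La_odd_power[OF D])
    have XM: "X \<in> M" using La_M[OF XL] .
    have XD: "X * D = D * X" unfolding X_def by (rule pow_commute[OF DM DM refl])
    have comm: "(F0 + D) * X = X * (F0 + D)" using DM XM XD La_F0[OF XL] by (simp add: mult_M)
    have "gam (F0 + D) (X * Y - Y * X) = 0" if Y: "Y \<in> pa" for Y
    proof -
      have YM: "Y \<in> M" using pa_M[OF Y] .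
      have FM: "F0 + D \<in> M" using DM by simp
      have "tr ((F0 + D) * (X * Y - Y * X)) = tr (((F0 + D) * X) * Y) - tr (((F0 + D) * Y) * X)"
        using FM XM YM by (simp add: mult_M(1,4) tr_minus[of _ n] del: M_closed(2) )
      also have "tr (((F0 + D) * Y) * X) = tr (X * ((F0 + D) * Y))" using FM XM YM by (intro tr_comm) auto
      also have "X * ((F0 + D) * Y) = ((F0 + D) * X) * Y" unfolding comm using FM XM YM by (simp add: mult_M(1))
      finally show ?thesis using bracket_pa[OF La_pa[OF XL] Y] by (simp add: gam_def)
    qed
    then have "X \<in> lie_stab n Pg (gam (F0 + D))" using La_pa[OF XL] by (simp add: lie_stab_Pg)
    then have "tr ((F0 + D) * X) = 0" using nil La_pa[OF XL] by (auto simp: nilpotent_type_def gam_def)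
    then have "tr (D * X) = 0"
      using DM XM tr_F0_BD[OF XM La_BD[OF XL]] by (simp add: mult_M tr_add[of _ n])
    moreover have "D ^\<^sub>m (2 * k + 2) = X * D" by (simp add: X_def)
    ultimately show ?thesis using XD by simp
  qed
  then have z: "tr (D ^\<^sub>m (2 * Suc k)) = 0" for k by simp
  have "(D ^\<^sub>m 2) ^\<^sub>m n = 0\<^sub>m n n"
  proof (rule trace_powers_nilpotent)
    fix k :: nat assume "1 \<le> k"
    then obtain k' where "k = Suc k'" by (cases k) auto
    then show "tr ((D ^\<^sub>m 2) ^\<^sub>m k) = 0" using z[of k'] pow_mult[OF DM, of 2 k] by simp
  qed (use DM in auto)
  then show thesis using that pow_mult[OF DM, of 2 n] by simp
qed

text \<open>A diagonal element of \<open>pa\<close> with pairwise distinct eigenvalues, namely 1,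
  ..., l and their negatives. It is a starting vector that commutes with no nonzero matrix of
  vanishing cube.\<close>

definition dmat :: "complex mat" where
  "dmat = mat n n (\<lambda>(i, j). if i = j then (if i < l then of_nat (i + 1) else - of_nat (du i + 1)) else 0)"

lemma dmat_M [simp]: "dmat \<in> M" by (simp add: dmat_def)

lemma dmat_pa: "dmat \<in> pa"
proof -
  have "adj dmat $$ (i, j) = (- dmat) $$ (i, j)" if "i < n" "j < n" for i j
    using that by (cases "i = j") (auto simp: adj_entry dmat_def)
  then have "adj dmat = - dmat" by (intro eq_matI) (auto simp: dmat_def)
  then show ?thesis by (auto simp: pa_def sp_def UT_def dmat_def)
qed

lemma dmat_inj: assumes "i < n" "j < n" "i \<noteq> j" shows "dmat $$ (i, i) \<noteq> dmat $$ (j, j)"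
proof -
  define f where "f k = (complex_of_nat (k + 1))" for k
  have f: "f i = f j \<longleftrightarrow> i = j" "f i + f j \<noteq> 0" for i j
  proof -
    show "f i = f j \<longleftrightarrow> i = j" unfolding f_def of_nat_eq_iff by simp
    have "of_nat ((i + 1) + (j + 1)) \<noteq> (0::complex)" unfolding of_nat_eq_0_iff by simp
    then show "f i + f j \<noteq> 0" unfolding f_def of_nat_add by simp
  qed
  have fd: "dmat $$ (i, i) = (if i < l then f i else - f (du i))" if "i < n" for i
    using that by (simp add: dmat_def f_def)
  have neg: "x \<noteq> - y" "- y \<noteq> x" if "x + y \<noteq> 0" for x y :: complex using that by auto
  have "du i \<noteq> du j" using assms by linarith
  then show ?thesis
    unfolding fd[OF assms(1)] fd[OF assms(2)]
    using assms(3) f(1)[of i j] f(1)[of "du i" "du j"] neg[OF f(2), of i "du j"] neg[OF f(2), of j "du i"]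
    by (cases "i < l"; cases "j < l") (simp_all del: diff_Suc_1)
qed

text \<open>Distinct eigenvalues force \<open>X\<close> to be diagonal, and then the cubes of its
  entries vanish.\<close>

lemma dmat_centraliser:
  assumes X: "X \<in> M" and comm: "X * dmat = dmat * X" and cube: "X * (X * X) = 0\<^sub>m n n"
  shows "X = 0\<^sub>m n n"
proof -
  have off: "X $$ (i, j) = 0" if ij: "i < n" "j < n" "i \<noteq> j" for i j
  proof -
    have "(X * dmat) $$ (i, j) = (\<Sum>k<n. if k = j then X $$ (i, j) * dmat $$ (j, j) else 0)"
      unfolding mult_entry[OF X dmat_M ij(1,2)] by (rule sum.cong) (use ij in \<open>auto simp: dmat_def\<close>)
    moreover have "(dmat * X) $$ (i, j) = (\<Sum>k<n. if k = i then dmat $$ (i, i) * X $$ (i, j) else 0)"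
      unfolding mult_entry[OF dmat_M X ij(1,2)] by (rule sum.cong) (use ij in \<open>auto simp: dmat_def\<close>)
    ultimately have "(X * dmat) $$ (i, j) = X $$ (i, j) * dmat $$ (j, j)" "(dmat * X) $$ (i, j) = dmat $$ (i, i) * X $$ (i, j)"
      using ij by simp_all
    then have "X $$ (i, j) * dmat $$ (j, j) = dmat $$ (i, i) * X $$ (i, j)" unfolding comm by (rule trans[OF sym])
    then have "dmat $$ (j, j) = dmat $$ (i, i) \<or> X $$ (i, j) = 0"
      by (simp only: mult.commute[of "dmat $$ (i, i)"] mult_cancel_left) blast
    then show ?thesis using dmat_inj[OF ij(2,1)] ij(3) by blast
  qed
  have dg: "(X * Y) $$ (i, i) = X $$ (i, i) * Y $$ (i, i)" if "Y \<in> M" "i < n" for Y i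
  proof -
    have "(X * Y) $$ (i, i) = (\<Sum>k<n. if k = i then X $$ (i, i) * Y $$ (i, i) else 0)"
      unfolding mult_entry[OF X that(1,2,2)] by (rule sum.cong) (use off that in auto)
    then show ?thesis using that by simp
  qed
  have "X $$ (i, i) = 0" if "i < n" for i
  proof -
    have "(X * (X * X)) $$ (i, i) = X $$ (i, i) * (X $$ (i, i) * X $$ (i, i))"
      using that X by (simp add: dg del: index_mult_mat(1))
    then show ?thesis using that cube by simp
  qed
  then have "X $$ (i, j) = 0" if "i < n" "j < n" for i j using off that by (cases "i = j") auto
  then show ?thesis using X by (intro eq_matI) auto
qed

text \<open>Binomial expansion of left minus right multiplication by \<open>a\<close>: the third
  power is 3 u - 3 v, the fourth 6 w, and the fifth vanishes.\<close>

lemma ad_nilpotent: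
  assumes a: "a \<in> M" and cube: "a * (a * a) = 0\<^sub>m n n" and Y: "Y \<in> M"
  shows "((\<lambda>Y. a * Y - Y * a) ^^ 5) Y = 0\<^sub>m n n"
proof -
  have cube': "a * (a * (a * X)) = 0\<^sub>m n n" if "X \<in> M" for X
  proof -
    have "a * (a * (a * X)) = (a * (a * a)) * X" using a that by (simp add: mult_M)
    then show ?thesis using cube that by simp
  qed
  define T where "T = (\<lambda>Y. a * Y - Y * a)"
  define u v w where "u = a * (Y * (a * a))" and "v = a * (a * (Y * a))" and "w = a * (a * (Y * (a * a)))"
  have M': "u \<in> M" "v \<in> M" "w \<in> M" using a Y by (auto simp: u_def v_def w_def)
  have 3: "T (T (T Y)) = u + u + u - (v + v + v)"
    using a Y by (simp add: T_def u_def v_def mult_M cube cube')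
      (intro eq_matI, auto simp: algebra_simps simp del: index_mult_mat(1))
  have uv: "a * u = w" "u * a = 0\<^sub>m n n" "a * v = 0\<^sub>m n n" "v * a = w" "a * w = 0\<^sub>m n n" "w * a = 0\<^sub>m n n"
    using a Y by (simp_all add: u_def v_def w_def mult_M cube cube')
  have 4: "T (T (T (T Y))) = w + w + w + w + w + w"
  proof -
    have "T (T (T (T Y))) = a * (u + u + u - (v + v + v)) - (u + u + u - (v + v + v)) * a"
      unfolding 3 by (simp only: T_def)
    also have "\<dots> = w + w + w + w + w + w"
      using a M' by (simp add: mult_M uv) (intro eq_matI, auto simp del: index_mult_mat(1))
    finally show ?thesis .
  qed
  have "T (T (T (T (T Y)))) = 0\<^sub>m n n"
  proof -
    have "T (T (T (T (T Y)))) = a * (w + w + w + w + w + w) - (w + w + w + w + w + w) * a"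
      unfolding 4 by (simp only: T_def)
    then show ?thesis using a M' by (simp add: mult_M uv)
  qed
  moreover have "(T ^^ 5) Y = T (T (T (T (T Y))))" by (simp add: eval_nat_numeral)
  ultimately show ?thesis by (simp only: T_def)
qed

text \<open>Repeated brackets of \<open>dmat\<close> with \<open>Z\<close> end in zero. The last
  nonzero one, \<open>K\<close>, commutes with \<open>Z\<close>, and it is itself a bracket with
  \<open>Z\<close> because the first bracket is nonzero. It makes \<open>Ad (ex (c Z)) Y\<close>
  affine in c, so that c can be recovered.\<close>

lemma last_bracket:
  assumes Z: "Z \<in> pa" "Z \<noteq> 0\<^sub>m n n" and cube: "Z * (Z * Z) = 0\<^sub>m n n"
  obtains Y K where "Y \<in> pa" "K = Z * Y - Y * Z" "K \<noteq> 0\<^sub>m n n" "Z * K = K * Z"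
proof -
  have ZM: "Z \<in> M" using Z by (simp add: pa_M)
  define T where "T = (\<lambda>Y. Z * Y - Y * Z)"
  have TP: "(T ^^ k) Y \<in> pa" if "Y \<in> pa" for k Y
    using that Z by (induction k) (auto simp: T_def bracket_pa)
  have zero: "A = B" if "A - B = 0\<^sub>m n n" "A \<in> M" "B \<in> M" for A B :: "complex mat"
  proof (rule eq_matI)
    fix i j assume "i < dim_row B" "j < dim_col B"
    then have ij: "i < n" "j < n" using that by auto
    have "A $$ (i, j) - B $$ (i, j) = (A - B) $$ (i, j)" using that(2,3) ij by simp
    also have "\<dots> = 0" unfolding that(1) using ij by simp
    finally show "A $$ (i, j) = B $$ (i, j)" by simp
  qed (use that in auto)
  have "T dmat \<noteq> 0\<^sub>m n n"
    using dmat_centraliser[OF ZM _ cube] zero[of "Z * dmat" "dmat * Z"] Z(2) ZM by (auto simp: T_def)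
  define k where "k = (LEAST k. (T ^^ k) dmat = 0\<^sub>m n n)"
  have k0: "(T ^^ k) dmat = 0\<^sub>m n n" unfolding k_def
    by (rule LeastI[of _ 5]) (use ad_nilpotent[OF ZM cube dmat_M] in \<open>simp add: T_def\<close>)
  have kl: "(T ^^ j) dmat \<noteq> 0\<^sub>m n n" if "j < k" for j using not_less_Least that unfolding k_def by blast
  have T0: "T (0\<^sub>m n n) = 0\<^sub>m n n" using ZM by (simp add: T_def)
  have "k \<noteq> 0" "k \<noteq> 1" using k0 T0 \<open>T dmat \<noteq> _\<close> by (auto intro!: notI)
  then obtain j where j: "k = Suc (Suc j)" by (metis One_nat_def not0_implies_Suc)
  define Y where "Y = (T ^^ j) dmat"
  have YP: "Y \<in> pa" unfolding Y_def by (rule TP[OF dmat_pa])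
  have "T Y \<noteq> 0\<^sub>m n n" using kl[of "Suc j"] j by (simp add: Y_def)
  moreover have TT: "T (T Y) = 0\<^sub>m n n" using k0 j by (simp add: Y_def)
  have TYM: "T Y \<in> M" using ZM pa_M[OF YP] by (simp add: T_def)
  have "Z * T Y - T Y * Z = T (T Y)" unfolding T_def ..
  then have "Z * T Y = T Y * Z" unfolding TT by (rule zero) (use ZM TYM in auto)
  ultimately show thesis using that[OF YP refl] unfolding T_def by blast
qed

lemma conj_ex_bracket:
  assumes Z: "Z \<in> sp" and cube: "Z * (Z * Z) = 0\<^sub>m n n" and Y: "Y \<in> M"
    and K: "K = Z * Y - Y * Z" and comm: "Z * K = K * Z"
  shows "conj_by (ex Z) Y = Y + K"
proof -
  have ZM: "Z \<in> M" using Z by (rule sp_M)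
  have KM: "K \<in> M" using ZM Y by (simp add: K)
  have ZY: "Z * Y = Y * Z + K" using ZM Y unfolding K by (intro eq_matI) (auto simp del: index_mult_mat(1))
  have ZZY: "Z * (Z * Y) = Y * (Z * Z) + K * Z + K * Z"
  proof -
    have "Z * (Z * Y) = Z * (Y * Z) + Z * K" unfolding ZY using ZM Y KM by (simp add: mult_M)
    also have "Z * (Y * Z) = (Z * Y) * Z" using ZM Y by (simp add: mult_M)
    also have "(Z * Y) * Z = Y * (Z * Z) + K * Z" unfolding ZY using ZM Y KM by (simp add: mult_M)
    finally show ?thesis unfolding comm .
  qed
  \<comment> \<open>Moving \<open>Z\<close> three times past \<open>Y\<close> turns
    \<open>Z^3 Y = 0\<close> into \<open>3 K Z^2 = 0\<close>. This removes the cubic term that the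
    truncated exponential would leave over.\<close>
  have KZZ: "K * (Z * Z) = 0\<^sub>m n n"
  proof -
    have a: "(Z * (Z * Z)) * Y = Z * (Z * (Z * Y))" using ZM Y by (simp add: mult_M)
    have b: "Z * (Y * (Z * Z)) = K * (Z * Z)"
    proof -
      have "Z * (Y * (Z * Z)) = (Z * Y) * (Z * Z)" using ZM Y by (simp add: mult_M)
      also have "\<dots> = Y * (Z * (Z * Z)) + K * (Z * Z)" unfolding ZY using ZM Y KM by (simp add: mult_M)
      finally show ?thesis using cube Y ZM KM by simp
    qed
    have c: "Z * (K * Z) = K * (Z * Z)"
    proof -
      have "Z * (K * Z) = (Z * K) * Z" using ZM KM by (simp only: mult_M(1))
      also have "\<dots> = K * (Z * Z)" unfolding comm using ZM KM by (simp only: mult_M(1))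
      finally show ?thesis .
    qed
    have "0\<^sub>m n n = Z * (Y * (Z * Z) + K * Z + K * Z)" using a cube Y by (simp add: ZZY)
    also have "\<dots> = K * (Z * Z) + K * (Z * Z) + K * (Z * Z)" using ZM Y KM b c by (simp add: mult_M)
    finally have e: "0\<^sub>m n n = K * (Z * Z) + K * (Z * Z) + K * (Z * Z)" .
    show ?thesis
    proof (rule eq_matI)
      fix i j assume "i < dim_row (0\<^sub>m n n :: complex mat)" "j < dim_col (0\<^sub>m n n :: complex mat)"
      then have ij: "i < n" "j < n" by auto
      have "(0\<^sub>m n n) $$ (i, j) = (K * (Z * Z) + K * (Z * Z) + K * (Z * Z)) $$ (i, j)" using e by simp
      then show "(K * (Z * Z)) $$ (i, j) = 0\<^sub>m n n $$ (i, j)"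
        using ij KM ZM by (simp del: index_mult_mat(1))
    qed (use KM ZM in auto)
  qed
  have "ex Z * Y = (Y + K) * ex Z"
    using ZM Y KM unfolding ex_def
    by (simp add: mult_M ZZY KZZ) (simp add: ZY, intro eq_matI, auto simp: field_simps simp del: index_mult_mat(1))
  moreover have "ex Z \<in> Sp" by (rule ex_Sp[OF Z cube])
  ultimately have "conj_by (ex Z) Y = (Y + K) * (ex Z * adj (ex Z))" using ZM Y KM by (simp add: conj_by_Sp mult_M)
  then show ?thesis using Y KM Sp_adj_right[OF \<open>ex Z \<in> Sp\<close>] by simp
qed

text \<open>The line through \<open>E\<close> is fixed by the stabiliser, so
  \<open>reductive_type_no_ideal\<close> applies to it once the scalar c can be read off
  \<open>Ad (ex (c E))\<close>.\<close>

theorem no_central_nilpotent: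
  assumes red: "reductive_type n Pg \<gamma>"
    and E: "E \<in> pa" "E * (E * E) = 0\<^sub>m n n"
    and central: "\<And>g. g \<in> group_stab n Pg \<gamma> \<Longrightarrow> conj_by g E = E"
    and stab: "\<And>c. ex (c \<cdot>\<^sub>m E) \<in> group_stab n Pg \<gamma>"
  shows "E = 0\<^sub>m n n"
proof (rule ccontr)
  assume nz: "E \<noteq> 0\<^sub>m n n"
  have EM: "E \<in> M" using E by (simp add: pa_M)
  obtain Y K where YK: "Y \<in> pa" "K = E * Y - Y * E" "K \<noteq> 0\<^sub>m n n" "E * K = K * E"
    by (rule last_bracket[OF E(1) nz E(2)]) blast
  have YM: "Y \<in> M" and KM: "K \<in> M" using YK pa_M EM by auto
  have "\<exists>a b. a < n \<and> b < n \<and> K $$ (a, b) \<noteq> 0"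
  proof (rule ccontr)
    assume "\<not> ?thesis"
    then have "K = 0\<^sub>m n n" using KM by (intro eq_matI) auto
    then show False using YK by simp
  qed
  then obtain a b where ab: "a < n" "b < n" "K $$ (a, b) \<noteq> 0" by blast
  define N where "N = range (\<lambda>c. c \<cdot>\<^sub>m E)"
  \<comment> \<open>\<open>Ad (ex (c E))\<close> sends \<open>Y\<close> to \<open>Y + c K\<close>;
    an entry at which \<open>K\<close> is nonzero therefore yields c.\<close>
  define \<tau> where "\<tau> \<phi> = (\<phi> Y $$ (a, b) - Y $$ (a, b)) * inverse (K $$ (a, b))" for \<phi> :: "complex mat \<Rightarrow> complex mat"
  define \<rho> where "\<rho> \<phi> = \<tau> \<phi> \<cdot>\<^sub>m E" for \<phi>
  have cube: "(c \<cdot>\<^sub>m E) * ((d \<cdot>\<^sub>m E) * (e \<cdot>\<^sub>m E)) = 0\<^sub>m n n" for c d e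
    using EM E(2) by (simp add: mult_M)
  have "N = {0\<^sub>m n n}"
  proof (rule reductive_type_no_ideal[OF red, of N \<rho>])
    show "N \<subseteq> pa" using E by (auto simp: N_def pa_smult)
    have "0 \<cdot>\<^sub>m E = 0\<^sub>m n n" using EM by auto
    then show "0\<^sub>m n n \<in> N" unfolding N_def by (metis rangeI)
    fix Z Z' assume "Z \<in> N" "Z' \<in> N"
    then obtain c d where cd: "Z = c \<cdot>\<^sub>m E" "Z' = d \<cdot>\<^sub>m E" by (auto simp: N_def)
    have "Z + Z' = (c + d) \<cdot>\<^sub>m E" using EM by (auto simp: cd algebra_simps)
    then show "Z + Z' \<in> N" by (auto simp: N_def)
    show "Z * Z' = Z' * Z" using EM by (auto simp: cd mult_M)
  next
    fix c Z assume "Z \<in> N"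
    then obtain d where "Z = d \<cdot>\<^sub>m E" by (auto simp: N_def)
    then have "c \<cdot>\<^sub>m Z = (c * d) \<cdot>\<^sub>m E" by auto
    then show "c \<cdot>\<^sub>m Z \<in> N" by (auto simp: N_def)
  next
    fix Z Z' Z'' assume "Z \<in> N" "Z' \<in> N" "Z'' \<in> N"
    then show "Z * (Z' * Z'') = 0\<^sub>m n n" using cube by (auto simp: N_def)
  next
    fix Z assume "Z \<in> N"
    then show "ex Z \<in> group_stab n Pg \<gamma>" using stab by (auto simp: N_def)
  next
    fix g Z assume g: "g \<in> group_stab n Pg \<gamma>" and "Z \<in> N"
    then show "conj_by g Z \<in> N" using central[OF g] EM stab_Pg[OF g] by (auto simp: N_def conj_by_smult Pg_Sp)
  next
    fix i j assume ij: "i < n" "j < n"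
    have \<tau>: "\<tau> \<in> poly_functions (End_coords n pa)" unfolding \<tau>_def[abs_def]
      using ab YK by (intro poly_functions.mult poly_functions_minus poly_functions.const End_coord)
    have "(\<lambda>\<phi>. \<tau> \<phi> * E $$ (i, j)) \<in> poly_functions (End_coords n pa)"
      by (intro poly_functions.mult \<tau> poly_functions.const)
    then show "(\<lambda>\<phi>. \<rho> \<phi> $$ (i, j)) \<in> poly_functions (End_coords n pa)" using ij EM by (simp add: \<rho>_def)
  next
    show "\<rho> \<phi> \<in> M" for \<phi> using EM by (simp add: \<rho>_def)
  next
    fix Z assume "Z \<in> N"
    then obtain c where c: "Z = c \<cdot>\<^sub>m E" by (auto simp: N_def)
    have Zp: "Z \<in> pa" using E c by (simp add: pa_smult)
    have "conj_by (ex Z) Y = Y + c \<cdot>\<^sub>m K"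
    proof (rule conj_ex_bracket[OF pa_sp[OF Zp] _ YM])
      show "Z * (Z * Z) = 0\<^sub>m n n" using cube c by simp
      show "c \<cdot>\<^sub>m K = Z * Y - Y * Z" unfolding YK(2) c using EM YM
        by (simp add: mult_M) (intro eq_matI, auto simp: algebra_simps simp del: index_mult_mat(1))
      show "Z * (c \<cdot>\<^sub>m K) = c \<cdot>\<^sub>m K * Z" using c EM KM YK(4) by (simp add: mult_M)
    qed
    then have "Ad n Pg (ex Z) Y $$ (a, b) = Y $$ (a, b) + c * K $$ (a, b)"
      using YK(1) YM KM ab by (simp add: Ad_pa)
    then have "\<tau> (Ad n Pg (ex Z)) = c" using ab by (simp add: \<tau>_def)
    then show "\<rho> (Ad n Pg (ex Z)) = Z" by (simp add: \<rho>_def c)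
  next
    show "\<rho> (Ad n Pg g) \<in> N" for g by (simp add: \<rho>_def N_def)
  qed
  moreover have "1 \<cdot>\<^sub>m E \<in> N" unfolding N_def by blast
  moreover have "1 \<cdot>\<^sub>m E = E" using EM by auto
  ultimately show False using nz by simp
qed

theorem reductive_nilpotent_orbit:
  assumes \<gamma>: "\<gamma> \<in> lie_dual n Pg" and red: "reductive_type n Pg \<gamma>" and nil: "nilpotent_type n Pg \<gamma>"
  obtains g where "g \<in> Pg" "\<gamma> = act g (gam F0)"
proof -
  obtain g D where g: "g \<in> Pg" and D: "D \<in> La" and \<gamma>_eq: "\<gamma> = act g (gam (F0 + D))"
    by (rule normal_form[OF \<gamma> red]) blast
  define \<delta> where "\<delta> = gam (F0 + D)"
  have DM: "D \<in> M" using La_M[OF D] .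
  have gS: "g \<in> Sp" using g by (rule Pg_Sp)
  have \<delta>: "\<delta> \<in> lie_dual n Pg" using DM by (simp add: \<delta>_def gam_dual)
  have "act (adj g) \<gamma> = \<delta>"
    using g \<delta> unfolding \<gamma>_eq \<delta>_def[symmetric] by (simp add: act_act Pg_adj Sp_adj_left Pg_Sp act_one)
  then have "nilpotent_type n Pg \<delta>" using nilpotent_act[OF Pg_adj[OF g] \<gamma> nil] by simp
  then obtain m where m: "D ^\<^sub>m m = 0\<^sub>m n n" using nilpotent_type_Levi[OF D] unfolding \<delta>_def by blast
  have big: "D ^\<^sub>m k = 0\<^sub>m n n" if "m \<le> k" for k
    using pow_add[OF DM, of m "k - m"] m that DM by simp
  have "D = 0\<^sub>m n n"
  proof (rule ccontr)
    assume nz: "D \<noteq> 0\<^sub>m n n"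
    define k where "k = (LEAST k. D ^\<^sub>m (2 * k + 1) = 0\<^sub>m n n)"
    have k0: "D ^\<^sub>m (2 * k + 1) = 0\<^sub>m n n" unfolding k_def by (rule LeastI[of _ m], rule big) simp
    have kl: "D ^\<^sub>m (2 * j + 1) \<noteq> 0\<^sub>m n n" if "j < k" for j using not_less_Least that unfolding k_def by blast
    have "k \<noteq> 0" using k0 nz DM by (auto intro!: notI)
    then obtain j where j: "k = Suc j" using not0_implies_Suc by blast
    \<comment> \<open>The last nonzero odd power of \<open>D\<close> has vanishing cube: for
      \<open>k = j + 1\<close>, three times \<open>2 j + 1\<close> equals
      \<open>(2 k + 1) + 4 j\<close>. It is central for the stabiliser, which commutes with
      \<open>D\<close>.\<close>
    define A where "A = D ^\<^sub>m (2 * j + 1)"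
    have A0: "A \<noteq> 0\<^sub>m n n" using kl[of j] j unfolding A_def by blast
    have AL: "A \<in> La" unfolding A_def by (rule La_odd_power[OF D])
    have AM: "A \<in> M" using La_M[OF AL] .
    have "A * (A * A) = D ^\<^sub>m ((2 * j + 1) + ((2 * j + 1) + (2 * j + 1)))"
      unfolding A_def pow_add[OF DM, symmetric] ..
    also have "(2 * j + 1) + ((2 * j + 1) + (2 * j + 1)) = (2 * k + 1) + 4 * j" using j by simp
    also have "D ^\<^sub>m \<dots> = D ^\<^sub>m (2 * k + 1) * D ^\<^sub>m (4 * j)" by (rule pow_add[OF DM])
    also have "\<dots> = 0\<^sub>m n n" unfolding k0 using DM by simp
    finally have cube: "A * (A * A) = 0\<^sub>m n n" .
    have stab: "group_stab n Pg \<gamma> = conj_by g ` group_stab n Pg \<delta>"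
      unfolding \<gamma>_eq \<delta>_def[symmetric] by (rule stab_act[OF g \<delta>])
    define E where "E = conj_by g A"
    have EP: "E \<in> pa" unfolding E_def by (rule conj_by_pa[OF g La_pa[OF AL]])
    have "E = 0\<^sub>m n n"
    proof (rule no_central_nilpotent[OF red EP])
      have "E * (E * E) = conj_by g (A * (A * A))" using gS AM by (simp add: E_def conj_by_times)
      then show "E * (E * E) = 0\<^sub>m n n" using cube gS Sp_M[OF gS] by (simp add: conj_by_Sp)
    next
      fix h assume "h \<in> group_stab n Pg \<gamma>"
      then obtain s where s: "h = conj_by g s" "s \<in> group_stab n Pg \<delta>" using stab by blast
      have sP: "s \<in> Pg" using s stab_Pg by blast
      have sM: "s \<in> M" using sP by (rule Pg_M)
      have "D * s = s * D" using stab_Levi(2)[OF D] s unfolding \<delta>_def by auto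
      then have "A * s = s * A" unfolding A_def by (rule pow_commute[OF DM sM])
      then have "conj_by s A = A" using conj_by_commute[OF Pg_Sp[OF sP] AM] by simp
      then show "conj_by h E = E" using conj_by_conj[OF gS Pg_Sp[OF sP] AM] by (simp add: E_def s)
    next
      fix c
      let ?A = "c \<cdot>\<^sub>m A"
      have cA: "?A \<in> pa" using La_pa[OF AL] by (simp add: pa_smult)
      have c3: "?A * (?A * ?A) = 0\<^sub>m n n" using AM cube by (simp add: mult_M)
      have eP: "ex ?A \<in> Pg" by (rule ex_Pg[OF cA c3])
      have eM: "ex ?A \<in> M" using eP by (rule Pg_M)
      have AD: "A * D = D * A" unfolding A_def by (rule pow_commute[OF DM DM refl])
      have AF: "A * F0 = F0 * A" using La_F0[OF AL] by simp
      have "ex ?A * B = B * ex ?A" if "B \<in> M" "A * B = B * A" for B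
      proof -
        have "A * (A * B) = (A * B) * A" using that(1) AM unfolding that(2) by (simp only: mult_M(1)[symmetric] that(2))
        also have "\<dots> = B * (A * A)" unfolding that(2) using that(1) AM by (simp only: mult_M(1))
        finally have "A * (A * B) = B * (A * A)" .
        then show ?thesis using that AM by (simp add: ex_def mult_M)
      qed
      note comm = this
      have "ex ?A * (F0 + D) = (F0 + D) * ex ?A"
        using comm[OF F0_M AF] comm[OF DM AD] DM eM by (simp add: mult_M)
      then have "conj_by (ex ?A) (F0 + D) = F0 + D" using conj_by_commute[OF Pg_Sp[OF eP], of "F0 + D"] DM by simp
      then have inv: "conj_by (adj (ex ?A)) (F0 + D) = F0 + D"
        using conj_by_adj[OF Pg_Sp[OF eP], of "F0 + D"] DM by simp
      have "\<delta> (conj_by (ex ?A) X) = \<delta> X" if X: "X \<in> pa" for X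
        using tr_shift[OF Pg_Sp[OF eP], of "F0 + D" X] DM X eP
        by (simp add: \<delta>_def gam_def conj_by_pa pa_M inv)
      then have "ex ?A \<in> group_stab n Pg \<delta>" using eP by (simp add: group_stab_Pg)
      moreover have "ex (c \<cdot>\<^sub>m E) = conj_by g (ex ?A)"
        using gS AM by (simp add: E_def conj_by_ex conj_by_smult)
      ultimately show "ex (c \<cdot>\<^sub>m E) \<in> group_stab n Pg \<gamma>" using stab by blast
    qed
    then have "A = conj_by (adj g) (0\<^sub>m n n)" using conj_by_adj[OF gS AM] by (simp add: E_def)
    also have "\<dots> = 0\<^sub>m n n" using Sp_adj[OF gS] Sp_M[OF gS] by (simp add: conj_by_Sp adj_adj)
    finally show False using A0 by simp
  qed
  then show thesis using that[OF g] \<gamma>_eq by simp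
qed

theorem M_star_eq: "M_star n Pg = conj_class Pg La"
proof
  show "conj_class Pg La \<subseteq> M_star n Pg" by (rule conj_class_sub_M_star)
  show "M_star n Pg \<subseteq> conj_class Pg La"
  proof
    fix L assume "L \<in> M_star n Pg"
    then obtain \<gamma> where \<gamma>: "L = lie_algebra n (group_stab n Pg \<gamma>)" "\<gamma> \<in> lie_dual n Pg"
      "reductive_type n Pg \<gamma>" "nilpotent_type n Pg \<gamma>" by (auto simp: M_star_def)
    obtain g where g: "g \<in> Pg" "\<gamma> = act g (gam F0)"
      by (rule reductive_nilpotent_orbit[OF \<gamma>(2-4)]) blast
    have "Sg \<subseteq> M" using Sg_Pg Pg_M by blast
    then have "L = conj_by g ` La"
      using g \<gamma>(1) lie_conj[OF Pg_Sp[OF g(1)], of Sg] by (simp add: stab_act gam_dual stab_F0 lie_Sg)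
    then show "L \<in> conj_class Pg La" using g by (auto simp: conj_class_def)
  qed
qed

section \<open>The standard flag\<close>

lemma symp_form_M [simp]: "symp_form l \<in> M" by (simp add: symp_form_def)
lemma symp_form_dim [simp]: "dim_row (symp_form l) = n" "dim_col (symp_form l) = n"
  by (simp_all add: symp_form_def)

lemma symp_form_right: assumes "A \<in> M" "i < n" "j < n"
  shows "(A * symp_form l) $$ (i, j) = A $$ (i, du j) * sg (du j)"
proof -
  have "(A * symp_form l) $$ (i, j) = (\<Sum>k<n. if k = du j then A $$ (i, du j) * sg (du j) else 0)"
    unfolding mult_entry[OF assms(1) symp_form_M assms(2,3)]
    by (rule sum.cong) (use assms in \<open>auto simp: symp_form_def sg_def\<close>)
  then show ?thesis using assms by simp
qed

lemma symp_form_left: assumes "A \<in> M" "i < n" "j < n"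
  shows "(symp_form l * A) $$ (i, j) = sg i * A $$ (du i, j)"
proof -
  have "(symp_form l * A) $$ (i, j) = (\<Sum>k<n. if k = du i then sg i * A $$ (du i, j) else 0)"
    unfolding mult_entry[OF symp_form_M assms]
    by (rule sum.cong) (use assms in \<open>auto simp: symp_form_def sg_def\<close>)
  then show ?thesis using assms by simp
qed

lemma symp_form_sq: "symp_form l * symp_form l = - 1\<^sub>m n"
proof (rule eq_matI)
  fix i j assume "i < dim_row (- 1\<^sub>m n :: complex mat)" "j < dim_col (- 1\<^sub>m n :: complex mat)"
  then have ij: "i < n" "j < n" by auto
  then show "(symp_form l * symp_form l) $$ (i, j) = (- 1\<^sub>m n) $$ (i, j)"
    unfolding symp_form_right[OF symp_form_M ij] by (auto simp: symp_form_def sg_def)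
qed auto

lemma symp_form_cancel:
  assumes "A \<in> M" "B \<in> M" "symp_form l * A = symp_form l * B" shows "A = B"
proof -
  have e: "- A = - B"
  proof -
    have "symp_form l * symp_form l * A = symp_form l * symp_form l * B"
      using assms by (simp add: mult_M)
    then show ?thesis unfolding symp_form_sq using assms by (simp add: mult_M(9))
  qed
  show ?thesis
  proof (rule eq_matI)
    fix i j assume "i < dim_row B" "j < dim_col B"
    then show "A $$ (i, j) = B $$ (i, j)"
      using arg_cong[OF e, of "\<lambda>A. A $$ (i, j)"] assms by simp
  qed (use assms in auto)
qed

text \<open>Identifies \<open>adj\<close> as the adjoint for \<open>symp_form\<close>, which links
  \<open>Sp\<close> and \<open>sp\<close> to the group and the Lie algebra defined by the Gram
  matrix.\<close>

lemma transpose_symp_form: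
  assumes "X \<in> M" shows "transpose_mat X * symp_form l = symp_form l * adj X"
proof (rule eq_matI)
  fix i j assume "i < dim_row (symp_form l * adj X)" "j < dim_col (symp_form l * adj X)"
  then have ij: "i < n" "j < n" by auto
  have X: "transpose_mat X \<in> M" using assms by simp
  show "(transpose_mat X * symp_form l) $$ (i, j) = (symp_form l * adj X) $$ (i, j)"
    unfolding symp_form_right[OF X ij] symp_form_left[OF adj_carrier ij]
    using ij assms by (simp add: adj_entry sg_du)
qed (use assms in auto)

lemma Sp_group_eq: "Sp_group l = Sp"
proof -
  have "transpose_mat g * symp_form l * g = symp_form l \<longleftrightarrow> adj g * g = 1\<^sub>m n" if g: "g \<in> M" for g
  proof -
    have "transpose_mat g * symp_form l * g = symp_form l * (adj g * g)"
      using g by (simp add: transpose_symp_form mult_M)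
    moreover have "symp_form l * (adj g * g) = symp_form l * 1\<^sub>m n \<longleftrightarrow> adj g * g = 1\<^sub>m n"
      using symp_form_cancel[of "adj g * g" "1\<^sub>m n"] g by auto
    ultimately show ?thesis by simp
  qed
  then show ?thesis by (auto simp: Sp_group_def Sp_def)
qed

lemma sp_alg_eq: "sp_alg l = sp"
proof -
  have "transpose_mat X * symp_form l + symp_form l * X = 0\<^sub>m n n \<longleftrightarrow> adj X = - X" if X: "X \<in> M" for X
  proof -
    have "transpose_mat X * symp_form l + symp_form l * X = symp_form l * (adj X + X)"
      using X by (simp add: transpose_symp_form mult_M)
    moreover have "symp_form l * (adj X + X) = symp_form l * 0\<^sub>m n n \<longleftrightarrow> adj X + X = 0\<^sub>m n n"
      using symp_form_cancel[of "adj X + X" "0\<^sub>m n n"] X by auto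
    moreover have "adj X + X = 0\<^sub>m n n \<longleftrightarrow> adj X = - X"
    proof
      assume e: "adj X + X = 0\<^sub>m n n"
      show "adj X = - X"
      proof (rule eq_matI)
        fix i j assume "i < dim_row (- X)" "j < dim_col (- X)"
        then have ij: "i < n" "j < n" using X by auto
        have "adj X $$ (i, j) + X $$ (i, j) = (adj X + X) $$ (i, j)" using ij X by simp
        also have "\<dots> = 0" unfolding e using ij by simp
        finally show "adj X $$ (i, j) = (- X) $$ (i, j)" using ij X by (simp add: add_eq_0_iff2)
      qed (use X in auto)
    qed (use X in auto)
    ultimately show ?thesis using X by simp
  qed
  then show ?thesis by (auto simp: sp_alg_def sp_def)
qed

end

definition flag_step :: "nat \<Rightarrow> nat \<Rightarrow> nat \<Rightarrow> nat" where
  "flag_step l s i = (if s \<le> i then 1 else 0) + (if 2 * l - s \<le> i then 1 else 0)"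

text \<open>The position of an index among the jumps \<open>a\<^sub>1 + \<dots> + a\<^sub>k\<close> of the flag and the jumps
  \<open>2l - (a\<^sub>1 + \<dots> + a\<^sub>k)\<close> of the orthogonal flag.\<close>

definition flag_level :: "nat \<Rightarrow> nat list \<Rightarrow> nat \<Rightarrow> nat" where
  "flag_level l as i = (\<Sum>k<length as. flag_step l (sum_list (take (Suc k) as)) i)"

section \<open>Levels of indices with respect to the flag\<close>

lemma flag_level_Nil: "flag_level l [] i = 0" by (simp add: flag_level_def)

lemma flag_level_Cons:
  assumes "a \<le> l"
  shows "flag_level l (a # as) i = flag_step l a i + (\<Sum>k<length as. flag_step l (a + sum_list (take (Suc k) as)) i)"
  unfolding flag_level_def by (simp add: sum.lessThan_Suc_shift del: sum.lessThan_Suc)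

lemma sum_list_take_le: "sum_list (take k as) \<le> sum_list (as :: nat list)"
  by (metis append_take_drop_id le_add1 sum_list_append)

lemma flag_step_mono: "i \<le> j \<Longrightarrow> flag_step l s i \<le> flag_step l s j"
  by (auto simp: flag_step_def)

lemma levelled_flag:
  assumes r: "sum_list as \<le> l"
  shows "levelled l (sum_list as) (length as) (flag_level l as)"
proof
  let ?s = "\<lambda>k. sum_list (take k as)" and ?t = "length as"
  show "sum_list as \<le> l" by (rule r)
  have s: "?s k \<le> l" for k using sum_list_take_le[of k as] r by simp
  show "flag_level l as i \<le> flag_level l as j" if "i \<le> j" "j < 2 * l" for i j
    unfolding flag_level_def using that by (intro sum_mono flag_step_mono)
  show "flag_level l as (2 * l - 1 - i) + flag_level l as i = 2 * ?t" if i: "i < 2 * l" for i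
  proof -
    have *: "flag_step l (?s k) (2 * l - 1 - i) + flag_step l (?s k) i = 2" for k
    proof -
      have "?s k \<le> 2 * l - 1 - i \<longleftrightarrow> \<not> 2 * l - ?s k \<le> i" "2 * l - ?s k \<le> 2 * l - 1 - i \<longleftrightarrow> \<not> ?s k \<le> i"
        using s[of k] i by linarith+
      then show ?thesis by (simp add: flag_step_def)
    qed
    show ?thesis unfolding flag_level_def sum.distrib[symmetric] * by simp
  qed
  show "flag_level l as i < ?t" if i: "i < sum_list as" for i
  proof -
    have le: "flag_step l (?s k) i \<le> 1" for k
    proof -
      have "\<not> 2 * l - ?s k \<le> i" using s[of k] i r by linarith
      then show ?thesis by (simp add: flag_step_def)
    qed
    have t: "?t \<noteq> 0" using i by auto
    have "\<not> 2 * l - sum_list as \<le> i" using i r by linarith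
    \<comment> \<open>The last jump is at \<open>sum_list as\<close>, which lies beyond
      \<open>i\<close>; this summand is 0 while all others are at most 1, so the level stays below
      the number of jumps.\<close>
    then have "flag_step l (?s (Suc (?t - 1))) i < 1" using i t by (simp add: flag_step_def)
    then have "\<exists>k\<in>{..<?t}. flag_step l (?s (Suc k)) i < 1" using t by (intro bexI[of _ "?t - 1"]) auto
    then have "flag_level l as i < (\<Sum>k<?t. 1)"
      unfolding flag_level_def using le by (intro sum_strict_mono_ex1) auto
    then show ?thesis by simp
  qed
  show "flag_level l as i = ?t" if i: "sum_list as \<le> i" "i < 2 * l - sum_list as" for i
  proof -
    have "flag_step l (?s k) i = 1" for k
    proof -
      have "?s k \<le> i" "\<not> 2 * l - ?s k \<le> i" using sum_list_take_le[of k as] i by linarith+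
      then show ?thesis by (simp add: flag_step_def)
    qed
    then show ?thesis by (simp add: flag_level_def)
  qed
qed

text \<open>Levels are sums over jumps, so a strict increase shows in a single summand. The two
  outcomes are a jump of the flag and a jump of the orthogonal flag.\<close>

lemma flag_level_separated:
  assumes "flag_level l as j < flag_level l as i"
  obtains k where "k \<le> length as" "j < sum_list (take k as)" "sum_list (take k as) \<le> i"
  | k where "k \<le> length as" "j < 2 * l - sum_list (take k as)" "2 * l - sum_list (take k as) \<le> i"
proof -
  have "\<exists>k<length as. flag_step l (sum_list (take (Suc k) as)) j < flag_step l (sum_list (take (Suc k) as)) i"
  proof (rule ccontr)
    assume "\<not> ?thesis"
    then have "flag_level l as i \<le> flag_level l as j" unfolding flag_level_def by (intro sum_mono) auto
    then show False using assms by simp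
  qed
  then obtain k where k: "k < length as"
    "flag_step l (sum_list (take (Suc k) as)) j < flag_step l (sum_list (take (Suc k) as)) i" by blast
  then show thesis using that(1)[of "Suc k"] that(2)[of "Suc k"]
    by (auto simp: flag_step_def not_le split: if_splits simp del: take_Suc)
qed

lemma flag_level_less:
  assumes k: "k \<le> length as" and ji: "j < sum_list (take k as)" "sum_list (take k as) \<le> i"
  shows "flag_level l as j < flag_level l as i"
proof -
  obtain k' where k': "k = Suc k'" using ji by (cases k) auto
  have "flag_step l (sum_list (take (Suc k') as)) j < flag_step l (sum_list (take (Suc k') as)) i"
    using ji unfolding k' by (auto simp: flag_step_def simp del: take_Suc)
  then show ?thesis unfolding flag_level_def
    using k k' ji by (intro sum_strict_mono_ex1 ballI flag_step_mono bexI[of _ k']) auto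
qed

lemma flag_stable_iff:
  assumes g: "g \<in> carrier_mat (2 * l) (2 * l)"
  shows "(\<lambda>v. g *\<^sub>v v) ` std_flag l as k \<subseteq> std_flag l as k \<longleftrightarrow>
    (\<forall>i<2 * l. \<forall>j<2 * l. j < sum_list (take k as) \<longrightarrow> sum_list (take k as) \<le> i \<longrightarrow> g $$ (i, j) = 0)"
proof (intro iffI allI impI)
  fix i j assume sub: "(\<lambda>v. g *\<^sub>v v) ` std_flag l as k \<subseteq> std_flag l as k"
    and ij: "i < 2 * l" "j < 2 * l" "j < sum_list (take k as)" "sum_list (take k as) \<le> i"
  have "unit_vec (2 * l) j \<in> std_flag l as k" using ij by (auto simp: std_flag_def)
  then have "g *\<^sub>v unit_vec (2 * l) j \<in> std_flag l as k" using sub by blast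
  then have "(g *\<^sub>v unit_vec (2 * l) j) $ i = 0" using ij by (simp add: std_flag_def)
  then show "g $$ (i, j) = 0" using g ij by simp
next
  assume *: "\<forall>i<2 * l. \<forall>j<2 * l. j < sum_list (take k as) \<longrightarrow> sum_list (take k as) \<le> i \<longrightarrow> g $$ (i, j) = 0"
  show "(\<lambda>v. g *\<^sub>v v) ` std_flag l as k \<subseteq> std_flag l as k"
  proof clarify
    fix v assume v: "v \<in> std_flag l as k"
    have "(g *\<^sub>v v) $ i = 0" if i: "i < 2 * l" "sum_list (take k as) \<le> i" for i
    proof -
      have "g $$ (i, j) * v $ j = 0" if "j < 2 * l" for j
        using * i v that by (cases "j < sum_list (take k as)") (auto simp: std_flag_def)
      then show ?thesis using g i v by (auto simp: std_flag_def scalar_prod_def intro!: sum.neutral)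
    qed
    then show "g *\<^sub>v v \<in> std_flag l as k" using g v by (auto simp: std_flag_def)
  qed
qed

section \<open>The parabolic as a group of block triangular matrices\<close>

context
  fixes l :: nat and as :: "nat list"
  assumes r_le: "sum_list as \<le> l"
begin

interpretation L: levelled l "sum_list as" "length as" "flag_level l as"
  by (rule levelled_flag[OF r_le])

text \<open>The levels also jump at the orthogonal spaces of the flag. Stability of these under
  \<open>g\<close> amounts to stability of the flag under \<open>adj g\<close>, hence the second
  condition.\<close>

lemma UT_iff_flag:
  assumes g: "g \<in> carrier_mat (2 * l) (2 * l)"
  shows "L.UT g \<longleftrightarrow> (\<forall>k\<le>length as. (\<lambda>v. g *\<^sub>v v) ` std_flag l as k \<subseteq> std_flag l as k \<and>
    (\<lambda>v. L.adj g *\<^sub>v v) ` std_flag l as k \<subseteq> std_flag l as k)"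
proof
  assume UT: "L.UT g"
  have st: "(\<lambda>v. h *\<^sub>v v) ` std_flag l as k \<subseteq> std_flag l as k"
    if h: "h \<in> carrier_mat (2 * l) (2 * l)" "L.UT h" and k: "k \<le> length as" for h k
    unfolding flag_stable_iff[OF h(1)]
  proof (intro allI impI)
    fix i j assume "i < 2 * l" "j < 2 * l" "j < sum_list (take k as)" "sum_list (take k as) \<le> i"
    then show "h $$ (i, j) = 0" using h(2) flag_level_less[OF k, of j i] unfolding L.UT_def by blast
  qed
  show "\<forall>k\<le>length as. (\<lambda>v. g *\<^sub>v v) ` std_flag l as k \<subseteq> std_flag l as k \<and>
    (\<lambda>v. L.adj g *\<^sub>v v) ` std_flag l as k \<subseteq> std_flag l as k"
    using st[OF g UT] st[OF L.adj_carrier L.UT_adj[OF UT]] by simp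
next
  assume *: "\<forall>k\<le>length as. (\<lambda>v. g *\<^sub>v v) ` std_flag l as k \<subseteq> std_flag l as k \<and>
    (\<lambda>v. L.adj g *\<^sub>v v) ` std_flag l as k \<subseteq> std_flag l as k"
  show "L.UT g" unfolding L.UT_def
  proof (intro allI impI)
    fix i j assume ij: "i < 2 * l" "j < 2 * l" "flag_level l as j < flag_level l as i"
    from ij(3) show "g $$ (i, j) = 0"
    proof (cases rule: flag_level_separated)
      case (1 k)
      from 1(1) have "(\<lambda>v. g *\<^sub>v v) ` std_flag l as k \<subseteq> std_flag l as k" using * by simp
      from this[unfolded flag_stable_iff[OF g], rule_format, OF ij(1,2) 1(2,3)] show ?thesis .
    next
      case (2 k)
      let ?s = "sum_list (take k as)"
      have s: "?s \<le> l" using sum_list_take_le[of k as] r_le by simp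
      have d: "2 * l - Suc j < 2 * l" "2 * l - Suc i < 2 * l" "2 * l - Suc i < ?s" "?s \<le> 2 * l - Suc j"
        using 2 ij s by linarith+
      from 2(1) have "(\<lambda>v. L.adj g *\<^sub>v v) ` std_flag l as k \<subseteq> std_flag l as k" using * by simp
      from this[unfolded flag_stable_iff[OF L.adj_carrier], rule_format, OF d]
      have "L.adj g $$ (2 * l - Suc j, 2 * l - Suc i) = 0" .
      then show ?thesis using ij by (simp add: L.adj_entry L.sg_def split: if_splits)
    qed
  qed
qed

text \<open>Equality of each image with the flag member makes the inverse \<open>adj g\<close>
  preserve the flag too; conversely, inclusions for \<open>g\<close> and for \<open>adj g\<close>
  give equality.\<close>

lemma parabolic_group_eq: "parabolic_group l as = L.Pg"
proof
  show "parabolic_group l as \<subseteq> L.Pg"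
  proof
    fix g assume g: "g \<in> parabolic_group l as"
    have gS: "g \<in> L.Sp" and im: "\<And>k. k \<le> length as \<Longrightarrow> (\<lambda>v. g *\<^sub>v v) ` std_flag l as k = std_flag l as k"
      using g by (auto simp: parabolic_group_def L.Sp_group_eq)
    have gM: "g \<in> carrier_mat (2 * l) (2 * l)" using gS by (rule L.Sp_M)
    have "(\<lambda>v. L.adj g *\<^sub>v v) ` std_flag l as k \<subseteq> std_flag l as k" if k: "k \<le> length as" for k
    proof clarify
      fix w assume "w \<in> std_flag l as k"
      then obtain v where v: "v \<in> std_flag l as k" "w = g *\<^sub>v v" using im[OF k] by blast
      have vc: "v \<in> carrier_vec (2 * l)" using v by (simp add: std_flag_def)
      have "L.adj g *\<^sub>v w = (L.adj g * g) *\<^sub>v v" using gM vc v by (simp add: assoc_mult_mat_vec[of _ "2 * l" "2 * l" _ "2 * l"])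
      then show "L.adj g *\<^sub>v w \<in> std_flag l as k" using v vc by (simp add: L.Sp_adj_left[OF gS])
    qed
    then have "L.UT g" using UT_iff_flag[OF gM] im by blast
    then show "g \<in> L.Pg" using gS by (simp add: L.Pg_def)
  qed
  show "L.Pg \<subseteq> parabolic_group l as"
  proof
    fix g assume g: "g \<in> L.Pg"
    have gS: "g \<in> L.Sp" and gM: "g \<in> carrier_mat (2 * l) (2 * l)" using g by (auto simp: L.Pg_Sp L.Pg_M)
    have st: "(\<lambda>v. g *\<^sub>v v) ` std_flag l as k \<subseteq> std_flag l as k"
      "(\<lambda>v. L.adj g *\<^sub>v v) ` std_flag l as k \<subseteq> std_flag l as k" if "k \<le> length as" for k
      using UT_iff_flag[OF gM] L.Pg_UT[OF g] that by blast+
    have "std_flag l as k \<subseteq> (\<lambda>v. g *\<^sub>v v) ` std_flag l as k" if k: "k \<le> length as" for k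
    proof
      fix w assume w: "w \<in> std_flag l as k"
      have wc: "w \<in> carrier_vec (2 * l)" using w by (simp add: std_flag_def)
      have "g *\<^sub>v (L.adj g *\<^sub>v w) = (g * L.adj g) *\<^sub>v w" using gM wc by (simp add: assoc_mult_mat_vec[of _ "2 * l" "2 * l" _ "2 * l"])
      then have "w = g *\<^sub>v (L.adj g *\<^sub>v w)" using wc by (simp add: L.Sp_adj_right[OF gS])
      moreover have "L.adj g *\<^sub>v w \<in> std_flag l as k" using st(2)[OF k] w by blast
      ultimately show "w \<in> (\<lambda>v. g *\<^sub>v v) ` std_flag l as k" by blast
    qed
    then have "(\<lambda>v. g *\<^sub>v v) ` std_flag l as k = std_flag l as k" if "k \<le> length as" for k
      using st(1) that by blast
    then show "g \<in> parabolic_group l as" using gS by (simp add: parabolic_group_def L.Sp_group_eq)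
  qed
qed

text \<open>On \<open>sp\<close> the adjoint is \<open>- X\<close>, so stability of the flag under
  \<open>X\<close> already covers the orthogonal flag.\<close>

lemma parabolic_alg_eq: "parabolic_alg l as = L.pa"
proof -
  have "(\<forall>k\<le>length as. (\<lambda>v. X *\<^sub>v v) ` std_flag l as k \<subseteq> std_flag l as k) \<longleftrightarrow> L.UT X" if X: "X \<in> L.sp" for X
  proof -
    have XM: "X \<in> carrier_mat (2 * l) (2 * l)" using X by (rule L.sp_M)
    have mXM: "- X \<in> carrier_mat (2 * l) (2 * l)" using XM by simp
    have "(\<lambda>v. X *\<^sub>v v) ` std_flag l as k \<subseteq> std_flag l as k \<longleftrightarrow> (\<lambda>v. L.adj X *\<^sub>v v) ` std_flag l as k \<subseteq> std_flag l as k" for k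
      unfolding L.sp_adj[OF X] flag_stable_iff[OF XM] flag_stable_iff[OF mXM] using XM by auto
    then show ?thesis unfolding UT_iff_flag[OF XM] by blast
  qed
  then show ?thesis by (auto simp: parabolic_alg_def L.sp_alg_eq L.pa_def)
qed

lemma La_flag: "L.La = {X \<in> sp_alg l. (\<forall>i<2 * l. \<forall>j<2 * l. flag_level l as i \<noteq> flag_level l as j \<longrightarrow> X $$ (i, j) = 0) \<and>
    (\<forall>i<sum_list as. \<forall>j<sum_list as. X $$ (2 * l - Suc i, 2 * l - Suc j) = X $$ (i, j))}"
  using L.BD_UT unfolding L.La_def L.pa_def L.sp_alg_eq L.BD_def by auto

end

section \<open>The embedded sum of orthogonal and symplectic algebras in terms of entries\<close>

lemma sp_alg_iff:
  "X \<in> sp_alg l \<longleftrightarrow> X \<in> carrier_mat (2 * l) (2 * l) \<and> (\<forall>i<2 * l. \<forall>j<2 * l.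
     X $$ (2 * l - Suc j, 2 * l - Suc i) = (if (i < l) = (j < l) then - X $$ (i, j) else X $$ (i, j)))"
proof -
  \<comment> \<open>A trivial level structure, with \<open>r = 0\<close> and one level, gives access
    to \<open>sp_alg_eq\<close> for every \<open>l\<close>.\<close>
  interpret L: levelled l 0 0 "\<lambda>_. 0" by unfold_locales auto
  have "L.adj X = - X \<longleftrightarrow> (\<forall>i<2 * l. \<forall>j<2 * l.
     X $$ (2 * l - Suc j, 2 * l - Suc i) = (if (i < l) = (j < l) then - X $$ (i, j) else X $$ (i, j)))"
    if X: "X \<in> carrier_mat (2 * l) (2 * l)"
  proof -
    have "L.adj X = - X \<longleftrightarrow> (\<forall>i<2 * l. \<forall>j<2 * l. L.adj X $$ (i, j) = (- X) $$ (i, j))"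
      using X by (auto intro!: eq_matI)
    also have "\<dots> \<longleftrightarrow> (\<forall>i<2 * l. \<forall>j<2 * l. L.sg i * L.sg j * X $$ (2 * l - Suc j, 2 * l - Suc i) = - X $$ (i, j))"
      using X by (simp add: L.adj_entry)
    also have "\<dots> \<longleftrightarrow> (\<forall>i<2 * l. \<forall>j<2 * l.
     X $$ (2 * l - Suc j, 2 * l - Suc i) = (if (i < l) = (j < l) then - X $$ (i, j) else X $$ (i, j)))"
      by (intro all_cong1 imp_cong refl) (auto simp: L.sg_def)
    finally show ?thesis .
  qed
  then show ?thesis unfolding L.sp_alg_eq L.sp_def by auto
qed

lemma diag_block_three:
  assumes "A \<in> carrier_mat a a" "X \<in> carrier_mat m m" "C \<in> carrier_mat b b"
  shows "diag_block_mat [A, X, C] \<in> carrier_mat (a + m + b) (a + m + b)"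
    and "\<And>i j. i < a + m + b \<Longrightarrow> j < a + m + b \<Longrightarrow> diag_block_mat [A, X, C] $$ (i, j) =
      (if i < a \<and> j < a then A $$ (i, j)
       else if a \<le> i \<and> i < a + m \<and> a \<le> j \<and> j < a + m then X $$ (i - a, j - a)
       else if a + m \<le> i \<and> a + m \<le> j then C $$ (i - a - m, j - a - m) else (0::complex))"
  using assms by (auto simp: Let_def)

text \<open>Peels off the outermost pair of blocks, the first block and its dual, which is the step
  of the induction over the composition.\<close>

lemma levi_embed_Cons:
  "levi_embed (A # As) B = diag_block_mat [A, levi_embed As B, - antitranspose A]"
proof -
  have "diag_block_mat (Ys @ [C]) = diag_block_mat [diag_block_mat Ys, C]" for Ys and C :: "complex mat"
    using diag_block_mat_last[of "[diag_block_mat Ys]" C] diag_block_mat_last[of Ys C]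
    by (simp only: append.simps diag_block_mat_singleton)
  note * = this[of "As @ [B] @ rev (map (\<lambda>A. - antitranspose A) As)" "- antitranspose A"]
  have cons: "diag_block_mat (A # Ys) = diag_block_mat (A # Zs)" if "diag_block_mat Ys = diag_block_mat Zs" for Ys Zs
    unfolding diag_block_mat.simps that ..
  have "levi_embed (A # As) B = diag_block_mat (A # ((As @ [B] @ rev (map (\<lambda>A. - antitranspose A) As)) @ [- antitranspose A]))"
    unfolding levi_embed_def by (simp del: diag_block_mat.simps)
  also have "\<dots> = diag_block_mat [A, levi_embed As B, - antitranspose A]"
    unfolding levi_embed_def by (rule cons[OF *])
  finally show ?thesis .
qed

lemma so_sum_sp_Cons:
  "so_sum_sp l (a # as) = {diag_block_mat [A, X, - antitranspose A] | A X. A \<in> so_alg a \<and> X \<in> so_sum_sp (l - a) as}"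
proof -
  have "so_sum_sp l (a # as) = {levi_embed (A # As) B | A As B. A \<in> so_alg a \<and>
      list_all2 (\<lambda>A a. A \<in> so_alg a) As as \<and> B \<in> sp_alg (l - (a + sum_list as))}"
    unfolding so_sum_sp_def by (auto simp: list_all2_Cons2 simp del: diag_block_mat.simps)
  then show ?thesis unfolding levi_embed_Cons so_sum_sp_def diff_diff_left by blast
qed

text \<open>Removing the first block and its dual replaces \<open>l\<close> by \<open>l - a\<close>.
  The levels are 0 on the first block, one more than the inner levels in the middle and maximal on
  the last block, so entries between the three parts must vanish.\<close>

lemma so_sum_sp_entries:
  "sum_list as \<le> l \<Longrightarrow> so_sum_sp l as = {X \<in> sp_alg l.
    (\<forall>i<2 * l. \<forall>j<2 * l. flag_level l as i \<noteq> flag_level l as j \<longrightarrow> X $$ (i, j) = 0) \<and>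
    (\<forall>i<sum_list as. \<forall>j<sum_list as. X $$ (2 * l - Suc i, 2 * l - Suc j) = X $$ (i, j))}"
proof (induction as arbitrary: l)
  case Nil
  have "levi_embed [] B = B" for B by (simp add: levi_embed_def del: diag_block_mat.simps)
  then show ?case by (auto simp: so_sum_sp_def flag_level_Nil)
next
  case (Cons a as)
  define m where "m = l - a"
  have al: "a \<le> l" and ms: "sum_list as \<le> m" and lm: "l = a + m" using Cons.prems by (auto simp: m_def)
  let ?P = "\<lambda>l as X. (\<forall>i<2 * l. \<forall>j<2 * l. flag_level l as i \<noteq> flag_level l as j \<longrightarrow> X $$ (i, j) = 0) \<and>
    (\<forall>i<sum_list as. \<forall>j<sum_list as. X $$ (2 * l - Suc i, 2 * l - Suc j) = X $$ (i, j))"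
  have IH: "X \<in> so_sum_sp m as \<longleftrightarrow> X \<in> sp_alg m \<and> ?P m as X" for X
    using Cons.IH[OF ms] by blast
  have s: "sum_list (take k as) \<le> m" for k using sum_list_take_le[of k as] ms by simp
  let ?f = "flag_level l (a # as)"
  have fC: "?f i = flag_step l a i + (\<Sum>k<length as. flag_step l (a + sum_list (take (Suc k) as)) i)" for i
    by (rule flag_level_Cons[OF al])
  have f1: "?f i = 0" if "i < a" for i
  proof -
    have "flag_step l (a + sum_list (take k as)) i = 0" for k
      using that s[of k] lm by (simp add: flag_step_def)
    then show ?thesis using that lm unfolding fC by (simp add: flag_step_def)
  qed
  have f2: "?f (i + a) = Suc (flag_level m as i)" if "i < 2 * m" for i
  proof -
    have "flag_step l (a + sum_list (take k as)) (i + a) = flag_step m (sum_list (take k as)) i" for k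
    proof -
      have "a + sum_list (take k as) \<le> i + a \<longleftrightarrow> sum_list (take k as) \<le> i"
        "2 * l - (a + sum_list (take k as)) \<le> i + a \<longleftrightarrow> 2 * m - sum_list (take k as) \<le> i"
        using s[of k] lm by linarith+
      then show ?thesis by (simp add: flag_step_def)
    qed
    moreover have "flag_step l a (i + a) = 1" using that lm by (simp add: flag_step_def)
    ultimately show ?thesis unfolding fC by (simp add: flag_level_def)
  qed
  have f3: "?f i = 2 * Suc (length as)" if "2 * l - a \<le> i" for i
  proof -
    have "flag_step l (a + sum_list (take k as)) i = 2" for k
      using that s[of k] lm by (simp add: flag_step_def)
    moreover have "flag_step l a i = 2" using that lm by (simp add: flag_step_def)
    ultimately show ?thesis unfolding fC by simp
  qed
  have f2': "flag_level m as i \<le> 2 * length as" for i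
  proof -
    have "flag_level m as i \<le> (\<Sum>k<length as. 2)" unfolding flag_level_def by (intro sum_mono) (simp add: flag_step_def)
    then show ?thesis by simp
  qed
  show ?case
  proof (intro equalityI subsetI CollectI)
    fix D assume "D \<in> so_sum_sp l (a # as)"
    then obtain A X where D: "D = diag_block_mat [A, X, - antitranspose A]" and A: "A \<in> so_alg a"
      and X: "X \<in> so_sum_sp m as" unfolding so_sum_sp_Cons m_def by blast
    have AM: "A \<in> carrier_mat a a" and As: "\<And>i j. i < a \<Longrightarrow> j < a \<Longrightarrow> A $$ (i, j) = - A $$ (j, i)"
    proof -
      show AM: "A \<in> carrier_mat a a" using A by (simp add: so_alg_def)
      fix i j assume ij: "i < a" "j < a"
      have "transpose_mat A $$ (j, i) = (- A) $$ (j, i)" using A by (simp add: so_alg_def)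
      then show "A $$ (i, j) = - A $$ (j, i)" using ij AM by simp
    qed
    have Xsp: "X \<in> sp_alg m" and XP: "?P m as X" using X IH by auto
    have XM: "X \<in> carrier_mat (2 * m) (2 * m)" using Xsp by (simp add: sp_alg_iff)
    have CM: "- antitranspose A \<in> carrier_mat a a" using AM by (simp add: antitranspose_def)
    have n: "2 * l = a + 2 * m + a" using lm by simp
    note DM = diag_block_three(1)[OF AM XM CM, folded D n]
    \<comment> \<open>As \<open>A\<close> is skew, minus its antitranspose is its mirror image under
      reversal of both indices; this describes the last block.\<close>
    have De: "D $$ (i, j) = (if i < a \<and> j < a then A $$ (i, j)
       else if a \<le> i \<and> i < a + 2 * m \<and> a \<le> j \<and> j < a + 2 * m then X $$ (i - a, j - a)
       else if a + 2 * m \<le> i \<and> a + 2 * m \<le> j then A $$ (2 * l - Suc i, 2 * l - Suc j) else 0)"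
      if ij: "i < 2 * l" "j < 2 * l" for i j
    proof -
      have "(- antitranspose A) $$ (i - a - 2 * m, j - a - 2 * m) = A $$ (2 * l - Suc i, 2 * l - Suc j)"
        if c: "a + 2 * m \<le> i" "a + 2 * m \<le> j"
      proof -
        have b: "i - a - 2 * m < a" "j - a - 2 * m < a" using c ij lm by linarith+
        have e: "a - 1 - (i - a - 2 * m) = 2 * l - Suc i" "a - 1 - (j - a - 2 * m) = 2 * l - Suc j"
          using c ij lm by linarith+
        have "(- antitranspose A) $$ (i - a - 2 * m, j - a - 2 * m) = - A $$ (2 * l - Suc j, 2 * l - Suc i)"
          using b AM e by (simp add: antitranspose_def)
        also have "\<dots> = A $$ (2 * l - Suc i, 2 * l - Suc j)"
          using As[of "2 * l - Suc i" "2 * l - Suc j"] c ij lm by simp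
        finally show ?thesis .
      qed
      then show ?thesis using diag_block_three(2)[OF AM XM CM, of i j, folded D n] ij by auto
    qed
    have "D \<in> sp_alg l" unfolding sp_alg_iff
    proof (intro conjI DM allI impI)
      fix i j assume ij: "i < 2 * l" "j < 2 * l"
      have d: "2 * l - Suc j < 2 * l" "2 * l - Suc i < 2 * l" using ij by linarith+
      consider (1) "i < a" "j < a" | (2) "a \<le> i" "i < a + 2 * m" "a \<le> j" "j < a + 2 * m"
        | (3) "a + 2 * m \<le> i" "a + 2 * m \<le> j"
        | (4) "\<not> (i < a \<and> j < a)" "\<not> (a \<le> i \<and> i < a + 2 * m \<and> a \<le> j \<and> j < a + 2 * m)" "\<not> (a + 2 * m \<le> i \<and> a + 2 * m \<le> j)"
        by linarith
      then show "D $$ (2 * l - Suc j, 2 * l - Suc i) = (if (i < l) = (j < l) then - D $$ (i, j) else D $$ (i, j))"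
      proof cases
        case 1
        have c: "a + 2 * m \<le> 2 * l - Suc j" "a + 2 * m \<le> 2 * l - Suc i" "i < l" "j < l"
          "2 * l - Suc (2 * l - Suc i) = i" "2 * l - Suc (2 * l - Suc j) = j" using 1 lm by linarith+
        have nn: "\<not> (2 * l - Suc j < a)" "\<not> (2 * l - Suc j < a + 2 * m)" using c by linarith+
        show ?thesis unfolding De[OF d] De[OF ij] using 1 c nn As[OF 1] As[OF 1(2,1)] by simp
      next
        case 2
        have c: "a \<le> 2 * l - Suc j" "2 * l - Suc j < a + 2 * m" "a \<le> 2 * l - Suc i" "2 * l - Suc i < a + 2 * m"
          "2 * l - Suc j - a = 2 * m - Suc (j - a)" "2 * l - Suc i - a = 2 * m - Suc (i - a)"
          "i - a < 2 * m" "j - a < 2 * m" "i < l \<longleftrightarrow> i - a < m" "j < l \<longleftrightarrow> j - a < m" using 2 lm by linarith+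
        have "X $$ (2 * m - Suc (j - a), 2 * m - Suc (i - a)) =
            (if (i - a < m) = (j - a < m) then - X $$ (i - a, j - a) else X $$ (i - a, j - a))"
          using Xsp c(7,8) unfolding sp_alg_iff by blast
        then show ?thesis unfolding De[OF d] De[OF ij] using 2 c by simp
      next
        case 3
        have c: "2 * l - Suc j < a" "2 * l - Suc i < a" "\<not> i < l" "\<not> j < l" "\<not> i < a" "\<not> i < a + 2 * m"
          using 3 lm ij by linarith+
        show ?thesis unfolding De[OF d] De[OF ij] using 3 c As[OF c(1,2)] by simp
      next
        case 4
        have e: "\<And>k. k < 2 * l \<Longrightarrow> 2 * l - Suc k < a \<longleftrightarrow> a + 2 * m \<le> k"
          "\<And>k. k < 2 * l \<Longrightarrow> a + 2 * m \<le> 2 * l - Suc k \<longleftrightarrow> k < a"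
          "\<And>k. k < 2 * l \<Longrightarrow> a \<le> 2 * l - Suc k \<and> 2 * l - Suc k < a + 2 * m \<longleftrightarrow> a \<le> k \<and> k < a + 2 * m"
          using lm by linarith+
        have "D $$ (i, j) = 0" unfolding De[OF ij] using 4 by argo
        moreover have "D $$ (2 * l - Suc j, 2 * l - Suc i) = 0"
        proof -
          have "\<not> (2 * l - Suc j < a \<and> 2 * l - Suc i < a)"
            "\<not> (a \<le> 2 * l - Suc j \<and> 2 * l - Suc j < a + 2 * m \<and> a \<le> 2 * l - Suc i \<and> 2 * l - Suc i < a + 2 * m)"
            "\<not> (a + 2 * m \<le> 2 * l - Suc j \<and> a + 2 * m \<le> 2 * l - Suc i)"
            using 4 e[OF ij(1)] e[OF ij(2)] by blast+
          then show ?thesis unfolding De[OF d] by argo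
        qed
        ultimately show ?thesis by simp
      qed
    qed
    moreover have "D $$ (i, j) = 0" if ij: "i < 2 * l" "j < 2 * l" "?f i \<noteq> ?f j" for i j
    proof -
      have n1: "\<not> (i < a \<and> j < a)" using ij(3) f1 by auto
      have n3: "\<not> (a + 2 * m \<le> i \<and> a + 2 * m \<le> j)" using ij(3) f3 lm by auto
      show ?thesis
      proof (cases "a \<le> i \<and> i < a + 2 * m \<and> a \<le> j \<and> j < a + 2 * m")
        case True
        then have c: "i - a < 2 * m" "j - a < 2 * m" by linarith+
        then have "flag_level m as (i - a) \<noteq> flag_level m as (j - a)"
          using ij(3) f2[of "i - a"] f2[of "j - a"] True by auto
        then have "X $$ (i - a, j - a) = 0" using XP c by blast
        then show ?thesis unfolding De[OF ij(1,2)] using True n1 by auto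
      qed (use n1 n3 De[OF ij(1,2)] in argo)
    qed
    moreover have "D $$ (2 * l - Suc i, 2 * l - Suc j) = D $$ (i, j)"
      if ij: "i < sum_list (a # as)" "j < sum_list (a # as)" for i j
    proof -
      have il: "i < l" "j < l" using ij ms lm by auto
      have d: "2 * l - Suc i < 2 * l" "2 * l - Suc j < 2 * l" "i < 2 * l" "j < 2 * l" using il by linarith+
      have e: "\<And>k. k < l \<Longrightarrow> \<not> 2 * l - Suc k < a" "\<And>k. k < l \<Longrightarrow> \<not> a + 2 * m \<le> k" 
         "\<And>k. k < l \<Longrightarrow> a + 2 * m \<le> 2 * l - Suc k \<longleftrightarrow> k < a" "\<And>k. k < l \<Longrightarrow> 2 * l - Suc k < a + 2 * m \<longleftrightarrow> \<not> k < a"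
         "\<And>k. k < l \<Longrightarrow> 2 * l - Suc (2 * l - Suc k) = k" "\<And>k. k < l \<Longrightarrow> a \<le> 2 * l - Suc k"
         "\<And>k. k < l \<Longrightarrow> k < a + 2 * m"
        using lm by linarith+
      have "X $$ (2 * l - Suc i - a, 2 * l - Suc j - a) = X $$ (i - a, j - a)" if c: "\<not> i < a" "\<not> j < a"
      proof -
        have ij': "i < a + sum_list as" "j < a + sum_list as" using ij by auto
        have "2 * l - Suc i - a = 2 * m - Suc (i - a)" "2 * l - Suc j - a = 2 * m - Suc (j - a)"
          "i - a < sum_list as" "j - a < sum_list as"
          using c il lm ij' by linarith+
        then show ?thesis using XP by simp
      qed
      then show ?thesis unfolding De[OF d(1,2)] De[OF d(3,4)] using e[OF il(1)] e[OF il(2)]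
        by (cases "i < a"; cases "j < a") simp_all
    qed
    ultimately show "D \<in> sp_alg l \<and> ?P l (a # as) D" by blast
  next
    fix D assume "D \<in> {X \<in> sp_alg l. ?P l (a # as) X}"
    then have Dsp: "D \<in> sp_alg l" and D0: "\<And>i j. i < 2 * l \<Longrightarrow> j < 2 * l \<Longrightarrow> ?f i \<noteq> ?f j \<Longrightarrow> D $$ (i, j) = 0"
      and Dd: "\<And>i j. i < a + sum_list as \<Longrightarrow> j < a + sum_list as \<Longrightarrow> D $$ (2 * l - Suc i, 2 * l - Suc j) = D $$ (i, j)"
      by auto
    have DM: "D \<in> carrier_mat (2 * l) (2 * l)" using Dsp by (simp add: sp_alg_iff)
    have Ds: "D $$ (2 * l - Suc j, 2 * l - Suc i) = (if (i < l) = (j < l) then - D $$ (i, j) else D $$ (i, j))"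
      if "i < 2 * l" "j < 2 * l" for i j using Dsp that unfolding sp_alg_iff by blast
    define A where "A = mat a a (\<lambda>(i, j). D $$ (i, j))"
    define X where "X = mat (2 * m) (2 * m) (\<lambda>(i, j). D $$ (i + a, j + a))"
    have AM: "A \<in> carrier_mat a a" and XM: "X \<in> carrier_mat (2 * m) (2 * m)" by (auto simp: A_def X_def)
    \<comment> \<open>The symplectic relation and the mirror relation evaluate the same entry of the
      last block; comparing them makes the first block skew.\<close>
    have As: "D $$ (j, i) = - D $$ (i, j)" if "i < a" "j < a" for i j
      using Ds[of i j] Dd[of j i] that lm by simp
    have A: "A \<in> so_alg a"
      unfolding so_alg_def
    proof (intro CollectI conjI AM eq_matI)
      fix i j assume "i < dim_row (- A)" "j < dim_col (- A)"
      then have ij: "i < a" "j < a" using AM by auto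
      then show "transpose_mat A $$ (i, j) = (- A) $$ (i, j)" using As[OF ij] by (simp add: A_def)
    qed (use AM in auto)
    have "X \<in> sp_alg m" unfolding sp_alg_iff
    proof (intro conjI XM allI impI)
      fix i j assume ij: "i < 2 * m" "j < 2 * m"
      have c: "i + a < 2 * l" "j + a < 2 * l" "2 * l - Suc (j + a) = 2 * m - Suc j + a" "2 * l - Suc (i + a) = 2 * m - Suc i + a"
        "i + a < l \<longleftrightarrow> i < m" "j + a < l \<longleftrightarrow> j < m" "2 * m - Suc j < 2 * m" "2 * m - Suc i < 2 * m"
        using ij lm by linarith+
      show "X $$ (2 * m - Suc j, 2 * m - Suc i) = (if (i < m) = (j < m) then - X $$ (i, j) else X $$ (i, j))"
        using Ds[OF c(1,2)] ij c by (simp add: X_def)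
    qed
    moreover have "?P m as X"
    proof (intro conjI allI impI)
      fix i j assume ij: "i < 2 * m" "j < 2 * m" "flag_level m as i \<noteq> flag_level m as j"
      have "D $$ (i + a, j + a) = 0"
      proof (rule D0)
        show "i + a < 2 * l" "j + a < 2 * l" using ij lm by linarith+
        show "?f (i + a) \<noteq> ?f (j + a)" using f2[OF ij(1)] f2[OF ij(2)] ij(3) by simp
      qed
      then show "X $$ (i, j) = 0" using ij by (simp add: X_def)
    next
      fix i j assume ij: "i < sum_list as" "j < sum_list as"
      have c: "2 * l - Suc (j + a) = 2 * m - Suc j + a" "2 * l - Suc (i + a) = 2 * m - Suc i + a"
        "2 * m - Suc j < 2 * m" "2 * m - Suc i < 2 * m" "i < 2 * m" "j < 2 * m"
        using ij ms lm by linarith+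
      show "X $$ (2 * m - Suc i, 2 * m - Suc j) = X $$ (i, j)"
        using Dd[of "i + a" "j + a"] ij c by (simp add: X_def)
    qed
    ultimately have X: "X \<in> so_sum_sp m as" using IH by blast
    have CM: "- antitranspose A \<in> carrier_mat a a" using AM by (simp add: antitranspose_def)
    have n: "2 * l = a + 2 * m + a" using lm by simp
    note B = diag_block_three[OF AM XM CM, folded n]
    have "D = diag_block_mat [A, X, - antitranspose A]"
    proof (rule eq_matI)
      show "dim_row D = dim_row (diag_block_mat [A, X, - antitranspose A])"
        "dim_col D = dim_col (diag_block_mat [A, X, - antitranspose A])" using DM B(1) by auto
      fix i j assume "i < dim_row (diag_block_mat [A, X, - antitranspose A])"
        "j < dim_col (diag_block_mat [A, X, - antitranspose A])"
      then have ij: "i < 2 * l" "j < 2 * l" using B(1) by auto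
      have "a + 2 * m = 2 * l - a" using lm by simp
      \<comment> \<open>The extreme levels characterise the outer blocks, so two indices of equal
        level lie in the same one of the three parts.\<close>
      have F: "?f i = 0 \<longleftrightarrow> i < a" "?f i = 2 * Suc (length as) \<longleftrightarrow> a + 2 * m \<le> i" if "i < 2 * l" for i
      proof -
        consider "i < a" | "a \<le> i" "i < a + 2 * m" | "a + 2 * m \<le> i" by linarith
        then have "(?f i = 0 \<longleftrightarrow> i < a) \<and> (?f i = 2 * Suc (length as) \<longleftrightarrow> a + 2 * m \<le> i)"
        proof cases
          case 1
          then show ?thesis using f1[OF 1] by simp
        next
          case 2
          then have "?f i = Suc (flag_level m as (i - a))" using f2[of "i - a"] by simp
          then show ?thesis using 2 f2'[of "i - a"] by simp
        next
          case 3
          then show ?thesis using f3[of i] lm by simp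
        qed
        then show "?f i = 0 \<longleftrightarrow> i < a" "?f i = 2 * Suc (length as) \<longleftrightarrow> a + 2 * m \<le> i" by auto
      qed
      consider (1) "i < a" "j < a" | (2) "a \<le> i" "i < a + 2 * m" "a \<le> j" "j < a + 2 * m"
        | (3) "a + 2 * m \<le> i" "a + 2 * m \<le> j" "\<not> i < a"
        | (4) "\<not> (i < a \<and> j < a)" "\<not> (a \<le> i \<and> i < a + 2 * m \<and> a \<le> j \<and> j < a + 2 * m)" "\<not> (a + 2 * m \<le> i \<and> a + 2 * m \<le> j)"
        by linarith
      then show "D $$ (i, j) = diag_block_mat [A, X, - antitranspose A] $$ (i, j)"
      proof cases
        case 1
        then show ?thesis unfolding B(2)[OF ij] by (simp add: A_def)
      next
        case 2
        then show ?thesis unfolding B(2)[OF ij] by (simp add: X_def)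
      next
        case 3
        have b: "i - a - 2 * m < a" "j - a - 2 * m < a" using 3 ij lm by linarith+
        have e: "a - 1 - (i - a - 2 * m) = 2 * l - Suc i" "a - 1 - (j - a - 2 * m) = 2 * l - Suc j"
          "2 * l - Suc i < a" "2 * l - Suc j < a" "2 * l - Suc (2 * l - Suc i) = i" "2 * l - Suc (2 * l - Suc j) = j"
          using 3 ij lm by linarith+
        have "(- antitranspose A) $$ (i - a - 2 * m, j - a - 2 * m) = - D $$ (2 * l - Suc j, 2 * l - Suc i)"
          using b AM e by (simp add: antitranspose_def A_def)
        also have "\<dots> = D $$ (2 * l - Suc i, 2 * l - Suc j)" using As[OF e(4,3)] As[OF e(3,4)] by simp
        also have "\<dots> = D $$ (i, j)" using Dd[of "2 * l - Suc i" "2 * l - Suc j"] e by simp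
        finally have "D $$ (i, j) = (- antitranspose A) $$ (i - a - 2 * m, j - a - 2 * m)" by simp
        moreover have "\<not> i < a + 2 * m" using 3 by simp
        ultimately show ?thesis unfolding B(2)[OF ij] using 3 by simp
      next
        case 4
        have "diag_block_mat [A, X, - antitranspose A] $$ (i, j) = 0" unfolding B(2)[OF ij] using 4 by argo
        moreover have "?f i \<noteq> ?f j"
        proof
          assume e: "?f i = ?f j"
          show False using 4 F[OF ij(1)] F[OF ij(2)] unfolding e by linarith
        qed
        ultimately show ?thesis using D0[OF ij] by simp
      qed
    qed
    then show "D \<in> so_sum_sp l (a # as)" unfolding so_sum_sp_Cons using A X m_def by blast
  qed
qed

theorem theorem5p6:
  fixes l r :: nat and as :: "nat list"
  assumes "1 \<le> l"
    and "\<forall>a\<in>set as. 1 \<le> a"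
    and "sum_list as = r"
    and "1 \<le> r" and "r \<le> l"
  shows "lie_algebra (2 * l) (parabolic_group l as) = parabolic_alg l as \<and>
    M_star (2 * l) (parabolic_group l as) = conj_class (parabolic_group l as) (so_sum_sp l as)"
proof -
  have r: "sum_list as \<le> l" using assms by simp
  interpret L: levelled l "sum_list as" "length as" "flag_level l as" by (rule levelled_flag[OF r])
  show ?thesis
    unfolding parabolic_group_eq[OF r] parabolic_alg_eq[OF r] so_sum_sp_entries[OF r] La_flag[OF r, symmetric]
    using L.lie_Pg L.M_star_eq by blast
qed

end
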